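(* Let $n\ge2$, $1\le p,q<\infty$, let $u,v$ be weights on $\mathbb{R}^n$, and let $T$ be any one of the following operators: $M$ or a $k$-fold iteration $M^k$ ($k\in\mathbb{N}$); $M_{L^{n',1}}$; $\mathcal M_{\mathbb{S}^{n-1}}$; $M_\Omega$ with $\Omega\in L^{n,\infty}(\mathbb{S}^{n-1})$; $T_\Omega$ or $T^\star_\Omega$ with $\Omega\in L^{n,\infty}(\mathbb{S}^{n-1})$ of mean zero on $\mathbb{S}^{n-1}$ (all these operators are defined in the context). Then there is a constant $C$, independent of $f$, $u$ and $v$, such that the following hold. (1) If $I_1:L^p(v)\to L^q(u)$ is bounded, then $T:\dot W^{1,p}(v)\to L^q(u)$ with $$\|Tf\|_{L^q(u)}\le C\,\|I_1\|_{\mathcal B(L^p(v),L^q(u))}\,\|\nabla f\|_{L^p(v)}.$$ (2) If $I_1:L^p(v)\to L^{q,\infty}(u)$ is bounded, then $T:\dot W^{1,p}(v)\to L^{q,\infty}(u)$ with $$\|Tf\|_{L^{q,\infty}(u)}\le C\,\|I_1\|_{\mathcal B(L^p(v),L^{q,\infty}(u))}\,\|\nabla f\|_{L^p(v)}.$$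
   Context: A weight is a nonnegative locally integrable function; $\|f\|_{L^q(u)}=(\int|f|^q u\,dx)^{1/q}$ and $\|f\|_{L^{q,\infty}(u)}=\sup_{t>0}t\,u(\{|f|>t\})^{1/q}$, where $u(E)=\int_E u\,dx$. $\|I_1\|_{\mathcal B(X,Y)}$ is the operator norm of $I_1:X\to Y$, where $I_1g(x)=\int_{\mathbb{R}^n}\frac{g(y)}{|x-y|^{n-1}}\,dy$. The homogeneous weighted Sobolev space $\dot W^{1,p}(v)$ is the closure of $C_c^\infty(\mathbb{R}^n)$ in the semi-norm $\|\nabla f\|_{L^p(v)}$; the action of $T$ on $\dot W^{1,p}(v)$ is understood as the extension by density of its action on $C_c^\infty(\mathbb{R}^n)$. Notation: $n'=\frac n{n-1}$; $Q$ denotes cubes with sides parallel to the axes; $\sigma$ is surface measure on $\mathbb{S}^{n-1}$; $\Omega$ is homogeneous of degree zero on $\mathbb{R}^n\setminus\{0\}$, and $\Omega\in L^{n,\infty}(\mathbb{S}^{n-1})$ means $\sup_{t>0}t\,\sigma(\{y'\in\mathbb{S}^{n-1}:|\Omega(y')|>t\})^{1/n}<\infty$. Operators: - Hardy–Littlewood maximal operator $Mf(x)=\sup_{Q\ni x}\frac1{|Q|}\int_Q|f|$, and $M^k$ its $k$-fold composition. - Lorentz maximal operator $M_{L^{n',1}}f(x)=\sup_{Q\ni x}\|f\|_{L^{n',1}(Q)}$, where $\|f\|_{L^{n',1}(Q)}=|Q|^{-1/n'}\,n'\int_0^\infty|\{y\in Q:|f(y)|>t\}|^{1/n'}\,dt$.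 - Spherical maximal operator $\mathcal M_{\mathbb{S}^{n-1}}f(x)=\sup_{t>0}\left|\int_{\mathbb{S}^{n-1}}f(x-ty')\,d\sigma(y')\right|$. - Rough maximal operator $M_\Omega f(x)=\sup_{t>0}\frac1{t^n}\int_{|y|<t}|\Omega(y)f(x-y)|\,dy$. - Rough singular integral $T_\Omega f(x)=\mathrm{p.v.}\int_{\mathbb{R}^n}\frac{\Omega(y)}{|y|^n}f(x-y)\,dy$. - Maximal rough singular integral $T^\star_\Omega f(x)=\sup_{t>0}\left|\int_{|y|>t}\frac{\Omega(y)}{|y|^n}f(x-y)\,dy\right|$. *)

theory Defs
  imports "HOL-Analysis.Analysis"
begin

section \<open>Lebesgue and weak Lebesgue spaces\<close>

definition epowr :: "ennreal \<Rightarrow> real \<Rightarrow> ennreal" where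
  "epowr x a = (if x = \<infinity> then \<infinity> else ennreal (enn2real x powr a))"
  \<comment> \<open>only used with exponents \<open>a > 0\<close>\<close>

type_synonym 'a fun_norm = "'a measure \<Rightarrow> ('a \<Rightarrow> ereal) \<Rightarrow> ennreal"

definition Lq_norm :: "real \<Rightarrow> 'a fun_norm" where
  "Lq_norm q M F = epowr (\<integral>\<^sup>+ x. epowr (e2ennreal \<bar>F x\<bar>) q \<partial>M) (1 / q)"

definition weak_Lq_norm :: "real \<Rightarrow> 'a fun_norm" where
  "weak_Lq_norm q M F =
     (SUP t\<in>{0<..}. ennreal t * epowr (emeasure M {x \<in> space M. ereal t < \<bar>F x\<bar>}) (1 / q))"

definition fun_space :: "'a fun_norm \<Rightarrow> 'a measure \<Rightarrow> ('a \<Rightarrow> ereal) set" where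
  "fun_space N M = {F \<in> borel_measurable M. N M F < \<infinity>}"

definition weight :: "(real ^ 'n \<Rightarrow> real) \<Rightarrow> bool" where
  "weight w \<longleftrightarrow> (\<forall>x. 0 \<le> w x) \<and> (\<forall>K. compact K \<longrightarrow> set_integrable lebesgue K w)"

definition weighted :: "(real ^ 'n \<Rightarrow> real) \<Rightarrow> (real ^ 'n) measure" where
  "weighted w = density lebesgue (\<lambda>x. ennreal (w x))"


section \<open>The Riesz potential of order one and its operator norm\<close>

definition I1_kernel :: "(real ^ 'n \<Rightarrow> real) \<Rightarrow> real ^ 'n \<Rightarrow> real ^ 'n \<Rightarrow> real" where
  "I1_kernel g x y = g y / norm (x - y) ^ (CARD('n) - 1)"

definition I1 :: "(real ^ 'n \<Rightarrow> real) \<Rightarrow> real ^ 'n \<Rightarrow> real" where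
  "I1 g x = (LINT y|lebesgue. I1_kernel g x y)"

text \<open>
  \<open>A\<close> bounds \<open>I1\<close> from \<open>L^p(v)\<close> to the space with norm \<open>N\<close> over \<open>u dx\<close>. The almost everywhere
  clause says that the integral defining \<open>I1 g\<close> converges absolutely for \<open>u dx\<close>-almost every point;
  without it, the Bochner integral would silently be \<open>0\<close> at the other points.
\<close>
definition I1_bound :: "real \<Rightarrow> (real ^ 'n \<Rightarrow> real) \<Rightarrow> (real ^ 'n) fun_norm \<Rightarrow> (real ^ 'n \<Rightarrow> real)
    \<Rightarrow> real \<Rightarrow> bool" where
  "I1_bound p v N u A \<longleftrightarrow> 0 \<le> A \<and>
     (\<forall>g. (\<lambda>x. ereal (g x)) \<in> fun_space (Lq_norm p) (weighted v) \<longrightarrow>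
        (AE x in weighted u. integrable lebesgue (I1_kernel g x)) \<and>
        (\<lambda>x. ereal (I1 g x)) \<in> fun_space N (weighted u) \<and>
        N (weighted u) (\<lambda>x. ereal (I1 g x))
          \<le> ennreal A * Lq_norm p (weighted v) (\<lambda>x. ereal (g x)))"

definition I1_bounded :: "real \<Rightarrow> (real ^ 'n \<Rightarrow> real) \<Rightarrow> (real ^ 'n) fun_norm \<Rightarrow> (real ^ 'n \<Rightarrow> real)
    \<Rightarrow> bool" where
  "I1_bounded p v N u \<longleftrightarrow> (\<exists>A. I1_bound p v N u A)"

definition I1_norm :: "real \<Rightarrow> (real ^ 'n \<Rightarrow> real) \<Rightarrow> (real ^ 'n) fun_norm \<Rightarrow> (real ^ 'n \<Rightarrow> real)
    \<Rightarrow> ennreal" where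
  "I1_norm p v N u = Inf {ennreal A | A. I1_bound p v N u A}"


section \<open>Test functions and the homogeneous weighted Sobolev space\<close>

definition partial :: "'n \<Rightarrow> (real ^ 'n \<Rightarrow> real) \<Rightarrow> real ^ 'n \<Rightarrow> real" where
  "partial i f x = frechet_derivative f (at x) (axis i 1)"

definition grad :: "(real ^ 'n \<Rightarrow> real) \<Rightarrow> real ^ 'n \<Rightarrow> real ^ 'n" where
  "grad f x = (\<chi> i. partial i f x)"

primrec Ck :: "nat \<Rightarrow> (real ^ 'n \<Rightarrow> real) \<Rightarrow> bool" where
  "Ck 0 f \<longleftrightarrow> continuous_on UNIV f"
| "Ck (Suc k) f \<longleftrightarrow> (\<forall>x. f differentiable at x) \<and> (\<forall>i. Ck k (partial i f))"

definition test_fun :: "(real ^ 'n \<Rightarrow> real) \<Rightarrow> bool" where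
  "test_fun f \<longleftrightarrow> (\<forall>k. Ck k f) \<and> compact (closure {x. f x \<noteq> 0})"

definition grad_norm :: "real \<Rightarrow> (real ^ 'n \<Rightarrow> real) \<Rightarrow> (real ^ 'n \<Rightarrow> real) \<Rightarrow> ennreal" where
  "grad_norm p v f = Lq_norm p (weighted v) (\<lambda>x. ereal (norm (grad f x)))"

text \<open>
  The closure of the test functions in the semi-norm \<open>grad_norm p v\<close>, as the abstract completion:
  its elements are the equivalence classes of Cauchy sequences of test functions.
\<close>
definition sobolev_Cauchy :: "real \<Rightarrow> (real ^ 'n \<Rightarrow> real) \<Rightarrow> (nat \<Rightarrow> real ^ 'n \<Rightarrow> real) \<Rightarrow> bool" where
  "sobolev_Cauchy p v \<phi> \<longleftrightarrow> (\<forall>j. test_fun (\<phi> j)) \<and>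
     (\<forall>\<epsilon>>0. \<exists>J. \<forall>i\<ge>J. \<forall>j\<ge>J. grad_norm p v (\<lambda>x. \<phi> i x - \<phi> j x) < ennreal \<epsilon>)"

definition sobolev_rel :: "real \<Rightarrow> (real ^ 'n \<Rightarrow> real)
    \<Rightarrow> ((nat \<Rightarrow> real ^ 'n \<Rightarrow> real) \<times> (nat \<Rightarrow> real ^ 'n \<Rightarrow> real)) set" where
  "sobolev_rel p v = {(\<phi>, \<psi>). sobolev_Cauchy p v \<phi> \<and> sobolev_Cauchy p v \<psi> \<and>
     (\<lambda>j. grad_norm p v (\<lambda>x. \<phi> j x - \<psi> j x)) \<longlonglongrightarrow> 0}"

definition sobolev :: "real \<Rightarrow> (real ^ 'n \<Rightarrow> real) \<Rightarrow> (nat \<Rightarrow> real ^ 'n \<Rightarrow> real) set set" where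
  "sobolev p v = {\<phi>. sobolev_Cauchy p v \<phi>} // sobolev_rel p v"

definition sobolev_norm :: "real \<Rightarrow> (real ^ 'n \<Rightarrow> real) \<Rightarrow> (nat \<Rightarrow> real ^ 'n \<Rightarrow> real) set
    \<Rightarrow> ennreal" where
  "sobolev_norm p v F = (THE l. \<forall>\<phi>\<in>F. (\<lambda>j. grad_norm p v (\<phi> j)) \<longlonglongrightarrow> l)"

type_synonym 'n operator = "(real ^ 'n \<Rightarrow> real) \<Rightarrow> real ^ 'n \<Rightarrow> ereal"

text \<open>
  \<open>h\<close> is the value at \<open>F\<close> of the extension by density of \<open>T\<close>. Where \<open>T (\<phi> j) x\<close> is infinite, the
  difference below is infinite, because \<open>h\<close> is real-valued.
\<close>
definition density_ext :: "'n::finite operator \<Rightarrow> (real ^ 'n) fun_norm \<Rightarrow> (real ^ 'n \<Rightarrow> real)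
    \<Rightarrow> (nat \<Rightarrow> real ^ 'n \<Rightarrow> real) set \<Rightarrow> (real ^ 'n \<Rightarrow> real) \<Rightarrow> bool" where
  "density_ext T N u F h \<longleftrightarrow> (\<lambda>x. ereal (h x)) \<in> fun_space N (weighted u) \<and>
     (\<forall>\<phi>\<in>F. (\<lambda>j. N (weighted u) (\<lambda>x. T (\<phi> j) x - ereal (h x))) \<longlonglongrightarrow> 0)"

text \<open>
  \<open>T\<close> maps the Sobolev space to the space with norm \<open>N\<close> over \<open>u dx\<close>, with constant \<open>K\<close>: first on
  test functions, then for the extension by density.
\<close>
definition sobolev_maps :: "'n::finite operator \<Rightarrow> real \<Rightarrow> (real ^ 'n \<Rightarrow> real) \<Rightarrow> (real ^ 'n) fun_norm
    \<Rightarrow> (real ^ 'n \<Rightarrow> real) \<Rightarrow> ennreal \<Rightarrow> bool" where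
  "sobolev_maps T p v N u K \<longleftrightarrow>
     (\<forall>f. test_fun f \<longrightarrow> T f \<in> fun_space N (weighted u) \<and>
        N (weighted u) (T f) \<le> K * grad_norm p v f) \<and>
     (\<forall>F\<in>sobolev p v. \<exists>h. density_ext T N u F h \<and>
        N (weighted u) (\<lambda>x. ereal (h x)) \<le> K * sobolev_norm p v F)"


section \<open>Surface measure on the unit sphere\<close>

text \<open>
  Surface measure by polar coordinates: \<open>\<sigma>(E)\<close> is \<open>n\<close> times the Lebesgue measure of the cone
  \<open>{x. 0 < |x| < 1 \<and> x / |x| \<in> E}\<close>; note that \<open>sgn x = x / |x|\<close>. It is completed, so that
  measurable functions on the sphere need not be Borel.
\<close>
definition surface :: "(real ^ 'n) measure" where
  "surface = completion (scale_measure (of_nat CARD('n))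
     (distr (lebesgue_on (ball 0 1 - {0})) (restrict_space borel (sphere 0 1)) sgn))"

definition homogeneous0 :: "(real ^ 'n \<Rightarrow> real) \<Rightarrow> bool" where
  "homogeneous0 \<Omega> \<longleftrightarrow> (\<forall>r y. 0 < r \<and> y \<noteq> 0 \<longrightarrow> \<Omega> (r *\<^sub>R y) = \<Omega> y)"

definition rough_kernel :: "(real ^ 'n \<Rightarrow> real) \<Rightarrow> bool" where
  "rough_kernel \<Omega> \<longleftrightarrow> homogeneous0 \<Omega> \<and>
     (\<lambda>y. ereal (\<Omega> y)) \<in> fun_space (weak_Lq_norm (real CARD('n))) surface"

definition mean_zero :: "(real ^ 'n \<Rightarrow> real) \<Rightarrow> bool" where
  "mean_zero \<Omega> \<longleftrightarrow> integrable surface \<Omega> \<and> (LINT y|surface. \<Omega> y) = 0"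


section \<open>The operators\<close>

definition cubes :: "(real ^ 'n) set set" where
  "cubes = {cbox a (\<chi> i. a $ i + l) | a l. 0 < l}"

definition HL :: "(real ^ 'n \<Rightarrow> ennreal) \<Rightarrow> real ^ 'n \<Rightarrow> ennreal" where
  "HL g x = (SUP Q\<in>{Q \<in> cubes. x \<in> Q}. (\<integral>\<^sup>+ y\<in>Q. g y \<partial>lebesgue) / emeasure lebesgue Q)"

definition max_iter :: "nat \<Rightarrow> 'n::finite operator" where
  "max_iter k f x = enn2ereal ((HL ^^ k) (\<lambda>y. ennreal \<bar>f y\<bar>) x)"

definition max_HL :: "'n::finite operator" where
  "max_HL f x = enn2ereal (HL (\<lambda>y. ennreal \<bar>f y\<bar>) x)"

definition conj_dim :: "'n itself \<Rightarrow> real" where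
  "conj_dim _ = real CARD('n) / (real CARD('n) - 1)"

definition lorentz_avg :: "(real ^ 'n) set \<Rightarrow> (real ^ 'n \<Rightarrow> real) \<Rightarrow> ennreal" where
  "lorentz_avg Q f = (let n' = conj_dim TYPE('n) in
     ennreal n' * (\<integral>\<^sup>+ t\<in>{0<..}. epowr (emeasure lebesgue {y \<in> Q. t < \<bar>f y\<bar>}) (1 / n') \<partial>lborel)
       / epowr (emeasure lebesgue Q) (1 / n'))"

definition max_lorentz :: "'n::finite operator" where
  "max_lorentz f x = enn2ereal (SUP Q\<in>{Q \<in> cubes. x \<in> Q}. lorentz_avg Q f)"

definition max_sphere :: "'n::finite operator" where
  "max_sphere f x = (SUP t\<in>{0<..}. ereal \<bar>LINT y|surface. f (x - t *\<^sub>R y)\<bar>)"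

definition max_rough :: "(real ^ 'n \<Rightarrow> real) \<Rightarrow> 'n::finite operator" where
  "max_rough \<Omega> f x = enn2ereal (SUP t\<in>{0<..}.
     (\<integral>\<^sup>+ y\<in>ball 0 t. ennreal \<bar>\<Omega> y * f (x - y)\<bar> \<partial>lebesgue) / ennreal (t ^ CARD('n)))"

definition truncated :: "(real ^ 'n \<Rightarrow> real) \<Rightarrow> real \<Rightarrow> (real ^ 'n \<Rightarrow> real) \<Rightarrow> real ^ 'n \<Rightarrow> real" where
  "truncated \<Omega> t f x =
     (LINT y:{y. t < norm y}|lebesgue. \<Omega> y / norm y ^ CARD('n) * f (x - y))"

text \<open>
  For a test function and a mean-zero rough kernel the principal value exists at every point;
  \<open>Lim\<close> is unspecified where it does not.
\<close>
definition sing_rough :: "(real ^ 'n \<Rightarrow> real) \<Rightarrow> 'n::finite operator" where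
  "sing_rough \<Omega> f x = ereal (Lim (at_right 0) (\<lambda>t. truncated \<Omega> t f x))"

definition max_sing_rough :: "(real ^ 'n \<Rightarrow> real) \<Rightarrow> 'n::finite operator" where
  "max_sing_rough \<Omega> f x = (SUP t\<in>{0<..}. ereal \<bar>truncated \<Omega> t f x\<bar>)"

end

theory Submission
  imports Defs
begin

text \<open>
  Every operator \<open>T\<close> of the list obeys the pointwise inequality \<open>|T f| \<le> C I\<^sub>1|\<nabla>f|\<close> for \<open>C\<^sup>1\<close>
  functions with compact support, where \<open>C\<close> depends on \<open>T\<close> but on no weight. Once this is known, the
  weights enter only through the assumed bound for \<open>I\<^sub>1\<close>, applied to \<open>g = |\<nabla>f|\<close>. The notion
  \<open>controlled_by_riesz\<close> collects what is needed of \<open>T\<close>, and \<open>sobolev_maps_of_controlled\<close> carries it to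
  the statement about weights, for strong and weak norms at once.

  Integrating \<open>\<nabla>f\<close> along rays gives \<open>|f| \<le> c I\<^sub>1|\<nabla>f|\<close> and the bound for spherical averages. Polar
  coordinates are replaced by \<open>nn_integral_rays\<close>, which needs only Tonelli and dilations because the
  surface measure is defined by cones. The kernel \<open>|x|\<^sup>1\<^sup>-\<^sup>n\<close> is an \<open>A\<^sub>1\<close> weight, uniformly under
  translations, so \<open>M (I\<^sub>1 g) \<le> C I\<^sub>1 g\<close> (\<open>HL_riesz\<close>); this handles \<open>M\<close> and its iterates.

  The other operators need the sharp Sobolev inequality \<open>\<parallel>f\<parallel> \<le> C \<parallel>\<nabla>f\<parallel>\<^sub>1\<close> with the norm of
  \<open>L\<^sup>n\<^sup>'\<^sup>,\<^sup>1\<close> on the left. The weak-type inequality follows from the representation by \<open>I\<^sub>1\<close>; applied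
  to smooth truncations of \<open>f\<close> at all heights, it improves itself to \<open>L\<^sup>n\<^sup>'\<^sup>,\<^sup>1\<close> (Maz'ya's truncation
  argument, \<open>C1c_lorentz_sobolev\<close>). A cutoff function localizes it to balls. Together with \<open>M\<close> this
  gives \<open>C1c_lorentz_local\<close>, hence the Lorentz maximal operator, and by the duality of
  \<open>L\<^sup>n\<^sup>,\<^sup>\<infinity>\<close> and \<open>L\<^sup>n\<^sup>'\<^sup>,\<^sup>1\<close> the operators \<open>M\<^sub>\<Omega>\<close>. Together with the Poincare inequality it gives
  \<open>C1_lorentz_poincare\<close>, in which a constant is subtracted from \<open>f\<close>. For \<open>T\<^sub>\<Omega>\<close> and its maximal
  version the constant costs nothing because \<open>\<Omega>\<close> has mean zero on annuli. Writing \<open>|y|\<^sup>-\<^sup>n\<close> as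
  \<open>n \<integral> r\<^sup>-\<^sup>n\<^sup>-\<^sup>1 dr\<close> over \<open>r > |y|\<close> turns a truncated singular integral into a superposition of
  integrals over annuli, and the resulting bounds, summed over all scales, are again \<open>I\<^sub>1|\<nabla>f|\<close>. The same
  majorant gives the existence of the principal value by dominated convergence.

  The extension by density needs control of \<open>T f - T g\<close>. Most of the operators are sublinear, and then
  \<open>|T f - T g| \<le> C I\<^sub>1|\<nabla>(f - g)|\<close>. For the Lorentz maximal operator the weaker bound by
  \<open>C (\<epsilon> (I\<^sub>1|\<nabla>f| + I\<^sub>1|\<nabla>g|) + I\<^sub>1|\<nabla>(f - g)| / \<epsilon>)\<close> is proved. It avoids the triangle inequality of the
  Lorentz norm, and still makes \<open>T\<close> uniformly continuous on bounded sets, which is enough for the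
  extension.
\<close>

section \<open>The Riesz potential of order one\<close>

lemma tonelli_lborel:
  fixes f :: "'a::euclidean_space \<Rightarrow> 'b::euclidean_space \<Rightarrow> ennreal"
  assumes "case_prod f \<in> borel_measurable (borel \<Otimes>\<^sub>M borel)"
  shows "(\<integral>\<^sup>+x. \<integral>\<^sup>+y. f x y \<partial>lborel \<partial>lborel) = (\<integral>\<^sup>+y. \<integral>\<^sup>+x. f x y \<partial>lborel \<partial>lborel)"
proof -
  have "case_prod f \<in> borel_measurable (lborel \<Otimes>\<^sub>M lborel)"
    using assms by (simp cong: measurable_cong_sets sets_pair_measure_cong)
  from lborel_pair.Fubini'[OF this] show ?thesis by simp
qed

lemma nn_integral_lborel_affine:
  fixes g :: "'a::euclidean_space \<Rightarrow> ennreal"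
  assumes [measurable]: "g \<in> borel_measurable borel" and "c \<noteq> 0"
  shows "(\<integral>\<^sup>+x. g x \<partial>lborel) = ennreal (\<bar>c\<bar> ^ DIM('a)) * (\<integral>\<^sup>+x. g (t + c *\<^sub>R x) \<partial>lborel)"
  by (subst lborel_affine[OF assms(2), of t])
    (simp add: nn_integral_density nn_integral_distr nn_integral_cmult ennreal_power)

lemma nn_integral_lborel_reflect:
  fixes g :: "'a::euclidean_space \<Rightarrow> ennreal"
  assumes "g \<in> borel_measurable borel"
  shows "(\<integral>\<^sup>+z. g (x - z) \<partial>lborel) = (\<integral>\<^sup>+z. g z \<partial>lborel)"
  using nn_integral_lborel_affine[OF assms, of "-1" x] by simp

lemma ball_borel_measurable[measurable]: "ball (x::'a::euclidean_space) r \<in> sets borel"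
  by simp

lemma cball_borel_measurable[measurable]: "cball (x::'a::euclidean_space) r \<in> sets borel"
  by simp

text \<open>
  In \<^typ>\<open>ennreal\<close> the kernel is infinite at the origin when \<open>n \<ge> 2\<close>. With this value, unlike with \<open>0\<close>, the
  estimate of averages over cubes below holds also at the pole.
\<close>
definition riesz_kernel :: "real ^ 'n \<Rightarrow> ennreal" where
  "riesz_kernel w = inverse (ennreal (norm w ^ (CARD('n) - 1)))"

definition riesz :: "(real ^ 'n \<Rightarrow> ennreal) \<Rightarrow> real ^ 'n \<Rightarrow> ennreal" where
  "riesz g x = (\<integral>\<^sup>+y. g y * riesz_kernel (x - y) \<partial>lborel)"

lemma riesz_kernel_measurable[measurable]: "riesz_kernel \<in> borel_measurable borel"
  unfolding riesz_kernel_def[abs_def] by measurable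

lemma riesz_measurable[measurable]:
  assumes [measurable]: "g \<in> borel_measurable borel"
  shows "riesz g \<in> borel_measurable borel"
  unfolding riesz_def[abs_def] by measurable

lemma riesz_kernel_eq:
  "w \<noteq> 0 \<Longrightarrow> riesz_kernel (w::real^'n) = ennreal (1 / norm w ^ (CARD('n) - 1))"
  unfolding riesz_kernel_def by (subst inverse_ennreal) (auto simp: divide_inverse)

lemma riesz_kernel_minus: "riesz_kernel (- w) = riesz_kernel w"
  by (simp add: riesz_kernel_def)

lemma riesz_alt:
  assumes [measurable]: "g \<in> borel_measurable borel"
  shows "riesz g x = (\<integral>\<^sup>+z. g (x - z) * riesz_kernel z \<partial>lborel)"
  unfolding riesz_def
  using nn_integral_lborel_reflect[of "\<lambda>z. g (x - z) * riesz_kernel z" x] by simp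

lemma nn_integral_tail_power:
  assumes "0 < a" "1 \<le> m"
  shows "(\<integral>\<^sup>+s. ennreal (1 / s ^ (Suc m)) * indicator {a<..} s \<partial>lborel) = ennreal (1 / (real m * a ^ m))"
proof -
  have "(\<integral>\<^sup>+s. ennreal (1 / s ^ (Suc m)) * indicator {a<..} s \<partial>lborel)
     = (\<integral>\<^sup>+s. ennreal (1 / s ^ (Suc m)) * indicator {a..} s \<partial>lborel)"
  proof (rule nn_integral_cong_AE)
    show "AE s in lborel. ennreal (1 / s ^ (Suc m)) * indicator {a<..} s
       = ennreal (1 / s ^ (Suc m)) * indicator {a..} s"
      using AE_lborel_singleton[of a] by eventually_elim (auto simp: indicator_def)
  qed
  also have "\<dots> = ennreal (0 - (- 1 / (real m * a ^ m)))"
  proof (rule nn_integral_FTC_atLeast)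
    fix x :: real assume "a \<le> x"
    then have "x > 0" using assms by auto
    show "((\<lambda>x. - 1 / (real m * x ^ m)) has_real_derivative 1 / x ^ Suc m) (at x)"
      using \<open>x > 0\<close> assms
      by (auto intro!: derivative_eq_intros simp: field_simps power_Suc[symmetric] simp del: power_Suc)
        (simp add: power_add[symmetric] flip: power_Suc mult_2)
    show "0 \<le> 1 / x ^ Suc m" using \<open>x > 0\<close> by simp
  next
    show "((\<lambda>x. - 1 / (real m * x ^ m)) \<longlongrightarrow> 0) at_top"
      using assms
      by (intro tendsto_divide_0[OF tendsto_const] filterlim_at_top_imp_at_infinity
        filterlim_tendsto_pos_mult_at_top[OF tendsto_const] filterlim_pow_at_top filterlim_ident) auto
  qed auto
  finally show ?thesis by simp
qed

text \<open>
  This replaces integration in polar coordinates. Substituting \<open>r = s |y|\<close> along each ray and exchanging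
  the integrals leaves, for fixed \<open>s\<close>, a dilation of the unit ball by \<open>s\<close>; the integral over \<open>s > |z|\<close>
  that remains for each \<open>z\<close> is elementary.
\<close>
lemma nn_integral_rays:
  fixes g :: "real ^ 'n \<Rightarrow> ennreal"
  assumes [measurable]: "g \<in> borel_measurable borel"
  shows "(\<integral>\<^sup>+y\<in>ball 0 1. (\<integral>\<^sup>+r\<in>{0<..}. g (r *\<^sub>R sgn y) \<partial>lborel) \<partial>lborel)
     = ennreal (1 / CARD('n)) * (\<integral>\<^sup>+z. g z * riesz_kernel z \<partial>lborel)"
proof -
  let ?n = "CARD('n)"
  have [measurable]: "sgn \<in> borel_measurable (borel :: (real^'n) measure)"
    unfolding sgn_div_norm[abs_def] by measurable
  have "(\<integral>\<^sup>+y\<in>ball 0 1. (\<integral>\<^sup>+r\<in>{0<..}. g (r *\<^sub>R sgn y) \<partial>lborel) \<partial>lborel)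
    = (\<integral>\<^sup>+y. \<integral>\<^sup>+s. g (s *\<^sub>R y) * indicator {0<..} s * ennreal (norm y) * indicator (ball 0 1) y \<partial>lborel \<partial>lborel)"
  proof (rule nn_integral_cong_AE)
    have *: "(\<integral>\<^sup>+r\<in>{0<..}. g (r *\<^sub>R sgn y) \<partial>lborel) * indicator (ball 0 1) y =
       (\<integral>\<^sup>+s. g (s *\<^sub>R y) * indicator {0<..} s * ennreal (norm y) * indicator (ball 0 1) y \<partial>lborel)"
      if "y \<noteq> 0" for y :: "real^'n"
    proof -
      have "(\<integral>\<^sup>+r\<in>{0<..}. g (r *\<^sub>R sgn y) \<partial>lborel)
         = ennreal \<bar>norm y\<bar> * (\<integral>\<^sup>+s. g ((0 + norm y * s) *\<^sub>R sgn y) * indicator {0<..} (0 + norm y * s) \<partial>lborel)"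
        using that by (intro nn_integral_real_affine) auto
      also have "(\<lambda>s. g ((0 + norm y * s) *\<^sub>R sgn y) * indicator {0<..} (0 + norm y * s)) = (\<lambda>s. g (s *\<^sub>R y) * indicator {0<..} s)"
        using that by (auto simp: fun_eq_iff indicator_def sgn_div_norm zero_less_mult_iff
            mult.commute[of "norm y"] mult.assoc)
      finally show ?thesis
        by (simp add: nn_integral_cmult[symmetric] nn_integral_multc[symmetric] mult_ac)
    qed
    show "AE y in lborel. (\<integral>\<^sup>+r\<in>{0<..}. g (r *\<^sub>R sgn y) \<partial>lborel) * indicator (ball 0 1) y =
       (\<integral>\<^sup>+s. g (s *\<^sub>R y) * indicator {0<..} s * ennreal (norm y) * indicator (ball 0 1) y \<partial>lborel)"
      using AE_lborel_singleton[of 0] by eventually_elim (rule *)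
  qed
  also have "\<dots> = (\<integral>\<^sup>+s. \<integral>\<^sup>+y. g (s *\<^sub>R y) * indicator {0<..} s * ennreal (norm y) * indicator (ball 0 1) y \<partial>lborel \<partial>lborel)"
    by (rule tonelli_lborel) measurable
  also have "\<dots> = (\<integral>\<^sup>+s. \<integral>\<^sup>+z. g z * (ennreal (norm z) * (ennreal (1 / s ^ Suc ?n) * indicator {norm z<..} s)) \<partial>lborel \<partial>lborel)"
  proof (rule nn_integral_cong)
    fix s :: real
    show "(\<integral>\<^sup>+y. g (s *\<^sub>R y) * indicator {0<..} s * ennreal (norm y) * indicator (ball 0 1) y \<partial>lborel)
      = (\<integral>\<^sup>+z. g z * (ennreal (norm z) * (ennreal (1 / s ^ Suc ?n) * indicator {norm z<..} s)) \<partial>lborel)"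
    proof (cases "s > 0")
      case True
      have "(\<integral>\<^sup>+y. g (s *\<^sub>R y) * indicator {0<..} s * ennreal (norm y) * indicator (ball 0 1) y \<partial>lborel)
        = ennreal (\<bar>1/s\<bar> ^ DIM(real^'n)) * (\<integral>\<^sup>+z. g (s *\<^sub>R (0 + (1/s) *\<^sub>R z)) * indicator {0<..} s * ennreal (norm (0 + (1/s) *\<^sub>R z)) * indicator (ball 0 1) (0 + (1/s) *\<^sub>R z) \<partial>lborel)"
        using True by (intro nn_integral_lborel_affine) auto
      also have "\<dots> = (\<integral>\<^sup>+z. g z * (ennreal (norm z) * (ennreal (1 / s ^ Suc ?n) * indicator {norm z<..} s)) \<partial>lborel)"
        using True
        apply (subst nn_integral_cmult[symmetric])
         apply measurable
        apply (rule nn_integral_cong)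
        apply (auto simp: indicator_def field_simps ennreal_mult'' mult_ac power_divide divide_simps simp flip: ennreal_mult)
        done
      finally show ?thesis .
    next
      case False
      then have "\<not> norm z < s" for z :: "real^'n"
        using norm_ge_zero[of z] by linarith
      then show ?thesis using False by simp
    qed
  qed
  also have "\<dots> = (\<integral>\<^sup>+z. \<integral>\<^sup>+s. g z * (ennreal (norm z) * (ennreal (1 / s ^ Suc ?n) * indicator {norm z<..} s)) \<partial>lborel \<partial>lborel)"
    by (rule tonelli_lborel) (unfold indicator_def greaterThan_iff, measurable)
  also have "\<dots> = (\<integral>\<^sup>+z. ennreal (1 / ?n) * (g z * riesz_kernel z) \<partial>lborel)"
  proof (rule nn_integral_cong_AE)
    have *: "(\<integral>\<^sup>+s. g z * (ennreal (norm z) * (ennreal (1 / s ^ Suc ?n) * indicator {norm z<..} s)) \<partial>lborel)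
       = ennreal (1 / ?n) * (g z * riesz_kernel z)" if "z \<noteq> 0" for z :: "real^'n"
    proof -
      have "(\<integral>\<^sup>+s. g z * (ennreal (norm z) * (ennreal (1 / s ^ Suc ?n) * indicator {norm z<..} s)) \<partial>lborel)
        = g z * (ennreal (norm z) * ennreal (1 / (real ?n * norm z ^ ?n)))"
        using that by (simp add: nn_integral_cmult nn_integral_tail_power[of "norm z" ?n] Suc_le_eq del: power_Suc)
      also have "ennreal (norm z) * ennreal (1 / (real ?n * norm z ^ ?n)) = ennreal (1 / ?n) * riesz_kernel z"
      proof -
        have "norm z ^ ?n = norm z * norm z ^ (?n - 1)" by (simp add: power_eq_if)
        then show ?thesis
          using that by (simp add: riesz_kernel_eq flip: ennreal_mult)
      qed
      finally show ?thesis by (simp add: mult_ac)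
    qed
    show "AE z in lborel. (\<integral>\<^sup>+s. g z * (ennreal (norm z) * (ennreal (1 / s ^ Suc ?n) * indicator {norm z<..} s)) \<partial>lborel)
       = ennreal (1 / ?n) * (g z * riesz_kernel z)"
      using AE_lborel_singleton[of 0] by eventually_elim (rule *)
  qed
  finally show ?thesis by (simp add: nn_integral_cmult)
qed

lemma riesz_kernel_ball:
  assumes "0 \<le> R"
  shows "(\<integral>\<^sup>+z\<in>ball 0 R. riesz_kernel (z::real^'n) \<partial>lborel) = ennreal (CARD('n) * unit_ball_vol CARD('n) * R)"
proof -
  have "(\<integral>\<^sup>+y\<in>ball (0::real^'n) 1. (\<integral>\<^sup>+r\<in>{0<..}. indicator (ball 0 R) (r *\<^sub>R sgn y) \<partial>lborel) \<partial>lborel)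
     = (\<integral>\<^sup>+y\<in>ball (0::real^'n) 1. ennreal R \<partial>lborel)"
  proof (rule nn_integral_cong_AE)
    have *: "(\<integral>\<^sup>+r\<in>{0<..}. indicator (ball 0 R) (r *\<^sub>R sgn y) \<partial>lborel) = ennreal R" if "y \<noteq> 0" for y :: "real^'n"
    proof -
      have "(\<integral>\<^sup>+r\<in>{0<..}. indicator (ball 0 R) (r *\<^sub>R sgn y) \<partial>lborel) = (\<integral>\<^sup>+r. indicator {0<..<R} r \<partial>lborel)"
        using that by (intro nn_integral_cong) (auto simp: indicator_def norm_sgn)
      also have "\<dots> = ennreal R" using assms by simp
      finally show ?thesis .
    qed
    show "AE y::real^'n in lborel. (\<integral>\<^sup>+r\<in>{0<..}. indicator (ball 0 R) (r *\<^sub>R sgn y) \<partial>lborel) * indicator (ball 0 1) y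
      = ennreal R * indicator (ball 0 1) y"
      using AE_lborel_singleton[of 0] by eventually_elim (simp add: *)
  qed
  also have "\<dots> = ennreal (R * unit_ball_vol CARD('n))"
    using assms by (subst nn_integral_cmult_indicator) (auto simp: emeasure_ball ennreal_mult)
  finally have "ennreal (R * unit_ball_vol CARD('n)) = ennreal (1 / CARD('n)) * (\<integral>\<^sup>+z. indicator (ball 0 R) z * riesz_kernel (z::real^'n) \<partial>lborel)"
    by (subst (asm) nn_integral_rays) auto
  then have "ennreal CARD('n) * ennreal (R * unit_ball_vol CARD('n)) = (ennreal CARD('n) * ennreal (1 / CARD('n))) * (\<integral>\<^sup>+z. indicator (ball 0 R) z * riesz_kernel (z::real^'n) \<partial>lborel)"
    by (simp add: mult.assoc)
  also have "ennreal CARD('n) * ennreal (1 / CARD('n)) = 1"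
    by (simp flip: ennreal_mult)
  finally show ?thesis
    using assms by (simp add: mult_ac flip: ennreal_mult)
qed

text \<open>
  In the ball of radius \<open>R\<close> about the pole the kernel is integrated exactly, and outside of it the kernel is
  at most \<open>R\<^sup>1\<^sup>-\<^sup>n\<close>. The result has the order \<open>|E|\<^sup>1\<^sup>/\<^sup>n\<close>, as for a ball centred at the pole.
\<close>
lemma riesz_kernel_set:
  assumes [measurable]: "E \<in> sets borel" and "0 < R" and E: "emeasure lborel E \<le> ennreal (R ^ CARD('n))"
  shows "(\<integral>\<^sup>+y\<in>E. riesz_kernel (z - y :: real^'n) \<partial>lborel) \<le> ennreal ((CARD('n) * unit_ball_vol CARD('n) + 1) * R)"
proof -
  let ?n = "CARD('n)"
  have pt: "riesz_kernel (z - y) * indicator E y \<le> indicator (ball 0 R) (z - y) * riesz_kernel (z - y)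
      + ennreal (1 / R ^ (?n - 1)) * indicator E y" for y
  proof (cases "norm (z - y) < R")
    case False
    then have "0 < norm (z - y)" using \<open>0 < R\<close> by linarith
    with False have "riesz_kernel (z - y) \<le> ennreal (1 / R ^ (?n - 1))"
      using \<open>0 < R\<close> by (subst riesz_kernel_eq) (auto intro!: ennreal_leI divide_left_mono power_mono mult_pos_pos)
    then show ?thesis by (auto simp: indicator_def)
  qed (auto simp: indicator_def)
  have "(\<integral>\<^sup>+y\<in>E. riesz_kernel (z - y) \<partial>lborel) \<le> (\<integral>\<^sup>+y. indicator (ball 0 R) (z - y) * riesz_kernel (z - y)
      + ennreal (1 / R ^ (?n - 1)) * indicator E y \<partial>lborel)"
    by (intro nn_integral_mono pt)
  also have "\<dots> = (\<integral>\<^sup>+y. indicator (ball 0 R) (z - y) * riesz_kernel (z - y) \<partial>lborel)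
      + ennreal (1 / R ^ (?n - 1)) * emeasure lborel E"
    by (subst nn_integral_add) (auto simp: nn_integral_cmult_indicator)
  also have "(\<integral>\<^sup>+y. indicator (ball 0 R) (z - y) * riesz_kernel (z - y) \<partial>lborel)
      = (\<integral>\<^sup>+y. indicator (ball 0 R) y * riesz_kernel (y :: real^'n) \<partial>lborel)"
    by (rule nn_integral_lborel_reflect) measurable
  also have "\<dots> = ennreal (?n * unit_ball_vol ?n * R)"
    using riesz_kernel_ball[of R, where 'n='n] \<open>0 < R\<close> by (simp add: mult.commute)
  also have "ennreal (1 / R ^ (?n - 1)) * emeasure lborel E \<le> ennreal (1 / R ^ (?n - 1)) * ennreal (R ^ ?n)"
    by (intro mult_left_mono E) auto
  also have "ennreal (1 / R ^ (?n - 1)) * ennreal (R ^ ?n) = ennreal R"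
    using \<open>0 < R\<close> by (cases ?n) (auto simp flip: ennreal_mult)
  also have "ennreal (?n * unit_ball_vol ?n * R) + ennreal R = ennreal ((?n * unit_ball_vol ?n + 1) * R)"
    using \<open>0 < R\<close> by (simp add: algebra_simps flip: ennreal_plus)
  finally show ?thesis by (simp add: add_left_mono)
qed

section \<open>Averages of Riesz potentials over cubes\<close>

abbreviation cube :: "real ^ 'n \<Rightarrow> real \<Rightarrow> (real ^ 'n) set" where
  "cube a l \<equiv> cbox a (\<chi> i. a $ i + l)"

lemma emeasure_cube:
  assumes "0 \<le> l"
  shows "emeasure lborel (cube (a::real^'n) l) = ennreal (l ^ CARD('n))"
proof -
  have "(\<Prod>b\<in>Basis. ((\<chi> i. a $ i + l) - a) \<bullet> b) = (\<Prod>b\<in>(Basis::(real^'n) set). l)"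
    by (rule prod.cong) (auto simp: Basis_vec_def inner_axis)
  also have "\<dots> = l ^ CARD('n)" by simp
  finally show ?thesis
    using assms by (subst emeasure_lborel_cbox) (auto simp: Basis_vec_def inner_axis)
qed

lemma norm_diff_cube:
  fixes l :: real
  assumes "x \<in> cube (a::real^'n) l" "y \<in> cube a l"
  shows "norm (x - y) \<le> CARD('n) * l"
proof -
  have "norm (x - y) \<le> (\<Sum>i\<in>UNIV. \<bar>(x - y) $ i\<bar>)" by (rule norm_le_l1_cart)
  also have "\<dots> \<le> (\<Sum>i\<in>(UNIV::'n set). l)"
    using assms by (intro sum_mono) (auto simp: mem_box_cart abs_le_iff, (smt (verit))+)
  finally show ?thesis by simp
qed

definition A1_const :: "nat \<Rightarrow> real" where
  "A1_const n = (n * unit_ball_vol n + 1) * (2 * n) ^ (n - 1)"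

text \<open>
  The \<open>A\<^sub>1\<close> property of the kernel. A cube whose side is small compared with its distance to the pole sees a
  nearly constant kernel; for the other cubes the bound for sets of given measure suffices.
\<close>
lemma riesz_kernel_cube_average:
  assumes "x \<in> cube (a::real^'n) l" "0 < l"
  shows "(\<integral>\<^sup>+y\<in>cube a l. riesz_kernel (y - z) \<partial>lborel)
    \<le> ennreal (A1_const CARD('n) * l ^ CARD('n)) * riesz_kernel (x - z)"
proof (cases "x = z")
  case True
  have "A1_const CARD('n) * l ^ CARD('n) > 0"
    unfolding A1_const_def using assms by (intro mult_pos_pos add_nonneg_pos) auto
  with True show ?thesis
    by (cases "CARD('n) = 1") (auto simp: riesz_kernel_def ennreal_mult_top power_0_left
      nn_integral_cmult_indicator emeasure_cube assms less_imp_le A1_const_def intro!: ennreal_leI)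
next
  case False
  let ?n = "CARD('n)" and ?K = "CARD('n) * unit_ball_vol CARD('n) + 1" and ?d = "norm (x - z)"
  have n: "?n \<ge> 1" by (simp add: Suc_leI)
  have K: "?K \<ge> 1" by simp
  have d: "?d > 0" using False by simp
  show ?thesis
  proof (cases "?d \<ge> 2 * ?n * l")
    case True
    have "riesz_kernel (y - z) \<le> ennreal (2 ^ (?n - 1)) * riesz_kernel (x - z)" if "y \<in> cube a l" for y
    proof -
      have "norm (x - y) \<le> ?d / 2" using norm_diff_cube[OF assms(1) that] True by simp
      then have *: "?d / 2 \<le> norm (y - z)" using norm_triangle_ineq[of "x - y" "y - z"] by simp
      then have "y \<noteq> z" using d by auto
      have "1 / norm (y - z) ^ (?n - 1) \<le> 1 / (?d / 2) ^ (?n - 1)"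
        using * d by (intro divide_left_mono power_mono mult_pos_pos zero_less_power) auto
      then show ?thesis
        using False \<open>y \<noteq> z\<close> by (simp add: riesz_kernel_eq power_divide ennreal_leI flip: ennreal_mult)
    qed
    then have "(\<integral>\<^sup>+y\<in>cube a l. riesz_kernel (y - z) \<partial>lborel)
      \<le> (\<integral>\<^sup>+y\<in>cube a l. ennreal (2 ^ (?n - 1)) * riesz_kernel (x - z) \<partial>lborel)"
      by (intro nn_integral_mono) (auto simp: indicator_def)
    also have "\<dots> = ennreal (2 ^ (?n - 1)) * riesz_kernel (x - z) * ennreal (l ^ ?n)"
      using assms by (subst nn_integral_cmult_indicator) (auto simp: emeasure_cube)
    also have "\<dots> = ennreal (2 ^ (?n - 1) * l ^ ?n) * riesz_kernel (x - z)"
      using assms by (simp add: ennreal_mult mult_ac)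
    also have "\<dots> \<le> ennreal (A1_const ?n * l ^ ?n) * riesz_kernel (x - z)"
    proof (intro mult_right_mono ennreal_leI)
      have "(2::real) ^ (?n - 1) \<le> (2 * real ?n) ^ (?n - 1)"
        using n by (intro power_mono) auto
      also have "\<dots> \<le> A1_const ?n" unfolding A1_const_def using mult_right_mono[OF K, of "(2 * real ?n) ^ (?n - 1)"] by simp
      finally show "2 ^ (?n - 1) \<le> A1_const ?n" .
    qed (use assms in auto)
    finally show ?thesis .
  next
    case False
    then have *: "?d / (2 * ?n) \<le> l" using n by (simp add: field_simps)
    have "(\<integral>\<^sup>+y\<in>cube a l. riesz_kernel (y - z) \<partial>lborel) = (\<integral>\<^sup>+y\<in>cube a l. riesz_kernel (z - y) \<partial>lborel)"
      by (intro nn_integral_cong) (metis minus_diff_eq riesz_kernel_minus)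
    also have "\<dots> \<le> ennreal (?K * l)"
      using assms by (intro riesz_kernel_set) (auto simp: emeasure_cube)
    also have "?K * l = (?K * (2 * ?n) ^ (?n - 1) * l) * (?d / (2 * ?n)) ^ (?n - 1) / ?d ^ (?n - 1)"
      using d n by (simp add: power_divide)
    also have "\<dots> \<le> (?K * (2 * ?n) ^ (?n - 1) * l) * l ^ (?n - 1) / ?d ^ (?n - 1)"
      using * d n K assms by (intro divide_right_mono mult_left_mono power_mono mult_nonneg_nonneg) auto
    also have "\<dots> = A1_const ?n * l ^ ?n * (1 / ?d ^ (?n - 1))"
      using n by (cases ?n) (auto simp: A1_const_def)
    finally show ?thesis
      using \<open>x \<noteq> z\<close> assms by (simp add: riesz_kernel_eq ennreal_leI A1_const_def flip: ennreal_mult)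
  qed
qed

lemma emeasure_lebesgue_cube:
  "0 \<le> l \<Longrightarrow> emeasure lebesgue (cube (a::real^'n) l) = ennreal (l ^ CARD('n))"
  by (simp add: emeasure_cube)

lemma HL_le_iff:
  "HL g (x::real^'n) \<le> B \<longleftrightarrow>
    (\<forall>a l. 0 < l \<longrightarrow> x \<in> cube a l \<longrightarrow> (\<integral>\<^sup>+y\<in>cube a l. g y \<partial>lborel) / ennreal (l ^ CARD('n)) \<le> B)"
proof -
  have "HL g x \<le> B \<longleftrightarrow> (\<forall>a l. 0 < l \<longrightarrow> x \<in> cube a l \<longrightarrow>
      (\<integral>\<^sup>+y\<in>cube a l. g y \<partial>lebesgue) / emeasure lebesgue (cube a l) \<le> B)"
    unfolding HL_def SUP_le_iff cubes_def by blast
  moreover have "emeasure lebesgue (cube a l) = ennreal (l ^ CARD('n))" if "0 < l" for a :: "real^'n" and l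
    using that by (intro emeasure_lebesgue_cube) simp
  ultimately show ?thesis
    unfolding nn_integral_completion by (intro iffI allI impI) simp_all
qed

lemma HL_ge:
  "0 < l \<Longrightarrow> (x::real^'n) \<in> cube a l \<Longrightarrow> (\<integral>\<^sup>+y\<in>cube a l. g y \<partial>lborel) / ennreal (l ^ CARD('n)) \<le> HL g x"
  using HL_le_iff[of g x "HL g x"] by blast

lemma HL_mono: "(\<And>y. g y \<le> h y) \<Longrightarrow> HL g x \<le> HL h (x::real^'n)"
  unfolding HL_le_iff
  by (intro allI impI order_trans[OF divide_right_mono_ennreal HL_ge]) (auto intro!: nn_integral_mono mult_right_mono)

lemma HL_riesz:
  fixes x :: "real ^ 'n"
  assumes [measurable]: "g \<in> borel_measurable borel"
  shows "HL (riesz g) x \<le> ennreal (A1_const CARD('n)) * riesz g x"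
  unfolding HL_le_iff
proof (intro allI impI)
  fix a :: "real^'n" and l :: real assume l: "0 < l" and x: "x \<in> cube a l"
  let ?n = "CARD('n)"
  have A: "A1_const ?n \<ge> 0" by (simp add: A1_const_def)
  have [measurable]: "cube a l \<in> sets borel" by simp
  have "(\<integral>\<^sup>+y\<in>cube a l. riesz g y \<partial>lborel) = (\<integral>\<^sup>+y. \<integral>\<^sup>+z. g z * (riesz_kernel (y - z) * indicator (cube a l) y) \<partial>lborel \<partial>lborel)"
    unfolding riesz_def by (simp add: nn_integral_multc[symmetric] mult.assoc)
  also have "\<dots> = (\<integral>\<^sup>+z. \<integral>\<^sup>+y. g z * (riesz_kernel (y - z) * indicator (cube a l) y) \<partial>lborel \<partial>lborel)"
    by (rule tonelli_lborel) measurable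
  also have "\<dots> = (\<integral>\<^sup>+z. g z * (\<integral>\<^sup>+y\<in>cube a l. riesz_kernel (y - z) \<partial>lborel) \<partial>lborel)"
    by (intro nn_integral_cong nn_integral_cmult) measurable
  also have "\<dots> \<le> (\<integral>\<^sup>+z. g z * (ennreal (A1_const ?n * l ^ ?n) * riesz_kernel (x - z)) \<partial>lborel)"
    by (intro nn_integral_mono mult_left_mono riesz_kernel_cube_average x l) auto
  also have "\<dots> = ennreal (A1_const ?n * l ^ ?n) * riesz g x"
    unfolding riesz_def by (subst nn_integral_cmult[symmetric]) (auto simp: mult_ac)
  finally have "(\<integral>\<^sup>+y\<in>cube a l. riesz g y \<partial>lborel) \<le> ennreal (l ^ ?n) * (ennreal (A1_const ?n) * riesz g x)"
    using A l by (simp add: ennreal_mult mult_ac)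
  then show "(\<integral>\<^sup>+y\<in>cube a l. riesz g y \<partial>lborel) / ennreal (l ^ ?n) \<le> ennreal (A1_const ?n) * riesz g x"
    using l by (intro divide_le_posI_ennreal) auto
qed

lemma ennreal_less_divide_iff:
  assumes "0 < w" shows "c < a / ennreal w \<longleftrightarrow> c * ennreal w < a"
  using assms by (cases a; cases c) (auto simp: divide_ennreal ennreal_mult[symmetric] ennreal_less_iff field_simps ennreal_top_mult ennreal_top_divide)

text \<open>
  Semicontinuity of maximal functions over closed cubes: a cube with a large quotient can be enlarged
  slightly without losing the strict inequality, and the enlarged cube contains a neighbourhood of \<open>x\<close>.
  The function whose quotients are taken may be arbitrary, as long as it is monotone in the cube.
\<close>
lemma open_superlevel_cube_sup:
  fixes \<Phi> :: "(real ^ 'n) set \<Rightarrow> ennreal" and w :: "real \<Rightarrow> real"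
  assumes mono: "\<And>a l b m. cube a l \<subseteq> cube b m \<Longrightarrow> \<Phi> (cube a l) \<le> \<Phi> (cube b m)"
    and w: "\<And>l. 0 < l \<Longrightarrow> 0 < w l" "continuous_on {0<..} w"
  shows "open {x. c < (SUP (a, l)\<in>{(a, l). 0 < l \<and> x \<in> cube a l}. \<Phi> (cube a l) / ennreal (w l))}"
proof (rule openI)
  fix x assume "x \<in> {x. c < (SUP (a, l)\<in>{(a, l). 0 < l \<and> x \<in> cube a l}. \<Phi> (cube a l) / ennreal (w l))}"
  then obtain a l where l: "0 < l" and x: "x \<in> cube a l" and c: "c < \<Phi> (cube a l) / ennreal (w l)"
    by (auto simp: less_SUP_iff)
  have c1: "c * ennreal (w l) < \<Phi> (cube a l)" using c l w by (simp add: ennreal_less_divide_iff)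
  have "c < \<infinity>" using c by (simp add: order_less_le_trans)
  have "isCont w l" using w(2) l by (simp add: continuous_on_eq_continuous_at)
  then have "(w \<longlongrightarrow> w l) (at l)" by (simp add: isCont_def)
  then have "((\<lambda>d. w (l + 2 * d)) \<longlongrightarrow> w l) (at_right 0)"
    by (rule filterlim_compose) (auto simp: filterlim_at eventually_at_filter intro!: tendsto_eq_intros)
  then have "((\<lambda>d. c * ennreal (w (l + 2 * d))) \<longlongrightarrow> c * ennreal (w l)) (at_right 0)"
    using \<open>c < \<infinity>\<close> by (intro ennreal_tendsto_cmult tendsto_ennrealI) auto
  from order_tendstoD(2)[OF this c1] have "eventually (\<lambda>d. c * ennreal (w (l + 2 * d)) < \<Phi> (cube a l)) (at_right 0)" .
  moreover have "eventually (\<lambda>d::real. 0 < d) (at_right 0)" by (simp add: eventually_at_filter)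
  ultimately have "eventually (\<lambda>d. 0 < d \<and> c * ennreal (w (l + 2 * d)) < \<Phi> (cube a l)) (at_right 0)"
    by eventually_elim auto
  then obtain d where d: "0 < d" "c * ennreal (w (l + 2 * d)) < \<Phi> (cube a l)"
    using eventually_happens' trivial_limit_at_right_real by blast
  let ?a = "\<chi> i. a $ i - d"
  have sub: "cube a l \<subseteq> cube ?a (l + 2 * d)"
    using d by (auto simp: mem_box_cart) (smt (verit))+
  have "\<Phi> (cube a l) \<le> \<Phi> (cube ?a (l + 2 * d))" by (intro mono sub)
  with d have "c * ennreal (w (l + 2 * d)) < \<Phi> (cube ?a (l + 2 * d))" by simp
  then have big: "c < \<Phi> (cube ?a (l + 2 * d)) / ennreal (w (l + 2 * d))"
    using l d w by (simp add: ennreal_less_divide_iff)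
  have "ball x d \<subseteq> {x. c < (SUP (a, l)\<in>{(a, l). 0 < l \<and> x \<in> cube a l}. \<Phi> (cube a l) / ennreal (w l))}"
  proof
    fix y assume "y \<in> ball x d"
    then have "\<bar>(y - x) $ i\<bar> < d" for i
      using component_le_norm_cart[of "y - x" i] by (simp add: dist_norm norm_minus_commute)
    then have "\<bar>y $ i - x $ i\<bar> < d" for i by simp
    then have "y \<in> cube ?a (l + 2 * d)"
      using x by (auto simp: mem_box_cart) (smt (verit))+
    then show "y \<in> {x. c < (SUP (a, l)\<in>{(a, l). 0 < l \<and> x \<in> cube a l}. \<Phi> (cube a l) / ennreal (w l))}"
      using big l d by (auto simp: less_SUP_iff intro!: exI[of _ ?a] exI[of _ "l + 2 * d"])
  qed
  with d show "\<exists>e>0. ball x e \<subseteq> {x. c < (SUP (a, l)\<in>{(a, l). 0 < l \<and> x \<in> cube a l}. \<Phi> (cube a l) / ennreal (w l))}"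
    by blast
qed

lemma HL_alt: "HL g (x::real^'n) = (SUP (a, l)\<in>{(a, l). 0 < l \<and> x \<in> cube a l}. 
     (\<integral>\<^sup>+y. g y * indicator (cube a l) y \<partial>lborel) / ennreal (l ^ CARD('n)))"
proof (rule antisym)
  show "HL g x \<le> (SUP (a, l)\<in>{(a, l). 0 < l \<and> x \<in> cube a l}. (\<integral>\<^sup>+y. g y * indicator (cube a l) y \<partial>lborel) / ennreal (l ^ CARD('n)))"
    unfolding HL_le_iff by (auto intro!: SUP_upper2)
qed (auto intro!: SUP_least HL_ge)

lemma HL_measurable[measurable]: "HL g \<in> borel_measurable (borel :: (real^'n) measure)"
proof (rule borel_measurableI_greater)
  fix c :: ennreal
  have "open {x::real^'n. c < HL g x}"
    unfolding HL_alt
    by (rule open_superlevel_cube_sup[of "\<lambda>Q. \<integral>\<^sup>+y. g y * indicator Q y \<partial>lborel" "\<lambda>l. l ^ CARD('n)"])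
      (auto intro!: nn_integral_mono mult_left_mono continuous_intros simp: indicator_def subset_iff)
  then show "{x \<in> space borel. c < HL g x} \<in> sets borel" by simp
qed

lemma HL_subadditive:
  fixes x :: "real ^ 'n"
  assumes [measurable]: "g \<in> borel_measurable borel" "h \<in> borel_measurable borel"
  shows "HL (\<lambda>y. g y + h y) x \<le> HL g x + HL h x"
  unfolding HL_le_iff
proof (intro allI impI)
  fix a :: "real^'n" and l :: real assume l: "0 < l" and x: "x \<in> cube a l"
  have [measurable]: "cube a l \<in> sets borel" by simp
  have "(\<integral>\<^sup>+y\<in>cube a l. g y + h y \<partial>lborel) = (\<integral>\<^sup>+y\<in>cube a l. g y \<partial>lborel) + (\<integral>\<^sup>+y\<in>cube a l. h y \<partial>lborel)"
    by (simp add: distrib_right nn_integral_add)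
  then show "(\<integral>\<^sup>+y\<in>cube a l. g y + h y \<partial>lborel) / ennreal (l ^ CARD('n)) \<le> HL g x + HL h x"
    using l x by (simp add: add_divide_distrib_ennreal add_mono HL_ge)
qed

lemma HL_cmult:
  fixes x :: "real ^ 'n"
  assumes [measurable]: "g \<in> borel_measurable borel"
  shows "HL (\<lambda>y. c * g y) x \<le> c * HL g x"
  unfolding HL_le_iff
proof (intro allI impI)
  fix a :: "real^'n" and l :: real assume l: "0 < l" and x: "x \<in> cube a l"
  have [measurable]: "cube a l \<in> sets borel" by simp
  show "(\<integral>\<^sup>+y\<in>cube a l. c * g y \<partial>lborel) / ennreal (l ^ CARD('n)) \<le> c * HL g x"
    using HL_ge[OF l x, of g]
    by (simp add: mult.assoc nn_integral_cmult mult_left_mono flip: ennreal_times_divide)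
qed

section \<open>Functions of class \<open>C\<^sup>1\<close> and integration along rays\<close>

definition C1 :: "(real ^ 'n \<Rightarrow> real) \<Rightarrow> bool" where
  "C1 f \<longleftrightarrow> (\<forall>x. GDERIV f x :> grad f x) \<and> continuous_on UNIV (grad f)"

definition C1c :: "(real ^ 'n \<Rightarrow> real) \<Rightarrow> bool" where
  "C1c f \<longleftrightarrow> C1 f \<and> bounded {x. f x \<noteq> 0}"

abbreviation grad_abs :: "(real ^ 'n \<Rightarrow> real) \<Rightarrow> real ^ 'n \<Rightarrow> ennreal" where
  "grad_abs f \<equiv> \<lambda>x. ennreal (norm (grad f x))"

lemma GDERIV_grad: "f differentiable at x \<Longrightarrow> GDERIV f x :> grad f x"
proof -
  assume "f differentiable at x"
  then have D: "(f has_derivative frechet_derivative f (at x)) (at x)"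
    by (simp add: frechet_derivative_works)
  then interpret bounded_linear "frechet_derivative f (at x)" by (rule has_derivative_bounded_linear)
  have "frechet_derivative f (at x) v = v \<bullet> grad f x" for v
  proof -
    have "frechet_derivative f (at x) v = frechet_derivative f (at x) (\<Sum>i\<in>UNIV. v $ i *\<^sub>R axis i 1)"
      by (subst basis_expansion[symmetric, of v]) (simp add: scalar_mult_eq_scaleR)
    also have "\<dots> = v \<bullet> grad f x"
      by (simp add: sum scaleR inner_vec_def grad_def partial_def)
    finally show ?thesis .
  qed
  then have "frechet_derivative f (at x) = (\<lambda>v. v \<bullet> grad f x)" by auto
  with D show "GDERIV f x :> grad f x" by (simp add: gderiv_def)
qed

lemma grad_eqI:
  fixes f :: "real ^ 'n \<Rightarrow> real"
  assumes "GDERIV f x :> D" shows "grad f x = D"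
proof -
  have "frechet_derivative f (at x) = (\<lambda>v. v \<bullet> D)"
    using assms by (simp add: gderiv_def frechet_derivative_at[symmetric])
  then show ?thesis by (simp add: grad_def partial_def vec_eq_iff inner_axis')
qed

lemma C1I:
  assumes "\<And>x. GDERIV f x :> G x" "continuous_on UNIV G"
  shows "C1 f" "grad f = G"
proof -
  show "grad f = G" using assms by (auto simp: fun_eq_iff intro: grad_eqI)
  with assms show "C1 f" by (simp add: C1_def)
qed

lemma C1_continuous: "C1 f \<Longrightarrow> continuous_on UNIV f"
  by (auto simp: C1_def gderiv_def intro!: continuous_at_imp_continuous_on has_derivative_continuous)

lemma C1_measurable: "C1 f \<Longrightarrow> f \<in> borel_measurable borel"
  by (simp add: C1_continuous borel_measurable_continuous_onI)

lemma grad_measurable: "C1 f \<Longrightarrow> grad f \<in> borel_measurable borel"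
  by (intro borel_measurable_continuous_onI) (simp add: C1_def)

lemma C1_diff:
  assumes "C1 f" "C1 g"
  shows "C1 (\<lambda>x. f x - g x)" "grad (\<lambda>x. f x - g x) = (\<lambda>x. grad f x - grad g x)"
proof -
  have 1: "GDERIV (\<lambda>x. f x - g x) x :> grad f x - grad g x" for x
    using assms by (intro GDERIV_diff) (auto simp: C1_def)
  have 2: "continuous_on UNIV (\<lambda>x. grad f x - grad g x)"
    using assms by (intro continuous_intros) (auto simp: C1_def)
  show "C1 (\<lambda>x. f x - g x)" "grad (\<lambda>x. f x - g x) = (\<lambda>x. grad f x - grad g x)"
    using C1I[OF 1 2] by auto
qed

lemma C1c_diff: "C1c f \<Longrightarrow> C1c g \<Longrightarrow> C1c (\<lambda>x. f x - g x)"
  unfolding C1c_def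
proof safe
  assume "C1 f" "C1 g" then show "C1 (\<lambda>x. f x - g x)" by (rule C1_diff)
next
  assume "bounded {x. f x \<noteq> 0}" "bounded {x. g x \<noteq> 0}"
  then have "bounded ({x. f x \<noteq> 0} \<union> {x. g x \<noteq> 0})" by simp
  then show "bounded {x. f x - g x \<noteq> 0}" by (rule bounded_subset) auto
qed

lemma test_fun_C1c:
  assumes "test_fun f" shows "C1c f"
proof -
  from assms have Ck: "Ck k f" for k by (simp add: test_fun_def)
  have "f differentiable at x" for x using Ck[of "Suc 0"] by simp
  then have 1: "GDERIV f x :> grad f x" for x by (rule GDERIV_grad)
  have "continuous_on UNIV (partial i f)" for i using Ck[of "Suc 0"] by simp
  then have 2: "continuous_on UNIV (grad f)"
    unfolding grad_def[abs_def] by (intro continuous_on_vec_lambda)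
  have "bounded {x. f x \<noteq> 0}"
    using assms by (auto simp: test_fun_def intro: bounded_subset[OF compact_imp_bounded closure_subset])
  with 1 2 show ?thesis by (simp add: C1c_def C1_def)
qed

lemma C1c_support:
  assumes "C1c f"
  shows "\<exists>B>0. \<forall>x. B \<le> norm x \<longrightarrow> f x = 0 \<and> grad f x = 0"
proof -
  obtain B where B: "B > 0" "\<And>x. f x \<noteq> 0 \<Longrightarrow> norm x \<le> B"
    using assms by (auto simp: C1c_def bounded_pos)
  have 1: "f x = 0" if "B + 1 \<le> norm x" for x using B that by fastforce
  have 2: "grad f x = 0" if "B + 1 \<le> norm x" for x
  proof (rule grad_eqI)
    have "open {y::real^'a. B < norm y}" by (intro open_Collect_less continuous_intros)
    moreover have "x \<in> {y. B < norm y}" using that by simp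
    ultimately show "GDERIV f x :> 0"
      unfolding gderiv_def
      by (rule has_derivative_transform_within_open[of "\<lambda>_. 0", rotated])
        (use B in fastforce)+
  qed
  show ?thesis by (rule exI[of _ "B + 1"]) (use B 1 2 in auto)
qed

lemma C1_segment_bound:
  assumes "C1 f" "t \<le> R"
  shows "ennreal \<bar>f (x + R *\<^sub>R w) - f (x + t *\<^sub>R w)\<bar>
    \<le> (\<integral>\<^sup>+r\<in>{t..R}. ennreal (norm w) * grad_abs f (x + r *\<^sub>R w) \<partial>lborel)"
proof -
  let ?d = "\<lambda>r. w \<bullet> grad f (x + r *\<^sub>R w)"
  have der: "DERIV (\<lambda>r. f (x + r *\<^sub>R w)) r :> ?d r" for r
  proof -
    have "(f has_derivative (\<lambda>v. v \<bullet> grad f (x + r *\<^sub>R w))) (at (x + r *\<^sub>R w))"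
      using assms by (simp add: C1_def gderiv_def)
    then have "((\<lambda>r. f (x + r *\<^sub>R w)) has_derivative (\<lambda>h. (h *\<^sub>R w) \<bullet> grad f (x + r *\<^sub>R w))) (at r)"
      by (rule has_derivative_compose[rotated]) (auto intro!: derivative_eq_intros)
    then show ?thesis by (simp add: has_field_derivative_def mult.commute[of _ "_ \<bullet> _"])
  qed
  have cont: "isCont ?d r" for r
  proof -
    have "continuous_on UNIV (\<lambda>r. grad f (x + r *\<^sub>R w))"
      by (rule continuous_on_compose2[of UNIV "grad f"])
        (use assms in \<open>auto simp: C1_def intro!: continuous_intros\<close>)
    then have "continuous_on UNIV ?d" by (intro continuous_intros)
    then show ?thesis by (simp add: continuous_on_eq_continuous_at)
  qed
  have "has_bochner_integral lborel (\<lambda>r. ?d r * indicator {t..R} r) (f (x + R *\<^sub>R w) - f (x + t *\<^sub>R w))"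
    by (rule has_bochner_integral_FTC_Icc_real[OF assms(2) der cont])
  then have "ennreal \<bar>f (x + R *\<^sub>R w) - f (x + t *\<^sub>R w)\<bar> \<le> (\<integral>\<^sup>+r. ennreal (norm (?d r * indicator {t..R} r)) \<partial>lborel)"
    using integral_norm_bound_ennreal[of lborel "\<lambda>r. ?d r * indicator {t..R} r"]
    by (auto simp: has_bochner_integral_iff)
  also have "\<dots> \<le> (\<integral>\<^sup>+r\<in>{t..R}. ennreal (norm w) * grad_abs f (x + r *\<^sub>R w) \<partial>lborel)"
  proof (rule nn_integral_mono)
    fix r
    have "ennreal (norm (?d r)) \<le> ennreal (norm w) * grad_abs f (x + r *\<^sub>R w)"
      using Cauchy_Schwarz_ineq2[of w "grad f (x + r *\<^sub>R w)"] by (simp add: ennreal_leI flip: ennreal_mult)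
    then show "ennreal (norm (?d r * indicator {t..R} r))
        \<le> ennreal (norm w) * grad_abs f (x + r *\<^sub>R w) * indicator {t..R} r"
      by (simp add: indicator_def)
  qed
  finally show ?thesis .
qed

text \<open>
  The fundamental theorem of calculus on a segment from \<open>x - t w\<close> to a point beyond the support. The ray
  starts at \<open>x\<close> itself, so that the right side is the same for all \<open>t\<close>.
\<close>
lemma C1c_ray_bound:
  assumes "C1c f" "norm w = 1" "0 \<le> t"
  shows "ennreal \<bar>f (x - t *\<^sub>R w)\<bar> \<le> (\<integral>\<^sup>+r\<in>{0<..}. grad_abs f (x - r *\<^sub>R w) \<partial>lborel)"
proof -
  obtain B where B: "0 < B" "\<And>x. B \<le> norm x \<Longrightarrow> f x = 0"
    using C1c_support[OF assms(1)] by blast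
  \<comment> \<open>At this distance along the ray the point lies outside the ball of radius \<open>B\<close> that contains the support.\<close>
  let ?R = "t + B + norm x"
  have "B \<le> norm (x + ?R *\<^sub>R (- w))"
  proof -
    have "norm (?R *\<^sub>R w) = ?R" using assms B by simp
    then show ?thesis
      using norm_triangle_ineq2[of "?R *\<^sub>R w" x] assms by (simp add: norm_minus_commute)
  qed
  then have 0: "f (x + ?R *\<^sub>R (- w)) = 0" by (rule B)
  have "ennreal \<bar>f (x + ?R *\<^sub>R (- w)) - f (x + t *\<^sub>R (- w))\<bar>
    \<le> (\<integral>\<^sup>+r\<in>{t..?R}. ennreal (norm (- w)) * grad_abs f (x + r *\<^sub>R (- w)) \<partial>lborel)"
    using assms B by (intro C1_segment_bound) (auto simp: C1c_def)
  then have "ennreal \<bar>f (x - t *\<^sub>R w)\<bar> \<le> (\<integral>\<^sup>+r\<in>{t..?R}. grad_abs f (x - r *\<^sub>R w) \<partial>lborel)"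
    using assms(2) unfolding 0 by simp
  also have "\<dots> \<le> (\<integral>\<^sup>+r\<in>{0<..}. grad_abs f (x - r *\<^sub>R w) \<partial>lborel)"
  proof (rule nn_integral_mono_AE)
    show "AE r in lborel. grad_abs f (x - r *\<^sub>R w) * indicator {t..?R} r \<le> grad_abs f (x - r *\<^sub>R w) * indicator {0<..} r"
      using AE_lborel_singleton[of 0] by eventually_elim (use assms in \<open>auto simp: indicator_def\<close>)
  qed
  finally show ?thesis .
qed

text \<open>
  By the definition of surface measure through cones, the left side is the integral of
  \<open>|f (x - t y')|\<close> over the unit sphere. At \<open>t = 0\<close> it gives the pointwise bound for \<open>f\<close>.
\<close>
lemma C1c_sphere_bound:
  fixes f :: "real ^ 'n \<Rightarrow> real"
  assumes f: "C1c f" and "0 \<le> t"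
  shows "ennreal CARD('n) * (\<integral>\<^sup>+y\<in>ball 0 1. ennreal \<bar>f (x - t *\<^sub>R sgn y)\<bar> \<partial>lborel) \<le> riesz (grad_abs f) x"
proof -
  have [measurable]: "grad f \<in> borel_measurable borel"
    using f by (intro grad_measurable) (simp add: C1c_def)
  have "(\<integral>\<^sup>+y\<in>ball 0 1. ennreal \<bar>f (x - t *\<^sub>R sgn y)\<bar> \<partial>lborel)
    \<le> (\<integral>\<^sup>+y\<in>ball 0 1. (\<integral>\<^sup>+r\<in>{0<..}. grad_abs f (x - r *\<^sub>R sgn y) \<partial>lborel) \<partial>lborel)"
  proof (rule nn_integral_mono_AE)
    show "AE y in lborel. ennreal \<bar>f (x - t *\<^sub>R sgn y)\<bar> * indicator (ball 0 1) y
       \<le> (\<integral>\<^sup>+r\<in>{0<..}. grad_abs f (x - r *\<^sub>R sgn y) \<partial>lborel) * indicator (ball 0 1) y"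
      using AE_lborel_singleton[of 0]
      by eventually_elim (intro mult_right_mono C1c_ray_bound assms, auto simp: norm_sgn)
  qed
  also have "\<dots> = ennreal (1 / CARD('n)) * riesz (grad_abs f) x"
    by (subst nn_integral_rays[where g = "\<lambda>z. grad_abs f (x - z)"]) (simp, simp add: riesz_alt)
  finally have "ennreal CARD('n) * (\<integral>\<^sup>+y\<in>ball 0 1. ennreal \<bar>f (x - t *\<^sub>R sgn y)\<bar> \<partial>lborel)
    \<le> ennreal CARD('n) * (ennreal (1 / CARD('n)) * riesz (grad_abs f) x)"
    by (rule mult_left_mono) simp
  also have "\<dots> = riesz (grad_abs f) x"
    by (simp add: mult.assoc[symmetric] flip: ennreal_mult)
  finally show ?thesis .
qed

lemma ennreal_inverse_cancel: "0 < s \<Longrightarrow> ennreal (1 / s) * ennreal s = 1"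
  by (simp flip: ennreal_mult)

lemma ennreal_one_plus_inverse:
  assumes "0 < s" shows "ennreal (1 / s) * ennreal (s + 1) = ennreal (1 + 1 / s)"
proof -
  have "1 / s * (s + 1) = 1 + 1 / s" using assms by (simp add: field_simps)
  then show ?thesis using assms by (subst ennreal_mult[symmetric]) auto
qed

abbreviation sphere_area :: "nat \<Rightarrow> real" where
  "sphere_area n \<equiv> real n * unit_ball_vol (real n)"

lemma C1c_riesz_bound:
  fixes f :: "real ^ 'n \<Rightarrow> real"
  assumes f: "C1c f"
  shows "ennreal \<bar>f x\<bar> \<le> ennreal (1 / sphere_area CARD('n)) * riesz (grad_abs f) x"
proof -
  let ?s = "sphere_area CARD('n)"
  have s: "?s > 0" by simp
  have "ennreal CARD('n) * (\<integral>\<^sup>+y\<in>ball (0::real^'n) 1. ennreal \<bar>f x\<bar> \<partial>lborel) \<le> riesz (grad_abs f) x"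
    using C1c_sphere_bound[OF f, of 0 x] by simp
  also have "(\<integral>\<^sup>+y\<in>ball (0::real^'n) 1. ennreal \<bar>f x\<bar> \<partial>lborel) = ennreal \<bar>f x\<bar> * ennreal (unit_ball_vol CARD('n))"
    by (subst nn_integral_cmult_indicator) (auto simp: emeasure_ball)
  finally have "ennreal ?s * ennreal \<bar>f x\<bar> \<le> riesz (grad_abs f) x"
    by (simp add: ennreal_mult mult_ac)
  then have "ennreal (1 / ?s) * (ennreal ?s * ennreal \<bar>f x\<bar>) \<le> ennreal (1 / ?s) * riesz (grad_abs f) x"
    by (rule mult_left_mono) simp
  moreover have "ennreal (1 / ?s) * ennreal ?s = 1"
    by (rule ennreal_inverse_cancel[OF s])
  ultimately show ?thesis by (simp only: mult.assoc[symmetric] mult_1)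
qed

section \<open>Sobolev's inequality of weak type\<close>

text \<open>
  The exponent \<open>1/n' = (n - 1)/n\<close> applied to the measure of a set, as in the Lorentz norm.
\<close>
abbreviation sobolev_pow :: "'n itself \<Rightarrow> ennreal \<Rightarrow> ennreal" where
  "sobolev_pow n m \<equiv> epowr m (1 / conj_dim n)"

lemma epowr_measurable[measurable]: "(\<lambda>x. epowr x a) \<in> borel_measurable borel"
  unfolding epowr_def by measurable

lemma epowr_mono: "x \<le> y \<Longrightarrow> 0 \<le> a \<Longrightarrow> epowr x a \<le> epowr y a"
  by (cases x; cases y) (auto simp: epowr_def powr_mono2 ennreal_leI top_unique)

lemma inverse_conj_dim: "2 \<le> CARD('n) \<Longrightarrow> 1 / conj_dim TYPE('n::finite) = real (CARD('n) - 1) / real CARD('n)"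
  by (simp add: conj_dim_def of_nat_diff)

lemma sobolev_pow_power:
  assumes "2 \<le> CARD('n::finite)" "0 \<le> R"
  shows "sobolev_pow TYPE('n) (ennreal (R ^ CARD('n))) = ennreal (R ^ (CARD('n) - 1))"
proof (cases "R = 0")
  case False
  then have "R > 0" using assms by simp
  then have "(R ^ CARD('n)) powr (real (CARD('n) - 1) / real CARD('n)) = R ^ (CARD('n) - 1)"
    by (simp add: powr_realpow[symmetric] powr_powr)
  then show ?thesis using assms by (simp add: epowr_def inverse_conj_dim)
qed (use assms in \<open>auto simp: epowr_def power_0_left\<close>)

lemma sobolev_pow_mono: 
  "2 \<le> CARD('n::finite) \<Longrightarrow> x \<le> y \<Longrightarrow> sobolev_pow TYPE('n) x \<le> sobolev_pow TYPE('n) y"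
  by (intro epowr_mono) (auto simp: inverse_conj_dim)

text \<open>
  Writing measures as \<open>n\<close>-th powers of a length keeps fractional powers out of the estimates.
\<close>
lemma ennreal_eq_power:
  assumes "m < \<infinity>" "0 < n"
  obtains R where "0 \<le> R" "m = ennreal (R ^ n)"
proof -
  obtain r where r: "0 \<le> r" "m = ennreal r" using assms by (cases m) auto
  show ?thesis using r assms by (intro that[of "root n r"]) (auto simp: real_root_pow_pos2)
qed

text \<open>
  Integrating \<open>|f| \<le> c I\<^sub>1|\<nabla>f|\<close> over the superlevel set and exchanging integrals moves \<open>I\<^sub>1\<close> to the indicator
  function of that set, whose potential is bounded by the \<open>n\<close>-th root of the measure.
\<close>
lemma C1c_weak_sobolev:
  fixes f :: "real ^ 'n \<Rightarrow> real"
  assumes n: "2 \<le> CARD('n)" and f: "C1c f" and t: "0 < t"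
  shows "ennreal t * sobolev_pow TYPE('n) (emeasure lborel {y. t < \<bar>f y\<bar>})
    \<le> ennreal (1 + 1 / sphere_area CARD('n)) * (\<integral>\<^sup>+y. grad_abs f y \<partial>lborel)"
proof -
  let ?n = "CARD('n)" and ?s = "sphere_area CARD('n)"
  have s: "?s > 0" by simp
  have [measurable]: "f \<in> borel_measurable borel" "grad f \<in> borel_measurable borel"
    using f by (intro C1_measurable grad_measurable, simp add: C1c_def)+
  define E where "E = {y. t < \<bar>f y\<bar>}"
  have E[measurable]: "E \<in> sets borel" unfolding E_def by measurable
  have "bounded E" using f t by (auto simp: C1c_def E_def intro: bounded_subset)
  then have "emeasure lborel E < \<infinity>" by (rule emeasure_bounded_finite)
  then obtain R where R: "0 \<le> R" "emeasure lborel E = ennreal (R ^ ?n)"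
    by (rule ennreal_eq_power[of _ ?n]) auto
  show ?thesis
  proof (cases "R = 0")
    case True
    then show ?thesis using R n by (simp add: E_def[symmetric] epowr_def power_0_left)
  next
    case False
    then have R0: "R > 0" using R by simp
    have "ennreal t * ennreal (R ^ ?n) = (\<integral>\<^sup>+y\<in>E. ennreal t \<partial>lborel)"
      by (subst nn_integral_cmult_indicator) (auto simp: R)
    also have "\<dots> \<le> (\<integral>\<^sup>+y\<in>E. (ennreal (1 / ?s) * riesz (grad_abs f) y) \<partial>lborel)"
    proof (intro nn_integral_mono)
      fix y show "ennreal t * indicator E y \<le> ennreal (1 / ?s) * riesz (grad_abs f) y * indicator E y"
      proof (cases "y \<in> E")
        case True
        then have "ennreal t \<le> ennreal \<bar>f y\<bar>" by (auto simp: E_def intro!: ennreal_leI)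
        also note C1c_riesz_bound[OF f]
        finally show ?thesis using True by simp
      qed simp
    qed
    also have "\<dots> = ennreal (1 / ?s) * (\<integral>\<^sup>+y. \<integral>\<^sup>+z. grad_abs f z * (riesz_kernel (y - z) * indicator E y) \<partial>lborel \<partial>lborel)"
      unfolding riesz_def by (simp add: nn_integral_cmult[symmetric] nn_integral_multc[symmetric] mult.assoc)
    also have "(\<integral>\<^sup>+y. \<integral>\<^sup>+z. grad_abs f z * (riesz_kernel (y - z) * indicator E y) \<partial>lborel \<partial>lborel)
      = (\<integral>\<^sup>+z. \<integral>\<^sup>+y. grad_abs f z * (riesz_kernel (z - y) * indicator E y) \<partial>lborel \<partial>lborel)"
    proof (subst tonelli_lborel)
      have "riesz_kernel (y - z) = riesz_kernel (z - y)" for y z :: "real^'n"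
        by (metis minus_diff_eq riesz_kernel_minus)
      then show "(\<integral>\<^sup>+ y. \<integral>\<^sup>+ x. grad_abs f y * (riesz_kernel (x - y) * indicator E x) \<partial>lborel \<partial>lborel) =
        (\<integral>\<^sup>+ z. \<integral>\<^sup>+ y. grad_abs f z * (riesz_kernel (z - y) * indicator E y) \<partial>lborel \<partial>lborel)" by simp
    qed measurable
    also have "\<dots> = (\<integral>\<^sup>+z. grad_abs f z * (\<integral>\<^sup>+y\<in>E. riesz_kernel (z - y) \<partial>lborel) \<partial>lborel)"
      by (intro nn_integral_cong nn_integral_cmult) measurable
    also have "\<dots> \<le> (\<integral>\<^sup>+z. grad_abs f z * ennreal ((?s + 1) * R) \<partial>lborel)"
      using R R0 by (intro nn_integral_mono mult_left_mono riesz_kernel_set) auto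
    also have "\<dots> = (\<integral>\<^sup>+z. grad_abs f z \<partial>lborel) * ennreal ((?s + 1) * R)"
      by (rule nn_integral_multc) measurable
    finally have "ennreal t * ennreal (R ^ ?n) \<le> ennreal (1 / ?s) * ((\<integral>\<^sup>+z. grad_abs f z \<partial>lborel) * ennreal ((?s + 1) * R))"
      by (simp add: mult_left_mono)
    also have "ennreal t * ennreal (R ^ ?n) = ennreal R * (ennreal t * ennreal (R ^ (?n - 1)))"
    proof -
      have "R ^ ?n = R * R ^ (?n - 1)" by (cases ?n) auto
      then show ?thesis using R t by (simp add: mult_ac flip: ennreal_mult)
    qed
    also have "ennreal (1 / ?s) * ((\<integral>\<^sup>+z. grad_abs f z \<partial>lborel) * ennreal ((?s + 1) * R))
      = (ennreal (1 / ?s) * ennreal (?s + 1)) * (ennreal R * (\<integral>\<^sup>+z. grad_abs f z \<partial>lborel))"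
      using R s by (simp add: mult_ac ennreal_mult)
    also have "ennreal (1 / ?s) * ennreal (?s + 1) = ennreal (1 + 1 / ?s)"
      by (rule ennreal_one_plus_inverse[OF s])
    finally have "ennreal R * (ennreal t * ennreal (R ^ (?n - 1)))
       \<le> ennreal R * (ennreal (1 + 1 / ?s) * (\<integral>\<^sup>+z. grad_abs f z \<partial>lborel))"
      by (simp add: mult_ac)
    then have "ennreal t * ennreal (R ^ (?n - 1)) \<le> ennreal (1 + 1 / ?s) * (\<integral>\<^sup>+z. grad_abs f z \<partial>lborel)"
      using R0 by (subst (asm) ennreal_mult_le_mult_iff) auto
    then show ?thesis using R n by (simp add: E_def[symmetric] sobolev_pow_power)
  qed
qed

section \<open>Sobolev's inequality in the Lorentz space\<close>

lemma C1_compose: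
  fixes f :: "real ^ 'n \<Rightarrow> real"
  assumes f: "C1 f" and g: "\<And>s. DERIV g s :> g' s" "continuous_on UNIV g'"
  shows "C1 (\<lambda>x. g (f x))" "grad (\<lambda>x. g (f x)) = (\<lambda>x. g' (f x) *\<^sub>R grad f x)"
proof -
  have 1: "GDERIV (\<lambda>x. g (f x)) x :> g' (f x) *\<^sub>R grad f x" for x
    using f g by (intro GDERIV_DERIV_compose) (auto simp: C1_def)
  have 2: "continuous_on UNIV (\<lambda>x. g' (f x) *\<^sub>R grad f x)"
    using f C1_continuous[OF f] by (intro continuous_intros continuous_on_compose2[OF g(2)]) (auto simp: C1_def)
  show "C1 (\<lambda>x. g (f x))" "grad (\<lambda>x. g (f x)) = (\<lambda>x. g' (f x) *\<^sub>R grad f x)"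
    using C1I[OF 1 2] by auto
qed

lemma C1_mult:
  fixes f g :: "real ^ 'n \<Rightarrow> real"
  assumes f: "C1 f" and g: "C1 g"
  shows "C1 (\<lambda>x. f x * g x)" "grad (\<lambda>x. f x * g x) = (\<lambda>x. f x *\<^sub>R grad g x + g x *\<^sub>R grad f x)"
proof -
  have 1: "GDERIV (\<lambda>x. f x * g x) x :> f x *\<^sub>R grad g x + g x *\<^sub>R grad f x" for x
    using f g by (intro GDERIV_mult) (auto simp: C1_def)
  have 2: "continuous_on UNIV (\<lambda>x. f x *\<^sub>R grad g x + g x *\<^sub>R grad f x)"
    using f g C1_continuous[OF f] C1_continuous[OF g] by (intro continuous_intros) (auto simp: C1_def)
  show "C1 (\<lambda>x. f x * g x)" "grad (\<lambda>x. f x * g x) = (\<lambda>x. f x *\<^sub>R grad g x + g x *\<^sub>R grad f x)"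
    using C1I[OF 1 2] by auto
qed

lemma C1_minus_const:
  fixes f :: "real ^ 'n \<Rightarrow> real"
  assumes f: "C1 f"
  shows "C1 (\<lambda>x. f x - c)" "grad (\<lambda>x. f x - c) = grad f"
proof -
  have 1: "GDERIV (\<lambda>x. f x - c) x :> grad f x" for x
    using GDERIV_diff[of f x "grad f x" "\<lambda>_. c" 0] f by (auto simp: C1_def GDERIV_const)
  have 2: "continuous_on UNIV (grad f)" using f by (simp add: C1_def)
  show "C1 (\<lambda>x. f x - c)" "grad (\<lambda>x. f x - c) = grad f"
    using C1I[OF 1 2] by auto
qed

lemma C1_sq_dist:
  fixes x :: "real ^ 'n"
  shows "C1 (\<lambda>y. (norm (y - x))\<^sup>2)" "grad (\<lambda>y. (norm (y - x))\<^sup>2) = (\<lambda>y. 2 *\<^sub>R (y - x))"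
proof -
  have 1: "GDERIV (\<lambda>y. (norm (y - x))\<^sup>2) y :> 2 *\<^sub>R (y - x)" for y
    unfolding gderiv_def power2_norm_eq_inner
    by (auto intro!: derivative_eq_intros simp: inner_commute inner_diff_left inner_diff_right algebra_simps)
  have 2: "continuous_on UNIV (\<lambda>y. 2 *\<^sub>R (y - x))" by (intro continuous_intros)
  show "C1 (\<lambda>y. (norm (y - x))\<^sup>2)" "grad (\<lambda>y. (norm (y - x))\<^sup>2) = (\<lambda>y. 2 *\<^sub>R (y - x))"
    using C1I[OF 1 2] by auto
qed

lemma DERIV_max_0_squared: "DERIV (\<lambda>s::real. (max 0 s)\<^sup>2) s :> 2 * max 0 s"
proof (cases "s = 0")
  case True
  have "((\<lambda>h::real. (max 0 h)\<^sup>2 / h) \<longlongrightarrow> 0) (at 0)"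
  proof (rule Lim_null_comparison)
    show "eventually (\<lambda>h::real. norm ((max 0 h)\<^sup>2 / h) \<le> \<bar>h\<bar>) (at 0)"
      by (rule always_eventually) (auto simp: max_def power2_eq_square)
    show "((\<lambda>h::real. \<bar>h\<bar>) \<longlongrightarrow> 0) (at 0)" by (intro tendsto_rabs_zero tendsto_ident_at)
  qed
  then show ?thesis using True by (simp add: DERIV_def)
next
  case False
  show ?thesis
  proof (cases "s > 0")
    case True
    have "DERIV (\<lambda>s::real. s\<^sup>2) s :> 2 * max 0 s"
      using True by (auto intro!: derivative_eq_intros)
    then show ?thesis
      by (rule has_field_derivative_transform_within_open[of _ _ _ "{0<..}"]) (use True in auto)
  next
    case neg: False
    have "DERIV (\<lambda>s::real. 0) s :> 2 * max 0 s"
      using neg by (auto intro!: derivative_eq_intros)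
    then show ?thesis
      by (rule has_field_derivative_transform_within_open[of _ _ _ "{..<0}"]) (use neg False in auto)
  qed
qed

text \<open>
  A quadratic spline, which vanishes up to \<open>1\<close> and is \<open>1\<close> from \<open>4\<close> on. It is applied to squares, so that
  the truncations live between the heights \<open>t\<close> and \<open>2 t\<close> and the cutoffs between the radii \<open>R\<close> and \<open>2 R\<close>.
\<close>
definition smooth_step :: "real \<Rightarrow> real" where
  "smooth_step s = 2 / 9 * ((max 0 (s - 1))\<^sup>2 - 2 * (max 0 (s - 5 / 2))\<^sup>2 + (max 0 (s - 4))\<^sup>2)"

definition smooth_step' :: "real \<Rightarrow> real" where
  "smooth_step' s = 4 / 9 * (max 0 (s - 1) - 2 * max 0 (s - 5 / 2) + max 0 (s - 4))"

lemma smooth_step_0: "s \<le> 1 \<Longrightarrow> smooth_step s = 0"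
  by (simp add: smooth_step_def max_def)

lemma smooth_step_1: "4 \<le> s \<Longrightarrow> smooth_step s = 1"
  by (simp add: smooth_step_def max_def power2_eq_square field_simps)

lemma smooth_step'_0: "s \<le> 1 \<or> 4 \<le> s \<Longrightarrow> smooth_step' s = 0"
  by (auto simp: smooth_step'_def max_def field_simps)

lemma smooth_step'_bounds: "0 \<le> smooth_step' s" "smooth_step' s \<le> 2 / 3"
  by (auto simp: smooth_step'_def max_def)

lemma DERIV_smooth_step: "DERIV smooth_step s :> smooth_step' s"
proof -
  have *: "DERIV (\<lambda>s::real. (max 0 (s - a))\<^sup>2) s :> 2 * max 0 (s - a)" for a
    using DERIV_shift[of "\<lambda>s. (max 0 s)\<^sup>2" "2 * max 0 (s - a)" s "- a"] DERIV_max_0_squared[of "s - a"] by simp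
  show ?thesis
    unfolding smooth_step_def[abs_def] smooth_step'_def
    by (rule derivative_eq_intros * refl | simp)+
qed

lemma continuous_smooth_step': "continuous_on A smooth_step'"
  unfolding smooth_step'_def[abs_def] by (intro continuous_intros)

lemma smooth_step_bounds: "0 \<le> smooth_step s" "smooth_step s \<le> 1"
proof -
  have mono: "smooth_step a \<le> smooth_step b" if "a \<le> b" for a b
    using DERIV_nonneg_imp_nondecreasing[OF that] DERIV_smooth_step smooth_step'_bounds by blast
  show "0 \<le> smooth_step s" using mono[of "min 1 s" s] by (simp add: smooth_step_0)
  show "smooth_step s \<le> 1" using mono[of s "max 4 s"] by (simp add: smooth_step_1)
qed

lemma sobolev_pow_measurable:
  fixes f :: "real ^ 'n \<Rightarrow> real"
  assumes [measurable]: "f \<in> borel_measurable borel" "E \<in> sets borel"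
  shows "(\<lambda>t. sobolev_pow TYPE('n) (emeasure lborel {y\<in>E. t < \<bar>f y\<bar>})) \<in> borel_measurable borel"
proof -
  have "emeasure lborel {y\<in>E. t < \<bar>f y\<bar>} = (\<integral>\<^sup>+y. (if y \<in> E \<and> t < \<bar>f y\<bar> then 1 else 0) \<partial>lborel)" for t
  proof -
    have "(\<integral>\<^sup>+y. (if y \<in> E \<and> t < \<bar>f y\<bar> then 1 else 0) \<partial>lborel) = (\<integral>\<^sup>+y. indicator {y\<in>E. t < \<bar>f y\<bar>} y \<partial>lborel)"
      by (intro nn_integral_cong) (auto simp: indicator_def)
    also have "\<dots> = emeasure lborel {y\<in>E. t < \<bar>f y\<bar>}" by (rule nn_integral_indicator) measurable
    finally show ?thesis ..
  qed
  then show ?thesis by simp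
qed

definition lorentz_const :: "nat \<Rightarrow> real" where
  "lorentz_const n = 32 / 3 * (1 + 1 / sphere_area n)"

lemma lorentz_const_nonneg: "0 \<le> lorentz_const n"
  by (simp add: lorentz_const_def)

text \<open>
  A given value \<open>a\<close> of \<open>|f|\<close> is seen only by the truncations at heights between \<open>a/2\<close> and \<open>a\<close>, a set of
  bounded logarithmic measure.
\<close>
lemma nn_integral_log_scale:
  fixes a :: real
  assumes "0 \<le> a"
  shows "(\<integral>\<^sup>+t\<in>{0<..}. ennreal (1 / t) * indicator {t. t < a \<and> a < 2 * t} t \<partial>lborel) \<le> 1"
proof (cases "a = 0")
  case False
  then have a: "a > 0" using assms by simp
  have "(\<integral>\<^sup>+t\<in>{0<..}. ennreal (1 / t) * indicator {t. t < a \<and> a < 2 * t} t \<partial>lborel)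
    \<le> (\<integral>\<^sup>+t. ennreal (2 / a) * indicator {a / 2..a} t \<partial>lborel)"
    using a by (intro nn_integral_mono) (auto simp: indicator_def field_simps intro!: ennreal_leI)
  also have "\<dots> = ennreal (2 / a) * ennreal (a / 2)"
    using a by (subst nn_integral_cmult_indicator) auto
  also have "\<dots> = 1" using a by (simp flip: ennreal_mult)
  finally show ?thesis .
next
  case True
  then have *: "\<And>t. ennreal (1 / t) * indicator {t. t < a \<and> a < 2 * t} t * indicator {0<..} t = 0"
    by (auto simp: indicator_def)
  show ?thesis unfolding * by simp
qed

lemma C1c_truncate:
  fixes f :: "real ^ 'n \<Rightarrow> real"
  assumes f: "C1c f" and t: "0 < t"
  shows "C1c (\<lambda>y. smooth_step ((f y)\<^sup>2 / t\<^sup>2))"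
    and "grad_abs (\<lambda>y. smooth_step ((f y)\<^sup>2 / t\<^sup>2)) y
      \<le> ennreal (8 / 3) * (grad_abs f y * (ennreal (1 / t) * indicator {t. t < \<bar>f y\<bar> \<and> \<bar>f y\<bar> < 2 * t} t))"
proof -
  let ?g' = "\<lambda>s. smooth_step' (s\<^sup>2 / t\<^sup>2) * (2 * s / t\<^sup>2)"
  have g: "DERIV (\<lambda>s. smooth_step (s\<^sup>2 / t\<^sup>2)) s :> ?g' s" for s
  proof -
    have "DERIV (\<lambda>s. s\<^sup>2 / t\<^sup>2) s :> 2 * s / t\<^sup>2" 
      by (rule DERIV_cdivide) (auto intro!: derivative_eq_intros)
    then show ?thesis by (rule DERIV_chain2[OF DERIV_smooth_step])
  qed
  have g': "continuous_on UNIV ?g'"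
  proof (rule continuous_on_mult)
    have "continuous_on UNIV (\<lambda>s. s\<^sup>2 / t\<^sup>2)" using t by (intro continuous_intros) auto
    then show "continuous_on UNIV (\<lambda>s. smooth_step' (s\<^sup>2 / t\<^sup>2))"
      by (rule continuous_on_compose2[OF continuous_smooth_step'[of UNIV]]) auto
    show "continuous_on UNIV (\<lambda>s. 2 * s / t\<^sup>2)" using t by (intro continuous_intros) auto
  qed
  from f have f1: "C1 f" and fb: "bounded {x. f x \<noteq> 0}" by (auto simp: C1c_def)
  note C = C1_compose[OF f1 g g']
  have "bounded {x. smooth_step ((f x)\<^sup>2 / t\<^sup>2) \<noteq> 0}"
    by (rule bounded_subset[OF fb]) (auto simp: smooth_step_0)
  with C show "C1c (\<lambda>y. smooth_step ((f y)\<^sup>2 / t\<^sup>2))" by (simp add: C1c_def)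
  have "\<bar>?g' s\<bar> \<le> 8 / 3 * (1 / t * indicator {t. t < \<bar>s\<bar> \<and> \<bar>s\<bar> < 2 * t} t)" for s
  proof (cases "t < \<bar>s\<bar> \<and> \<bar>s\<bar> < 2 * t")
    case True
    have "\<bar>?g' s\<bar> = smooth_step' (s\<^sup>2 / t\<^sup>2) * (2 * \<bar>s\<bar> / t\<^sup>2)"
      using smooth_step'_bounds[of "s\<^sup>2 / t\<^sup>2"] by (simp add: abs_mult)
    also have "\<dots> \<le> 2 / 3 * (2 * (2 * t) / t\<^sup>2)"
      using True smooth_step'_bounds[of "s\<^sup>2 / t\<^sup>2"] t by (intro mult_mono divide_right_mono) auto
    also have "\<dots> = 8 / 3 * (1 / t)" using t by (simp add: power2_eq_square)
    finally show ?thesis using True by simp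
  next
    case False
    then have "s\<^sup>2 \<le> t\<^sup>2 \<or> (2 * t)\<^sup>2 \<le> s\<^sup>2"
      using t abs_le_square_iff[of s t] abs_le_square_iff[of "2 * t" s] by auto
    then have "smooth_step' (s\<^sup>2 / t\<^sup>2) = 0"
      using t by (intro smooth_step'_0) (auto simp: field_simps)
    with False show ?thesis by auto
  qed
  from this[of "f y"] have "\<bar>?g' (f y)\<bar> * norm (grad f y)
      \<le> 8 / 3 * (1 / t * indicator {t. t < \<bar>f y\<bar> \<and> \<bar>f y\<bar> < 2 * t} t) * norm (grad f y)"
    by (rule mult_right_mono) simp
  then have "grad_abs (\<lambda>y. smooth_step ((f y)\<^sup>2 / t\<^sup>2)) y
    \<le> ennreal (8 / 3 * (1 / t * indicator {t. t < \<bar>f y\<bar> \<and> \<bar>f y\<bar> < 2 * t} t) * norm (grad f y))"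
    unfolding C(2) by (intro ennreal_leI) simp
  also have "\<dots> = ennreal (8 / 3) * (grad_abs f y * (ennreal (1 / t) * indicator {t. t < \<bar>f y\<bar> \<and> \<bar>f y\<bar> < 2 * t} t))"
    using t by (auto simp: indicator_def mult_ac simp flip: ennreal_mult)
  finally show "grad_abs (\<lambda>y. smooth_step ((f y)\<^sup>2 / t\<^sup>2)) y
      \<le> ennreal (8 / 3) * (grad_abs f y * (ennreal (1 / t) * indicator {t. t < \<bar>f y\<bar> \<and> \<bar>f y\<bar> < 2 * t} t))" .
qed

text \<open>
  Maz'ya's truncation argument with a continuous parameter. The weak-type inequality at height \<open>1/2\<close> for the
  truncation of \<open>f\<close> between \<open>t\<close> and \<open>2 t\<close> involves only the part of \<open>\<nabla>f\<close> where \<open>t < |f| < 2 t\<close>; integrating in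
  \<open>t\<close>, these parts overlap boundedly.
\<close>
lemma C1c_lorentz_sobolev:
  fixes f :: "real ^ 'n \<Rightarrow> real"
  assumes n: "2 \<le> CARD('n)" and f: "C1c f"
  shows "(\<integral>\<^sup>+t\<in>{0<..}. sobolev_pow TYPE('n) (emeasure lborel {y. t < \<bar>f y\<bar>}) \<partial>lborel)
    \<le> ennreal (lorentz_const CARD('n)) * (\<integral>\<^sup>+y. grad_abs f y \<partial>lborel)"
proof -
  let ?p = "sobolev_pow TYPE('n)"
  define S where "S = 1 + 1 / sphere_area CARD('n)"
  have S: "0 \<le> S" by (simp add: S_def)
  have [measurable]: "f \<in> borel_measurable borel" "grad f \<in> borel_measurable borel"
    using f by (intro C1_measurable grad_measurable, simp add: C1c_def)+
  have [measurable]: "(\<lambda>t. ?p (emeasure lborel {y. t < \<bar>f y\<bar>})) \<in> borel_measurable borel"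
    using sobolev_pow_measurable[of f UNIV] by simp
  define I where "I t y = (if 0 < t \<and> t < \<bar>f y\<bar> \<and> \<bar>f y\<bar> < 2 * t then ennreal (1 / t) else 0)" for t :: real and y
  have I_meas[measurable]: "(\<lambda>(t, y). I t y) \<in> borel_measurable (borel \<Otimes>\<^sub>M borel)"
    unfolding I_def by measurable
  have I_eq: "I t y = ennreal (1 / t) * indicator {t. t < \<bar>f y\<bar> \<and> \<bar>f y\<bar> < 2 * t} t * indicator {0<..} t" for t y
    by (auto simp: I_def indicator_def)
  \<comment> \<open>On the set where \<open>|f| > 2 t\<close> the truncation equals \<open>1\<close>, so height \<open>1/2\<close> captures it.\<close>
  have step: "?p (emeasure lborel {y. 2 * t < \<bar>f y\<bar>}) * indicator {0<..} t
     \<le> ennreal (16 / 3 * S) * (\<integral>\<^sup>+y. grad_abs f y * I t y \<partial>lborel)" (is "?L \<le> ?R") for t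
  proof (cases "t > 0")
    case True
    let ?h = "\<lambda>y. smooth_step ((f y)\<^sup>2 / t\<^sup>2)"
    have "{y. 2 * t < \<bar>f y\<bar>} \<subseteq> {y. 1 / 2 < \<bar>?h y\<bar>}"
    proof safe
      fix y assume "2 * t < \<bar>f y\<bar>"
      then have "(2 * t)\<^sup>2 \<le> (f y)\<^sup>2" using True abs_le_square_iff[of "2 * t" "f y"] by simp
      then have "?h y = 1" using True by (intro smooth_step_1) (simp add: field_simps)
      then show "1 / 2 < \<bar>?h y\<bar>" by simp
    qed
    then have "?p (emeasure lborel {y. 2 * t < \<bar>f y\<bar>}) \<le> ?p (emeasure lborel {y. 1 / 2 < \<bar>?h y\<bar>})"
      using C1_measurable[of ?h] C1c_truncate(1)[OF f True]
      by (intro sobolev_pow_mono n emeasure_mono) (auto simp: C1c_def)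
    also have "\<dots> = ennreal 2 * (ennreal (1 / 2) * ?p (emeasure lborel {y. 1 / 2 < \<bar>?h y\<bar>}))"
    proof -
      have "ennreal 2 * ennreal (1 / 2) = 1" 
      proof -
        have "ennreal 2 * ennreal (1 / 2) = ennreal (2 * (1 / 2))" by (rule ennreal_mult[symmetric]) auto
        then show ?thesis by simp
      qed
      then show ?thesis by (simp only: mult.assoc[symmetric] mult_1)
    qed
    also have "\<dots> \<le> ennreal 2 * (ennreal S * (\<integral>\<^sup>+y. grad_abs ?h y \<partial>lborel))"
    proof (rule mult_left_mono)
      show "ennreal (1 / 2) * ?p (emeasure lborel {y. 1 / 2 < \<bar>?h y\<bar>}) \<le> ennreal S * (\<integral>\<^sup>+y. grad_abs ?h y \<partial>lborel)"
        unfolding S_def by (rule C1c_weak_sobolev[OF n C1c_truncate(1)[OF f True]]) simp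
    qed simp
    also have "\<dots> \<le> ennreal 2 * (ennreal S * (\<integral>\<^sup>+y. ennreal (8 / 3) * (grad_abs f y * (ennreal (1 / t) * indicator {t. t < \<bar>f y\<bar> \<and> \<bar>f y\<bar> < 2 * t} t)) \<partial>lborel))"
      by (intro mult_left_mono nn_integral_mono C1c_truncate f True) auto
    also have "\<dots> = ennreal 2 * (ennreal S * (ennreal (8 / 3) * (\<integral>\<^sup>+y. grad_abs f y * I t y \<partial>lborel)))"
    proof -
      have "(\<integral>\<^sup>+y. ennreal (8 / 3) * (grad_abs f y * (ennreal (1 / t) * indicator {t. t < \<bar>f y\<bar> \<and> \<bar>f y\<bar> < 2 * t} t)) \<partial>lborel)
        = (\<integral>\<^sup>+y. ennreal (8 / 3) * (grad_abs f y * I t y) \<partial>lborel)"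
        using True by (simp add: I_eq)
      also have "\<dots> = ennreal (8 / 3) * (\<integral>\<^sup>+y. grad_abs f y * I t y \<partial>lborel)"
        by (rule nn_integral_cmult) measurable
      finally show ?thesis by simp
    qed
    also have "\<dots> = ?R"
    proof -
      have "ennreal (2 * (S * (8 / 3))) = ennreal 2 * (ennreal S * ennreal (8 / 3))"
      proof -
        have "ennreal (2 * (S * (8 / 3))) = ennreal 2 * ennreal (S * (8 / 3))"
          by (rule ennreal_mult) (use S in auto)
        also have "ennreal (S * (8 / 3)) = ennreal S * ennreal (8 / 3)"
          by (rule ennreal_mult) (use S in auto)
        finally show ?thesis .
      qed
      moreover have "2 * (S * (8 / 3)) = 16 / 3 * S" by simp
      ultimately show ?thesis by (simp only: mult.assoc)
    qed
    finally show ?thesis using True by simp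
  qed simp
  have "(\<integral>\<^sup>+t\<in>{0<..}. ?p (emeasure lborel {y. t < \<bar>f y\<bar>}) \<partial>lborel)
    = ennreal \<bar>2\<bar> * (\<integral>\<^sup>+t. ?p (emeasure lborel {y. 0 + 2 * t < \<bar>f y\<bar>}) * indicator {0<..} (0 + 2 * t) \<partial>lborel)"
    by (rule nn_integral_real_affine) auto
  also have "(\<integral>\<^sup>+t. ?p (emeasure lborel {y. 0 + 2 * t < \<bar>f y\<bar>}) * indicator {0<..} (0 + 2 * t) \<partial>lborel)
    \<le> (\<integral>\<^sup>+t. ennreal (16 / 3 * S) * (\<integral>\<^sup>+y. grad_abs f y * I t y \<partial>lborel) \<partial>lborel)"
    using step by (intro nn_integral_mono) (simp add: indicator_def)
  also have "\<dots> = ennreal (16 / 3 * S) * (\<integral>\<^sup>+t. \<integral>\<^sup>+y. grad_abs f y * I t y \<partial>lborel \<partial>lborel)"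
    by (rule nn_integral_cmult) measurable
  also have "(\<integral>\<^sup>+t. \<integral>\<^sup>+y. grad_abs f y * I t y \<partial>lborel \<partial>lborel) = (\<integral>\<^sup>+y. \<integral>\<^sup>+t. grad_abs f y * I t y \<partial>lborel \<partial>lborel)"
    by (rule tonelli_lborel) measurable
  also have "\<dots> = (\<integral>\<^sup>+y. grad_abs f y * (\<integral>\<^sup>+t. I t y \<partial>lborel) \<partial>lborel)"
    
    by (rule nn_integral_cong, rule nn_integral_cmult) measurable
  also have "\<dots> \<le> (\<integral>\<^sup>+y. grad_abs f y * 1 \<partial>lborel)"
    by (intro nn_integral_mono mult_left_mono) (simp_all add: I_eq nn_integral_log_scale)
  finally have "(\<integral>\<^sup>+t\<in>{0<..}. ?p (emeasure lborel {y. t < \<bar>f y\<bar>}) \<partial>lborel)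
    \<le> ennreal 2 * (ennreal (16 / 3 * S) * (\<integral>\<^sup>+y. grad_abs f y \<partial>lborel))"
    by (simp add: mult_left_mono)
  also have "\<dots> = ennreal (lorentz_const CARD('n)) * (\<integral>\<^sup>+y. grad_abs f y \<partial>lborel)"
  proof -
    have "ennreal 2 * ennreal (16 / 3 * S) = ennreal (2 * (16 / 3 * S))"
      by (rule ennreal_mult[symmetric]) (use S in auto)
    moreover have "2 * (16 / 3 * S) = lorentz_const CARD('n)" by (simp add: lorentz_const_def S_def)
    ultimately show ?thesis by (simp only: mult.assoc[symmetric])
  qed
  finally show ?thesis .
qed

section \<open>Sobolev and Poincare inequalities on balls\<close>

text \<open>
  The global inequality for \<open>(f - c) \<eta>\<close>, where \<open>\<eta>\<close> is a cutoff function of the ball. The two constants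
  used later are \<open>0\<close> and one furnished by the Poincare inequality.
\<close>
lemma C1_lorentz_ball:
  fixes f :: "real ^ 'n \<Rightarrow> real"
  assumes n: "2 \<le> CARD('n)" and f: "C1 f" and R: "0 < R"
  shows "(\<integral>\<^sup>+t\<in>{0<..}. sobolev_pow TYPE('n) (emeasure lborel {y\<in>ball x R. t < \<bar>f y - c\<bar>}) \<partial>lborel)
    \<le> ennreal (lorentz_const CARD('n)) * ((\<integral>\<^sup>+y\<in>ball x (2 * R). grad_abs f y \<partial>lborel)
        + ennreal (8 / (3 * R)) * (\<integral>\<^sup>+y\<in>ball x (2 * R). ennreal \<bar>f y - c\<bar> \<partial>lborel))"
proof -
  let ?\<eta> = "\<lambda>y. 1 - smooth_step ((norm (y - x))\<^sup>2 / R\<^sup>2)"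
  let ?g = "\<lambda>s. 1 - smooth_step (s / R\<^sup>2)" and ?g' = "\<lambda>s. - (smooth_step' (s / R\<^sup>2) * (1 / R\<^sup>2))"
  let ?F = "\<lambda>y. (f y - c) * ?\<eta> y"
  have g: "DERIV ?g s :> ?g' s" for s
  proof -
    have "DERIV (\<lambda>s. s / R\<^sup>2) s :> 1 / R\<^sup>2" by (rule DERIV_cdivide) (auto intro!: derivative_eq_intros)
    then have "DERIV (\<lambda>s. smooth_step (s / R\<^sup>2)) s :> smooth_step' (s / R\<^sup>2) * (1 / R\<^sup>2)"
      by (rule DERIV_chain2[OF DERIV_smooth_step])
    from DERIV_diff[OF DERIV_const this, of 1] show ?thesis by simp
  qed
  have g': "continuous_on UNIV ?g'"
  proof -
    have "continuous_on UNIV (\<lambda>s. smooth_step' (s / R\<^sup>2))"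
      by (rule continuous_on_compose2[OF continuous_smooth_step'[of UNIV]]) (use R in \<open>auto intro!: continuous_intros\<close>)
    then show ?thesis by (intro continuous_intros) (use R in auto)
  qed
  note \<eta> = C1_compose[OF C1_sq_dist(1)[of x] g g']
  note fc = C1_minus_const[OF f, of c]
  note F = C1_mult[OF fc(1) \<eta>(1)]
  have far: "?\<eta> y = 0" "smooth_step' ((norm (y - x))\<^sup>2 / R\<^sup>2) = 0" if "y \<notin> ball x (2 * R)" for y
  proof -
    have "2 * R \<le> norm (y - x)" using that by (simp add: dist_norm norm_minus_commute)
    then have "(2 * R)\<^sup>2 \<le> (norm (y - x))\<^sup>2" using R by (intro power_mono) auto
    then have "4 \<le> (norm (y - x))\<^sup>2 / R\<^sup>2" using R by (simp add: field_simps)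
    then show "?\<eta> y = 0" "smooth_step' ((norm (y - x))\<^sup>2 / R\<^sup>2) = 0"
      by (simp_all add: smooth_step_1 smooth_step'_0)
  qed
  have near: "?\<eta> y = 1" if "y \<in> ball x R" for y
  proof -
    have "norm (y - x) \<le> R" using that by (simp add: dist_norm norm_minus_commute)
    then have "(norm (y - x))\<^sup>2 \<le> R\<^sup>2" by (intro power_mono) auto
    then show ?thesis using R by (simp add: smooth_step_0)
  qed
  have "bounded {y. ?F y \<noteq> 0}"
    by (rule bounded_subset[OF bounded_ball[of x "2 * R"]]) (use far(1) in force)
  with F have CF: "C1c ?F" by (simp add: C1c_def)
  have gradF: "grad_abs ?F y \<le> grad_abs f y * indicator (ball x (2 * R)) y
      + ennreal (8 / (3 * R)) * (ennreal \<bar>f y - c\<bar> * indicator (ball x (2 * R)) y)" for y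
  proof (cases "y \<in> ball x (2 * R)")
    case True
    let ?s = "smooth_step' ((norm (y - x))\<^sup>2 / R\<^sup>2)"
    have "norm (grad ?\<eta> y) = ?s / R\<^sup>2 * (2 * norm (y - x))"
      using smooth_step'_bounds(1)[of "(norm (y - x))\<^sup>2 / R\<^sup>2"] by (simp add: \<eta>(2) C1_sq_dist(2))
    also have "\<dots> \<le> (2 / 3) / R\<^sup>2 * (2 * (2 * R))"
      using True R smooth_step'_bounds[of "(norm (y - x))\<^sup>2 / R\<^sup>2"]
      by (intro mult_mono divide_right_mono) (auto simp: dist_norm norm_minus_commute)
    also have "\<dots> = 8 / (3 * R)" using R by (simp add: power2_eq_square field_simps)
    finally have e: "norm (grad ?\<eta> y) \<le> 8 / (3 * R)" .
    have "norm (grad ?F y) \<le> \<bar>f y - c\<bar> * norm (grad ?\<eta> y) + \<bar>?\<eta> y\<bar> * norm (grad f y)"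
      unfolding F(2) fc(2) by (intro order_trans[OF norm_triangle_ineq]) simp
    also have "\<dots> \<le> \<bar>f y - c\<bar> * (8 / (3 * R)) + 1 * norm (grad f y)"
      using smooth_step_bounds[of "(norm (y - x))\<^sup>2 / R\<^sup>2"]
      by (intro add_mono mult_left_mono mult_right_mono e) auto
    finally have "norm (grad ?F y) \<le> norm (grad f y) + 8 / (3 * R) * \<bar>f y - c\<bar>" by simp
    then have "grad_abs ?F y \<le> ennreal (norm (grad f y) + 8 / (3 * R) * \<bar>f y - c\<bar>)"
      by (rule ennreal_leI)
    also have "\<dots> = grad_abs f y + ennreal (8 / (3 * R)) * ennreal \<bar>f y - c\<bar>"
    proof -
      have "ennreal (8 / (3 * R)) * ennreal \<bar>f y - c\<bar> = ennreal (8 / (3 * R) * \<bar>f y - c\<bar>)"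
        by (rule ennreal_mult[symmetric]) (use R in auto)
      then show ?thesis by (simp only:) (rule ennreal_plus, use R in auto)
    qed
    finally show ?thesis using True by simp
  next
    case False
    have "grad ?F y = 0"
      unfolding F(2) \<eta>(2) using far[OF False] by simp
    then show ?thesis by simp
  qed
  have [measurable]: "f \<in> borel_measurable borel" "grad f \<in> borel_measurable borel"
    using f by (simp_all add: C1_measurable grad_measurable)
  have [measurable]: "?F \<in> borel_measurable borel" using CF by (intro C1_measurable) (simp add: C1c_def)
  have "(\<integral>\<^sup>+t\<in>{0<..}. sobolev_pow TYPE('n) (emeasure lborel {y\<in>ball x R. t < \<bar>f y - c\<bar>}) \<partial>lborel)
    \<le> (\<integral>\<^sup>+t\<in>{0<..}. sobolev_pow TYPE('n) (emeasure lborel {y. t < \<bar>?F y\<bar>}) \<partial>lborel)"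
  proof (intro nn_integral_mono mult_right_mono sobolev_pow_mono n emeasure_mono)
    fix t show "{y \<in> ball x R. t < \<bar>f y - c\<bar>} \<subseteq> {y. t < \<bar>?F y\<bar>}"
      using near by force
    show "{y. t < \<bar>?F y\<bar>} \<in> sets lborel" by measurable
  qed simp
  also have "\<dots> \<le> ennreal (lorentz_const CARD('n)) * (\<integral>\<^sup>+y. grad_abs ?F y \<partial>lborel)"
    by (rule C1c_lorentz_sobolev[OF n CF])
  also have "\<dots> \<le> ennreal (lorentz_const CARD('n)) * (\<integral>\<^sup>+y. grad_abs f y * indicator (ball x (2 * R)) y
      + ennreal (8 / (3 * R)) * (ennreal \<bar>f y - c\<bar> * indicator (ball x (2 * R)) y) \<partial>lborel)"
    by (intro mult_left_mono nn_integral_mono gradF) auto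
  also have "\<dots> = ennreal (lorentz_const CARD('n)) * ((\<integral>\<^sup>+y\<in>ball x (2 * R). grad_abs f y \<partial>lborel)
        + ennreal (8 / (3 * R)) * (\<integral>\<^sup>+y\<in>ball x (2 * R). ennreal \<bar>f y - c\<bar> \<partial>lborel))"
    by (subst nn_integral_add) (simp_all add: nn_integral_cmult)
  finally show ?thesis .
qed

text \<open>
  Contraction of a ball towards one of its points \<open>z\<close> stays inside the ball and, for ratios
  at least \<open>1/2\<close>, distorts volumes by at most \<open>2\<^sup>n\<close>.
\<close>
lemma nn_integral_ball_contract:
  fixes g :: "real ^ 'n \<Rightarrow> ennreal"
  assumes [measurable]: "g \<in> borel_measurable borel" and z: "z \<in> ball x R" and s: "1 / 2 \<le> s" "s \<le> 1"
  shows "(\<integral>\<^sup>+y\<in>ball x R. g ((1 - s) *\<^sub>R z + s *\<^sub>R y) \<partial>lborel)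
    \<le> ennreal (2 ^ CARD('n)) * (\<integral>\<^sup>+y\<in>ball x R. g y \<partial>lborel)"
proof -
  let ?h = "\<lambda>w. g w * indicator (ball x R) w"
  have "(\<integral>\<^sup>+y\<in>ball x R. g ((1 - s) *\<^sub>R z + s *\<^sub>R y) \<partial>lborel) \<le> (\<integral>\<^sup>+y. ?h ((1 - s) *\<^sub>R z + s *\<^sub>R y) \<partial>lborel)"
  proof (rule nn_integral_mono)
    fix y
    have "(1 - s) *\<^sub>R z + s *\<^sub>R y \<in> ball x R" if "y \<in> ball x R"
      using that z s by (intro convexD[OF convex_ball]) auto
    then show "g ((1 - s) *\<^sub>R z + s *\<^sub>R y) * indicator (ball x R) y \<le> ?h ((1 - s) *\<^sub>R z + s *\<^sub>R y)"
      by (auto simp: indicator_def)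
  qed
  also have "\<dots> = 1 * \<dots>" by simp
  also have "\<dots> \<le> ennreal (2 ^ CARD('n) * s ^ CARD('n)) * (\<integral>\<^sup>+y. ?h ((1 - s) *\<^sub>R z + s *\<^sub>R y) \<partial>lborel)"
  proof (rule mult_right_mono)
    have "1 \<le> (2 * s) ^ CARD('n)" using s by (intro one_le_power) auto
    then show "1 \<le> ennreal (2 ^ CARD('n) * s ^ CARD('n))" by (simp add: power_mult_distrib)
  qed simp
  also have "\<dots> = ennreal (2 ^ CARD('n)) * (ennreal (\<bar>s\<bar> ^ DIM(real^'n)) * (\<integral>\<^sup>+y. ?h ((1 - s) *\<^sub>R z + s *\<^sub>R y) \<partial>lborel))"
    using s by (simp add: ennreal_mult mult.assoc)
  also have "\<dots> = ennreal (2 ^ CARD('n)) * (\<integral>\<^sup>+w. ?h w \<partial>lborel)"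
    using s by (subst nn_integral_lborel_affine[of ?h s "(1 - s) *\<^sub>R z", symmetric]) auto
  finally show ?thesis .
qed

text \<open>
  The difference \<open>f y - f z\<close> is integrated along the segment. For parameters \<open>s \<ge> 1/2\<close> the point
  \<open>z + s (y - z)\<close> is substituted for \<open>y\<close>, for the others it is substituted for \<open>z\<close>, so that the Jacobian is
  never small.
\<close>
lemma C1_poincare_double:
  fixes f :: "real ^ 'n \<Rightarrow> real"
  assumes f: "C1 f" and R: "0 < R"
  shows "(\<integral>\<^sup>+z\<in>ball x R. (\<integral>\<^sup>+y\<in>ball x R. ennreal \<bar>f y - f z\<bar> \<partial>lborel) \<partial>lborel)
    \<le> ennreal (2 * R * 2 ^ CARD('n)) * (\<integral>\<^sup>+y\<in>ball x R. grad_abs f y \<partial>lborel) * emeasure lborel (ball x R)"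
proof -
  let ?B = "ball x R" and ?n = "CARD('n)"
  let ?G = "\<integral>\<^sup>+y\<in>?B. grad_abs f y \<partial>lborel"
  have [measurable]: "f \<in> borel_measurable borel" "grad f \<in> borel_measurable borel"
    using f by (simp_all add: C1_measurable grad_measurable)
  define \<Phi> where "\<Phi> z y s = (if z \<in> ?B \<and> y \<in> ?B \<and> 0 \<le> s \<and> s \<le> 1 then grad_abs f (z + s *\<^sub>R (y - z)) else 0)"
    for z y :: "real^'n" and s :: real
  have \<Phi>_meas: "(\<lambda>p. \<Phi> (fst (fst p)) (snd p) (snd (fst p))) \<in> borel_measurable ((borel \<Otimes>\<^sub>M borel) \<Otimes>\<^sub>M borel)"
    unfolding \<Phi>_def by measurable
  have m0[measurable]: "\<Phi> z y \<in> borel_measurable borel" for z y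
    unfolding \<Phi>_def[abs_def] by measurable
  have m1: "(\<lambda>(y, s). \<Phi> z y s) \<in> borel_measurable (borel \<Otimes>\<^sub>M borel)" for z
    unfolding \<Phi>_def by measurable
  have m2: "(\<lambda>(z, y). \<Phi> z y s) \<in> borel_measurable (borel \<Otimes>\<^sub>M borel)" for s
    unfolding \<Phi>_def by measurable
  have m3: "(\<lambda>(z, s). \<integral>\<^sup>+y. \<Phi> z y s \<partial>lborel) \<in> borel_measurable (borel \<Otimes>\<^sub>M borel)"
    using lborel.borel_measurable_nn_integral_fst[of "\<lambda>p. \<Phi> (fst (fst p)) (snd p) (snd (fst p))" "borel \<Otimes>\<^sub>M borel"] \<Phi>_meas
    by (simp add: split_def cong: measurable_cong_sets sets_pair_measure_cong)
  have pt: "ennreal \<bar>f y - f z\<bar> * indicator ?B y * indicator ?B z \<le> ennreal (2 * R) * (\<integral>\<^sup>+s. \<Phi> z y s \<partial>lborel)" for y z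
  proof (cases "y \<in> ?B \<and> z \<in> ?B")
    case True
    have "ennreal \<bar>f (z + 1 *\<^sub>R (y - z)) - f (z + 0 *\<^sub>R (y - z))\<bar>
      \<le> (\<integral>\<^sup>+r\<in>{0..1}. ennreal (norm (y - z)) * grad_abs f (z + r *\<^sub>R (y - z)) \<partial>lborel)"
      by (rule C1_segment_bound[OF f]) simp
    also have "\<dots> = ennreal (norm (y - z)) * (\<integral>\<^sup>+s. \<Phi> z y s \<partial>lborel)"
      using True by (subst nn_integral_cmult[symmetric]) (auto simp: \<Phi>_def intro!: nn_integral_cong)
    also have "\<dots> \<le> ennreal (2 * R) * (\<integral>\<^sup>+s. \<Phi> z y s \<partial>lborel)"
    proof (intro mult_right_mono ennreal_leI)
      show "norm (y - z) \<le> 2 * R"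
        using True dist_triangle[of y z x] by (simp add: dist_norm[symmetric] dist_commute)
    qed simp
    finally show ?thesis using True by simp
  qed auto
  have slice: "(\<integral>\<^sup>+z. \<integral>\<^sup>+y. \<Phi> z y s \<partial>lborel \<partial>lborel) \<le> ennreal (2 ^ ?n) * ?G * emeasure lborel ?B * indicator {0..1} s" for s
  proof (cases "0 \<le> s \<and> s \<le> 1")
    case s: True
    show ?thesis
    proof (cases "1 / 2 \<le> s")
      case True
      have "(\<integral>\<^sup>+y. \<Phi> z y s \<partial>lborel) \<le> ennreal (2 ^ ?n) * ?G * indicator ?B z" for z
      proof (cases "z \<in> ?B")
        case zB: True
        have "z + s *\<^sub>R (y - z) = (1 - s) *\<^sub>R z + s *\<^sub>R y" for y by (simp add: algebra_simps)
        then have "(\<integral>\<^sup>+y. \<Phi> z y s \<partial>lborel) = (\<integral>\<^sup>+y\<in>?B. grad_abs f ((1 - s) *\<^sub>R z + s *\<^sub>R y) \<partial>lborel)"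
          using s zB by (auto simp: \<Phi>_def intro!: nn_integral_cong)
        also have "\<dots> \<le> ennreal (2 ^ ?n) * ?G"
          by (rule nn_integral_ball_contract) (use s True zB in auto)
        finally show ?thesis using zB by simp
      qed (simp add: \<Phi>_def)
      then have "(\<integral>\<^sup>+z. \<integral>\<^sup>+y. \<Phi> z y s \<partial>lborel \<partial>lborel) \<le> (\<integral>\<^sup>+z. ennreal (2 ^ ?n) * ?G * indicator ?B z \<partial>lborel)"
        by (rule nn_integral_mono)
      also have "\<dots> = ennreal (2 ^ ?n) * ?G * emeasure lborel ?B" by (rule nn_integral_cmult_indicator) simp
      finally show ?thesis using s by simp
    next
      case False
      have "(\<integral>\<^sup>+z. \<Phi> z y s \<partial>lborel) \<le> ennreal (2 ^ ?n) * ?G * indicator ?B y" for y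
      proof (cases "y \<in> ?B")
        case yB: True
        have "z + s *\<^sub>R (y - z) = (1 - (1 - s)) *\<^sub>R y + (1 - s) *\<^sub>R z" for z by (simp add: algebra_simps)
        then have "(\<integral>\<^sup>+z. \<Phi> z y s \<partial>lborel) = (\<integral>\<^sup>+z\<in>?B. grad_abs f ((1 - (1 - s)) *\<^sub>R y + (1 - s) *\<^sub>R z) \<partial>lborel)"
          using s yB by (auto simp: \<Phi>_def intro!: nn_integral_cong)
        also have "\<dots> \<le> ennreal (2 ^ ?n) * ?G"
          by (rule nn_integral_ball_contract) (use s False yB in auto)
        finally show ?thesis using yB by simp
      qed (simp add: \<Phi>_def)
      then have "(\<integral>\<^sup>+y. \<integral>\<^sup>+z. \<Phi> z y s \<partial>lborel \<partial>lborel) \<le> (\<integral>\<^sup>+y. ennreal (2 ^ ?n) * ?G * indicator ?B y \<partial>lborel)"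
        by (rule nn_integral_mono)
      also have "\<dots> = ennreal (2 ^ ?n) * ?G * emeasure lborel ?B" by (rule nn_integral_cmult_indicator) simp
      finally show ?thesis using s by (subst tonelli_lborel[OF m2]) simp
    qed
  qed (auto simp: \<Phi>_def)
  have "(\<integral>\<^sup>+z\<in>?B. (\<integral>\<^sup>+y\<in>?B. ennreal \<bar>f y - f z\<bar> \<partial>lborel) \<partial>lborel)
    = (\<integral>\<^sup>+z. \<integral>\<^sup>+y. ennreal \<bar>f y - f z\<bar> * indicator ?B y * indicator ?B z \<partial>lborel \<partial>lborel)"
    by (intro nn_integral_cong nn_integral_multc[symmetric]) measurable
  also have "\<dots> \<le> (\<integral>\<^sup>+z. \<integral>\<^sup>+y. ennreal (2 * R) * (\<integral>\<^sup>+s. \<Phi> z y s \<partial>lborel) \<partial>lborel \<partial>lborel)"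
    by (rule nn_integral_mono, rule nn_integral_mono) (rule pt)
  also have "\<dots> = (\<integral>\<^sup>+z. ennreal (2 * R) * (\<integral>\<^sup>+s. \<integral>\<^sup>+y. \<Phi> z y s \<partial>lborel \<partial>lborel) \<partial>lborel)"
  proof (rule nn_integral_cong)
    fix z
    have "(\<lambda>y. \<integral>\<^sup>+s. \<Phi> z y s \<partial>lborel) \<in> borel_measurable borel"
      using lborel.borel_measurable_nn_integral_fst[of "\<lambda>(y, s). \<Phi> z y s" borel] m1
      by (simp cong: measurable_cong_sets sets_pair_measure_cong)
    then have "(\<integral>\<^sup>+y. ennreal (2 * R) * (\<integral>\<^sup>+s. \<Phi> z y s \<partial>lborel) \<partial>lborel) = ennreal (2 * R) * (\<integral>\<^sup>+y. \<integral>\<^sup>+s. \<Phi> z y s \<partial>lborel \<partial>lborel)"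
      by (intro nn_integral_cmult) simp
    also have "(\<integral>\<^sup>+y. \<integral>\<^sup>+s. \<Phi> z y s \<partial>lborel \<partial>lborel) = (\<integral>\<^sup>+s. \<integral>\<^sup>+y. \<Phi> z y s \<partial>lborel \<partial>lborel)"
      by (rule tonelli_lborel[OF m1])
    finally show "(\<integral>\<^sup>+y. ennreal (2 * R) * (\<integral>\<^sup>+s. \<Phi> z y s \<partial>lborel) \<partial>lborel) = ennreal (2 * R) * (\<integral>\<^sup>+s. \<integral>\<^sup>+y. \<Phi> z y s \<partial>lborel \<partial>lborel)" .
  qed
  also have "\<dots> = ennreal (2 * R) * (\<integral>\<^sup>+z. \<integral>\<^sup>+s. \<integral>\<^sup>+y. \<Phi> z y s \<partial>lborel \<partial>lborel \<partial>lborel)"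
  proof (rule nn_integral_cmult)
    show "(\<lambda>z. \<integral>\<^sup>+s. \<integral>\<^sup>+y. \<Phi> z y s \<partial>lborel \<partial>lborel) \<in> borel_measurable lborel"
      using lborel.borel_measurable_nn_integral_fst[of "\<lambda>(z, s). \<integral>\<^sup>+y. \<Phi> z y s \<partial>lborel" borel] m3
      by (simp cong: measurable_cong_sets sets_pair_measure_cong)
  qed
  also have "(\<integral>\<^sup>+z. \<integral>\<^sup>+s. \<integral>\<^sup>+y. \<Phi> z y s \<partial>lborel \<partial>lborel \<partial>lborel) = (\<integral>\<^sup>+s. \<integral>\<^sup>+z. \<integral>\<^sup>+y. \<Phi> z y s \<partial>lborel \<partial>lborel \<partial>lborel)"
    by (rule tonelli_lborel[OF m3])
  also have "\<dots> \<le> (\<integral>\<^sup>+s. ennreal (2 ^ ?n) * ?G * emeasure lborel ?B * indicator {0..1::real} s \<partial>lborel)"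
    by (rule nn_integral_mono) (rule slice)
  also have "\<dots> = ennreal (2 ^ ?n) * ?G * emeasure lborel ?B"
    by (subst nn_integral_cmult_indicator) auto
  finally have "(\<integral>\<^sup>+z\<in>?B. (\<integral>\<^sup>+y\<in>?B. ennreal \<bar>f y - f z\<bar> \<partial>lborel) \<partial>lborel)
    \<le> ennreal (2 * R) * (ennreal (2 ^ ?n) * ?G * emeasure lborel ?B)"
    by (simp add: mult_left_mono)
  also have "\<dots> = ennreal (2 * R * 2 ^ ?n) * ?G * emeasure lborel ?B"
  proof -
    have "ennreal (2 * R * 2 ^ ?n) = ennreal (2 * R) * ennreal (2 ^ ?n)"
      by (rule ennreal_mult) (use R in auto)
    then show ?thesis by (simp only: mult.assoc)
  qed
  finally show ?thesis .
qed

text \<open>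
  The constant is a value \<open>f z\<close> at which the inner integral of the double inequality does not exceed the bound for its average.
\<close>
lemma C1_poincare:
  fixes f :: "real ^ 'n \<Rightarrow> real"
  assumes f: "C1 f" and R: "0 < R"
  obtains c where "(\<integral>\<^sup>+y\<in>ball x R. ennreal \<bar>f y - c\<bar> \<partial>lborel)
    \<le> ennreal (2 * R * 2 ^ CARD('n)) * (\<integral>\<^sup>+y\<in>ball x R. grad_abs f y \<partial>lborel)"
proof -
  let ?B = "ball x R"
  let ?K = "ennreal (2 * R * 2 ^ CARD('n)) * (\<integral>\<^sup>+y\<in>?B. grad_abs f y \<partial>lborel)"
  let ?H = "\<lambda>z. \<integral>\<^sup>+y\<in>?B. ennreal \<bar>f y - f z\<bar> \<partial>lborel"
  have [measurable]: "f \<in> borel_measurable borel"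
    using f by (simp add: C1_measurable)
  have H_meas: "?H \<in> borel_measurable borel" by measurable
  have "\<exists>c. (\<integral>\<^sup>+y\<in>?B. ennreal \<bar>f y - c\<bar> \<partial>lborel) \<le> ?K"
  proof (rule ccontr)
    assume "\<not> ?thesis"
    then have H: "?K < ?H z" for z by (meson not_le)
    have K: "?K \<noteq> \<infinity>"
      using less_le_trans[OF H[of x] top_greatest] unfolding infinity_ennreal_def by (rule less_imp_neq)
    have B: "emeasure lborel ?B = ennreal (unit_ball_vol CARD('n) * R ^ CARD('n))"
      using R by (simp add: emeasure_ball)
    have B0: "unit_ball_vol CARD('n) * R ^ CARD('n) > 0" using R by simp
    have "(\<integral>\<^sup>+z. ?K * indicator ?B z \<partial>lborel) < (\<integral>\<^sup>+z. ?H z * indicator ?B z \<partial>lborel)"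
    proof (rule nn_integral_less)
      show "(\<lambda>z. ?K * indicator ?B z) \<in> borel_measurable lborel" by simp
      show "(\<lambda>z. ?H z * indicator ?B z) \<in> borel_measurable lborel" using H_meas by simp
      have "(\<integral>\<^sup>+z. ?K * indicator ?B z \<partial>lborel) = ?K * emeasure lborel ?B" by (rule nn_integral_cmult_indicator) simp
      then show "(\<integral>\<^sup>+z. ?K * indicator ?B z \<partial>lborel) \<noteq> \<infinity>"
        using K unfolding B by (simp only: ennreal_mult_eq_top_iff infinity_ennreal_def ennreal_neq_top) auto
      show "AE z in lborel. ?K * indicator ?B z \<le> ?H z * indicator ?B z"
        using H by (intro always_eventually allI mult_right_mono) (auto intro: less_imp_le)
      show "\<not> (AE z in lborel. ?H z * indicator ?B z \<le> ?K * indicator ?B z)"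
      proof
        assume "AE z in lborel. ?H z * indicator ?B z \<le> ?K * indicator ?B z"
        then have "AE z in lborel. z \<notin> ?B"
        proof eventually_elim
          case (elim z)
          show "z \<notin> ?B"
          proof
            assume "z \<in> ?B"
            with elim have "?H z \<le> ?K" by (simp only: indicator_simps mult_1_right)
            from less_le_trans[OF H[of z] this] show False by (rule less_irrefl[THEN notE])
          qed
        qed
        then have "emeasure lborel ?B = 0" by (subst (asm) AE_iff_measurable[of ?B]) auto
        with B B0 show False by (simp add: ennreal_eq_0_iff)
      qed
    qed
    also have "\<dots> \<le> ?K * emeasure lborel ?B" by (rule C1_poincare_double[OF f R])
    also have "\<dots> = (\<integral>\<^sup>+z. ?K * indicator ?B z \<partial>lborel)" by (rule nn_integral_cmult_indicator[symmetric]) simp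
    finally show False by simp
  qed
  then show ?thesis using that by blast
qed

definition oscillation_const :: "nat \<Rightarrow> real" where
  "oscillation_const n = lorentz_const n * (1 + 32 / 3 * 2 ^ n)"

lemma C1_lorentz_poincare:
  fixes f :: "real ^ 'n \<Rightarrow> real"
  assumes n: "2 \<le> CARD('n)" and f: "C1 f" and R: "0 < R"
  obtains c where "(\<integral>\<^sup>+t\<in>{0<..}. sobolev_pow TYPE('n) (emeasure lborel {y\<in>ball x R. t < \<bar>f y - c\<bar>}) \<partial>lborel)
    \<le> ennreal (oscillation_const CARD('n)) * (\<integral>\<^sup>+y\<in>ball x (2 * R). grad_abs f y \<partial>lborel)"
proof -
  let ?G = "\<integral>\<^sup>+y\<in>ball x (2 * R). grad_abs f y \<partial>lborel" and ?L = "lorentz_const CARD('n)"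
  have "0 < 2 * R" using R by simp
  then obtain c where c: "(\<integral>\<^sup>+y\<in>ball x (2 * R). ennreal \<bar>f y - c\<bar> \<partial>lborel) \<le> ennreal (2 * (2 * R) * 2 ^ CARD('n)) * ?G"
    by (rule C1_poincare[OF f])
  note C1_lorentz_ball[OF n f R, of x c]
  also have "ennreal ?L * (?G + ennreal (8 / (3 * R)) * (\<integral>\<^sup>+y\<in>ball x (2 * R). ennreal \<bar>f y - c\<bar> \<partial>lborel))
    \<le> ennreal ?L * (?G + ennreal (8 / (3 * R)) * (ennreal (2 * (2 * R) * 2 ^ CARD('n)) * ?G))"
    by (intro mult_left_mono add_left_mono c) auto
  also have "ennreal (8 / (3 * R)) * (ennreal (2 * (2 * R) * 2 ^ CARD('n)) * ?G) = ennreal (32 / 3 * 2 ^ CARD('n)) * ?G"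
  proof -
    have "8 / (3 * R) * (2 * (2 * R) * 2 ^ CARD('n)) = 32 / 3 * 2 ^ CARD('n)" using R by simp
    moreover have "ennreal (8 / (3 * R)) * ennreal (2 * (2 * R) * 2 ^ CARD('n)) = ennreal (8 / (3 * R) * (2 * (2 * R) * 2 ^ CARD('n)))"
      by (rule ennreal_mult[symmetric]) (use R in auto)
    ultimately show ?thesis by (simp only: mult.assoc[symmetric])
  qed
  also have "?G + ennreal (32 / 3 * 2 ^ CARD('n)) * ?G = ennreal (1 + 32 / 3 * 2 ^ CARD('n)) * ?G"
    by (subst ennreal_plus) (auto simp: distrib_right)
  also have "ennreal ?L * (ennreal (1 + 32 / 3 * 2 ^ CARD('n)) * ?G) = ennreal (oscillation_const CARD('n)) * ?G"
    unfolding oscillation_const_def mult.assoc[symmetric]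
    by (subst ennreal_mult) (auto simp: lorentz_const_nonneg simp del: ennreal_plus)
  finally show ?thesis by (rule that)
qed

text \<open>
  On the ball the kernel is at least \<open>R\<^sup>1\<^sup>-\<^sup>n\<close>.
\<close>
lemma nn_integral_ball_le_riesz:
  fixes g :: "real ^ 'n \<Rightarrow> ennreal"
  assumes [measurable]: "g \<in> borel_measurable borel" and R: "0 < R"
  shows "(\<integral>\<^sup>+y\<in>ball x R. g y \<partial>lborel) \<le> ennreal (R ^ (CARD('n) - 1)) * riesz g x"
proof -
  have "(\<integral>\<^sup>+y\<in>ball x R. g y \<partial>lborel) \<le> (\<integral>\<^sup>+y. ennreal (R ^ (CARD('n) - 1)) * (g y * riesz_kernel (x - y)) \<partial>lborel)"
  proof (rule nn_integral_mono)
    fix y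
    show "g y * indicator (ball x R) y \<le> ennreal (R ^ (CARD('n) - 1)) * (g y * riesz_kernel (x - y))"
    proof (cases "y \<in> ball x R \<and> x \<noteq> y")
      case True
      let ?d = "norm (x - y)"
      have d: "0 < ?d" "?d \<le> R" using True by (auto simp: dist_norm)
      then have "1 \<le> R ^ (CARD('n) - 1) * (1 / ?d ^ (CARD('n) - 1))"
        by (simp add: power_mono)
      then have "1 \<le> ennreal (R ^ (CARD('n) - 1) * (1 / ?d ^ (CARD('n) - 1)))"
        by (simp only: ennreal_1[symmetric]) (rule ennreal_leI)
      also have "\<dots> = ennreal (R ^ (CARD('n) - 1)) * riesz_kernel (x - y)"
        using True R by (subst ennreal_mult) (auto simp: riesz_kernel_eq)
      finally have "g y * 1 \<le> g y * (ennreal (R ^ (CARD('n) - 1)) * riesz_kernel (x - y))"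
        by (rule mult_left_mono) simp
      then show ?thesis using True by (simp add: mult_ac)
    next
      case False
      show ?thesis
      proof (cases "x = y")
        case True
        then show ?thesis using R
          by (cases "g y = 0"; cases "CARD('n) - 1 = 0") (auto simp: riesz_kernel_def ennreal_mult_top power_0_left)
      qed (use False in auto)
    qed
  qed
  also have "\<dots> = ennreal (R ^ (CARD('n) - 1)) * riesz g x"
    unfolding riesz_def by (rule nn_integral_cmult) measurable
  finally show ?thesis .
qed

definition max_const :: "nat \<Rightarrow> real" where
  "max_const n = A1_const n / sphere_area n"

lemma A1_const_nonneg: "0 \<le> A1_const n" by (simp add: A1_const_def)

lemma max_const_nonneg: "0 \<le> max_const n" by (simp add: max_const_def A1_const_nonneg)

lemma C1c_HL_bound:
  fixes f :: "real ^ 'n \<Rightarrow> real"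
  assumes f: "C1c f"
  shows "HL (\<lambda>y. ennreal \<bar>f y\<bar>) x \<le> ennreal (max_const CARD('n)) * riesz (grad_abs f) x"
proof -
  let ?s = "1 / sphere_area CARD('n)"
  have [measurable]: "grad f \<in> borel_measurable borel"
    using f by (intro grad_measurable) (simp add: C1c_def)
  have "HL (\<lambda>y. ennreal \<bar>f y\<bar>) x \<le> HL (\<lambda>y. ennreal ?s * riesz (grad_abs f) y) x"
    by (intro HL_mono C1c_riesz_bound f)
  also have "\<dots> \<le> ennreal ?s * HL (riesz (grad_abs f)) x"
    by (rule HL_cmult) measurable
  also have "\<dots> \<le> ennreal ?s * (ennreal (A1_const CARD('n)) * riesz (grad_abs f) x)"
    by (intro mult_left_mono HL_riesz) auto
  also have "\<dots> = ennreal (max_const CARD('n)) * riesz (grad_abs f) x"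
    unfolding mult.assoc[symmetric]
    by (subst ennreal_mult[symmetric]) (auto simp: max_const_def A1_const_nonneg)
  finally show ?thesis .
qed

lemma nn_integral_ball_le_HL:
  fixes g :: "real ^ 'n \<Rightarrow> ennreal"
  assumes R: "0 < R"
  shows "(\<integral>\<^sup>+y\<in>ball x R. g y \<partial>lborel) \<le> ennreal ((2 * R) ^ CARD('n)) * HL g x"
proof -
  let ?a = "\<chi> i. x $ i - R"
  have sub: "ball x R \<subseteq> cube ?a (2 * R)"
  proof
    fix y assume "y \<in> ball x R"
    then have "\<bar>(y - x) $ i\<bar> < R" for i
      using component_le_norm_cart[of "y - x" i] by (simp add: dist_norm norm_minus_commute)
    then have "\<bar>y $ i - x $ i\<bar> < R" for i by simp
    then show "y \<in> cube ?a (2 * R)" by (auto simp: mem_box_cart) (smt (verit))+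
  qed
  have x: "x \<in> cube ?a (2 * R)" using sub R by auto
  let ?I = "\<integral>\<^sup>+y\<in>cube ?a (2 * R). g y \<partial>lborel" and ?w = "ennreal ((2 * R) ^ CARD('n))"
  have "(\<integral>\<^sup>+y\<in>ball x R. g y \<partial>lborel) \<le> ?I"
    using sub by (intro nn_integral_mono) (auto simp: indicator_def)
  also have "\<dots> = ?w * (?I / ?w)"
    unfolding ennreal_times_divide mult.commute[of ?w ?I]
    by (rule mult_divide_eq_ennreal[symmetric]) (use R in auto)
  also have "\<dots> \<le> ?w * HL g x"
    by (intro mult_left_mono HL_ge x) (use R in auto)
  finally show ?thesis .
qed

definition local_const :: "nat \<Rightarrow> real" where
  "local_const n = lorentz_const n * (2 ^ (n - 1) + 8 / 3 * 4 ^ n * max_const n)"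

lemma local_const_nonneg: "0 \<le> local_const n"
  by (simp add: local_const_def lorentz_const_nonneg max_const_nonneg)

text \<open>
  The gradient on the larger ball is bounded by \<open>I\<^sub>1\<close> directly, and the term from the cutoff function is an
  average of \<open>|f|\<close>, hence bounded by the maximal function.
\<close>
lemma C1c_lorentz_local:
  fixes f :: "real ^ 'n \<Rightarrow> real"
  assumes n: "2 \<le> CARD('n)" and f: "C1c f" and R: "0 < R"
  shows "(\<integral>\<^sup>+t\<in>{0<..}. sobolev_pow TYPE('n) (emeasure lborel {y\<in>ball x R. t < \<bar>f y\<bar>}) \<partial>lborel)
    \<le> ennreal (local_const CARD('n) * R ^ (CARD('n) - 1)) * riesz (grad_abs f) x"
proof -
  let ?n = "CARD('n)" and ?r = "riesz (grad_abs f) x" and ?L = "lorentz_const CARD('n)" and ?M = "max_const CARD('n)"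
  have f1: "C1 f" using f by (simp add: C1c_def)
  have [measurable]: "grad f \<in> borel_measurable borel" using f1 by (rule grad_measurable)
  have 1: "(\<integral>\<^sup>+y\<in>ball x (2 * R). grad_abs f y \<partial>lborel) \<le> ennreal ((2 * R) ^ (?n - 1)) * ?r"
    by (rule nn_integral_ball_le_riesz) (use R in auto)
  have "(\<integral>\<^sup>+y\<in>ball x (2 * R). ennreal \<bar>f y - 0\<bar> \<partial>lborel) \<le> ennreal ((2 * (2 * R)) ^ ?n) * HL (\<lambda>y. ennreal \<bar>f y\<bar>) x"
    using nn_integral_ball_le_HL[of "2 * R" "\<lambda>y. ennreal \<bar>f y\<bar>" x] R by simp
  also have "\<dots> \<le> ennreal ((2 * (2 * R)) ^ ?n) * (ennreal ?M * ?r)"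
    by (intro mult_left_mono C1c_HL_bound f) simp
  finally have 2: "(\<integral>\<^sup>+y\<in>ball x (2 * R). ennreal \<bar>f y - 0\<bar> \<partial>lborel) \<le> ennreal ((2 * (2 * R)) ^ ?n) * (ennreal ?M * ?r)" .
  have "(\<integral>\<^sup>+t\<in>{0<..}. sobolev_pow TYPE('n) (emeasure lborel {y\<in>ball x R. t < \<bar>f y\<bar>}) \<partial>lborel)
    \<le> ennreal ?L * ((\<integral>\<^sup>+y\<in>ball x (2 * R). grad_abs f y \<partial>lborel)
        + ennreal (8 / (3 * R)) * (\<integral>\<^sup>+y\<in>ball x (2 * R). ennreal \<bar>f y - 0\<bar> \<partial>lborel))"
    using C1_lorentz_ball[OF n f1 R, of x 0] by simp
  also have "\<dots> \<le> ennreal ?L * (ennreal ((2 * R) ^ (?n - 1)) * ?r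
        + ennreal (8 / (3 * R)) * (ennreal ((2 * (2 * R)) ^ ?n) * (ennreal ?M * ?r)))"
    by (intro mult_left_mono add_mono 1 2) auto
  also have "\<dots> = (ennreal ?L * (ennreal ((2 * R) ^ (?n - 1)) + ennreal (8 / (3 * R)) * (ennreal ((2 * (2 * R)) ^ ?n) * ennreal ?M))) * ?r"
    by (simp only: distrib_right mult.assoc)
  also have "ennreal ?L * (ennreal ((2 * R) ^ (?n - 1)) + ennreal (8 / (3 * R)) * (ennreal ((2 * (2 * R)) ^ ?n) * ennreal ?M))
    = ennreal (?L * ((2 * R) ^ (?n - 1) + 8 / (3 * R) * ((2 * (2 * R)) ^ ?n * ?M)))"
  proof -
    have "ennreal ((2 * (2 * R)) ^ ?n) * ennreal ?M = ennreal ((2 * (2 * R)) ^ ?n * ?M)"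
      by (rule ennreal_mult[symmetric]) (use R max_const_nonneg in auto)
    moreover have "ennreal (8 / (3 * R)) * ennreal ((2 * (2 * R)) ^ ?n * ?M) = ennreal (8 / (3 * R) * ((2 * (2 * R)) ^ ?n * ?M))"
      by (rule ennreal_mult[symmetric]) (use R max_const_nonneg in auto)
    moreover have "ennreal ((2 * R) ^ (?n - 1)) + ennreal (8 / (3 * R) * ((2 * (2 * R)) ^ ?n * ?M)) = ennreal ((2 * R) ^ (?n - 1) + 8 / (3 * R) * ((2 * (2 * R)) ^ ?n * ?M))"
      by (rule ennreal_plus[symmetric]) (use R max_const_nonneg in auto)
    moreover have "ennreal ?L * ennreal ((2 * R) ^ (?n - 1) + 8 / (3 * R) * ((2 * (2 * R)) ^ ?n * ?M)) = ennreal (?L * ((2 * R) ^ (?n - 1) + 8 / (3 * R) * ((2 * (2 * R)) ^ ?n * ?M)))"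
      by (rule ennreal_mult[symmetric]) (use R max_const_nonneg lorentz_const_nonneg in auto)
    ultimately show ?thesis by simp
  qed
  also have "?L * ((2 * R) ^ (?n - 1) + 8 / (3 * R) * ((2 * (2 * R)) ^ ?n * ?M)) = local_const ?n * R ^ (?n - 1)"
  proof -
    have "(2 * (2 * R)) ^ ?n = 4 ^ ?n * (R * R ^ (?n - 1))"
      using power_mult_distrib[of 4 R ?n] by (cases ?n) auto
    then show ?thesis using R by (simp add: local_const_def power_mult_distrib field_simps)
  qed
  finally show ?thesis .
qed

section \<open>Operators controlled by the Riesz potential of the gradient\<close>

lemma C1c_bounded_grad:
  assumes "C1c f"
  shows "\<exists>M\<ge>0. \<forall>x. norm (grad f x) \<le> M"
proof -
  obtain B where B: "0 < B" "\<And>x. B \<le> norm x \<Longrightarrow> f x = 0" "\<And>x. B \<le> norm x \<Longrightarrow> grad f x = 0"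
    using C1c_support[OF assms] by blast
  have "compact (grad f ` cball 0 B)"
    by (rule compact_continuous_image[OF continuous_on_subset[of UNIV]])
      (use assms in \<open>auto simp: C1c_def C1_def\<close>)
  from compact_imp_bounded[OF this] obtain M where M: "M > 0" "\<And>x. x \<in> cball 0 B \<Longrightarrow> norm (grad f x) \<le> M"
    unfolding bounded_pos by blast
  have "norm (grad f x) \<le> M" for x
    using M B(3)[of x] by (cases "norm x \<le> B") auto
  then show ?thesis using M by (intro exI[of _ M]) simp
qed

lemma C1c_bounded:
  assumes "C1c f"
  shows "\<exists>M\<ge>0. \<forall>x. \<bar>f x\<bar> \<le> M"
proof -
  obtain B where B: "0 < B" "\<And>x. B \<le> norm x \<Longrightarrow> f x = 0" "\<And>x. B \<le> norm x \<Longrightarrow> grad f x = 0"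
    using C1c_support[OF assms] by blast
  have "continuous_on UNIV f" using assms by (auto simp: C1c_def C1_continuous)
  then have "compact (f ` cball 0 B)"
    by (intro compact_continuous_image[OF continuous_on_subset[of UNIV f]]) auto
  from compact_imp_bounded[OF this] obtain M where M: "M > 0" "\<And>x. x \<in> cball 0 B \<Longrightarrow> norm (f x) \<le> M"
    unfolding bounded_pos by blast
  have "\<bar>f x\<bar> \<le> M" for x
    using M B(2)[of x] by (cases "norm x \<le> B") auto
  then show ?thesis using M by (intro exI[of _ M]) simp
qed

text \<open>
  The potential \<open>I\<^sub>1|\<nabla>f|\<close> as a real function. The potential is finite when \<open>f\<close> is of class \<open>C\<^sup>1\<close> with compact
  support.
\<close>
definition grad_potential :: "(real ^ 'n \<Rightarrow> real) \<Rightarrow> real ^ 'n \<Rightarrow> real" where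
  "grad_potential f x = enn2real (riesz (grad_abs f) x)"

lemma grad_potential_nonneg: "0 \<le> grad_potential f x"
  by (simp add: grad_potential_def)

lemma riesz_grad_finite:
  fixes f :: "real ^ 'n \<Rightarrow> real"
  assumes "C1c f"
  shows "riesz (grad_abs f) x < \<infinity>"
proof -
  obtain B where B: "0 < B" "\<And>x. B \<le> norm x \<Longrightarrow> f x = 0" "\<And>x. B \<le> norm x \<Longrightarrow> grad f x = 0"
    using C1c_support[OF assms] by blast
  obtain M where M: "0 \<le> M" "\<And>x. norm (grad f x) \<le> M" using C1c_bounded_grad[OF assms] by blast
  have "emeasure lborel (ball (0::real^'n) B) < \<infinity>" by (intro emeasure_bounded_finite) simp
  then obtain R where R: "0 \<le> R" "emeasure lborel (ball (0::real^'n) B) = ennreal (R ^ CARD('n))"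
    by (rule ennreal_eq_power[of _ "CARD('n)"]) auto
  have "riesz (grad_abs f) x \<le> (\<integral>\<^sup>+y. ennreal M * (riesz_kernel (x - y) * indicator (ball 0 B) y) \<partial>lborel)"
    unfolding riesz_def
  proof (rule nn_integral_mono)
    fix y show "grad_abs f y * riesz_kernel (x - y) \<le> ennreal M * (riesz_kernel (x - y) * indicator (ball 0 B) y)"
      using M B(3)[of y] by (cases "norm y < B") (auto intro!: mult_right_mono ennreal_leI)
  qed
  also have "\<dots> = ennreal M * (\<integral>\<^sup>+y\<in>ball 0 B. riesz_kernel (x - y) \<partial>lborel)"
    by (rule nn_integral_cmult) measurable
  also have "\<dots> \<le> ennreal M * ennreal ((CARD('n) * unit_ball_vol CARD('n) + 1) * (R + 1))"
    using R by (intro mult_left_mono riesz_kernel_set) (auto intro!: ennreal_leI power_mono)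
  also have "\<dots> < \<infinity>" by (simp add: ennreal_mult_less_top)
  finally show ?thesis .
qed

lemma ennreal_grad_potential:
  "C1c f \<Longrightarrow> ennreal (grad_potential f x) = riesz (grad_abs f) x"
  using riesz_grad_finite[of f x] by (simp add: grad_potential_def)

lemma grad_potential_diff_commute:
  assumes "C1c f" "C1c g"
  shows "grad_potential (\<lambda>x. f x - g x) = grad_potential (\<lambda>x. g x - f x)"
proof -
  have "grad (\<lambda>x. f x - g x) = (\<lambda>x. grad f x - grad g x)" "grad (\<lambda>x. g x - f x) = (\<lambda>x. grad g x - grad f x)"
    using assms by (auto simp: C1c_def C1_diff)
  then show ?thesis by (simp add: grad_potential_def fun_eq_iff norm_minus_commute)
qed

text \<open>
  The last clause replaces a Lipschitz bound. It is homogeneous in the pair \<open>(f, g)\<close>; its right side becomes small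
  for \<open>f\<close> and \<open>g\<close> in a bounded set when \<open>\<epsilon>\<close> is chosen small first and \<open>f - g\<close> afterwards.
\<close>
definition controlled_by_riesz :: "'n::finite operator \<Rightarrow> bool" where
  "controlled_by_riesz T \<longleftrightarrow> (\<exists>C\<ge>0. \<forall>f g. C1c f \<longrightarrow> C1c g \<longrightarrow>
     T f \<in> borel_measurable borel \<and>
     (\<forall>x. \<bar>T f x\<bar> \<le> ereal (C * grad_potential f x)) \<and>
     (\<forall>x \<epsilon>. 0 < \<epsilon> \<longrightarrow> \<epsilon> \<le> 1 / 2 \<longrightarrow> \<bar>T f x - T g x\<bar> \<le>
        ereal (C * (\<epsilon> * (grad_potential f x + grad_potential g x)
          + grad_potential (\<lambda>y. f y - g y) x / \<epsilon>))))"

lemma controlled_by_rieszI_Lipschitz: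
  fixes T :: "'n::finite operator"
  assumes "0 \<le> C"
    and meas: "\<And>f. C1c f \<Longrightarrow> T f \<in> borel_measurable borel"
    and bound: "\<And>f x. C1c f \<Longrightarrow> \<bar>T f x\<bar> \<le> ereal (C * grad_potential f x)"
    and lip: "\<And>f g x. C1c f \<Longrightarrow> C1c g \<Longrightarrow> \<bar>T f x - T g x\<bar> \<le> ereal (C * grad_potential (\<lambda>y. f y - g y) x)"
  shows "controlled_by_riesz T"
  unfolding controlled_by_riesz_def
proof (intro exI[of _ C] conjI allI impI assms)
  fix f g :: "real^'n \<Rightarrow> real" and x and \<epsilon> :: real assume "C1c f" "C1c g" "0 < \<epsilon>" "\<epsilon> \<le> 1 / 2"
  let ?d = "grad_potential (\<lambda>y. f y - g y) x"
  have "?d * \<epsilon> \<le> ?d * 1" using \<open>\<epsilon> \<le> 1 / 2\<close> by (intro mult_left_mono grad_potential_nonneg) simp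
  then have "?d \<le> ?d / \<epsilon>" using \<open>0 < \<epsilon>\<close> by (simp add: field_simps)
  also have "\<dots> \<le> \<epsilon> * (grad_potential f x + grad_potential g x) + ?d / \<epsilon>"
    using \<open>0 < \<epsilon>\<close> grad_potential_nonneg[of f x] grad_potential_nonneg[of g x] by simp
  finally have "C * ?d \<le> C * (\<epsilon> * (grad_potential f x + grad_potential g x) + ?d / \<epsilon>)"
    by (rule mult_left_mono) fact
  with lip[OF \<open>C1c f\<close> \<open>C1c g\<close>, of x]
  show "\<bar>T f x - T g x\<bar> \<le> ereal (C * (\<epsilon> * (grad_potential f x + grad_potential g x) + ?d / \<epsilon>))"
    by (meson ereal_less_eq(3) order_trans)
qed

lemma controlled_by_rieszI_sublinear:
  fixes T :: "'n::finite operator"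
  assumes C: "0 \<le> C"
    and meas: "\<And>f. C1c f \<Longrightarrow> T f \<in> borel_measurable borel"
    and pos: "\<And>f x. 0 \<le> T f x"
    and bound: "\<And>f x. C1c f \<Longrightarrow> T f x \<le> ereal (C * grad_potential f x)"
    and sub: "\<And>f g x. C1c f \<Longrightarrow> C1c g \<Longrightarrow> T f x \<le> T g x + T (\<lambda>y. f y - g y) x"
  shows "controlled_by_riesz T"
proof (rule controlled_by_rieszI_Lipschitz[OF C meas])
  fix f :: "real^'n \<Rightarrow> real" and x assume "C1c f" then show "\<bar>T f x\<bar> \<le> ereal (C * grad_potential f x)"
    using pos[of f x] bound by simp
next
  have fin: "\<exists>r. T f x = ereal r" if "C1c f" for f :: "real^'n \<Rightarrow> real" and x
    using bound[OF that, of x] pos[of f x] by (cases "T f x") auto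
  fix f g :: "real^'n \<Rightarrow> real" and x assume f: "C1c f" and g: "C1c g"
  obtain a b c d where e: "T f x = ereal a" "T g x = ereal b" "T (\<lambda>y. f y - g y) x = ereal c" "T (\<lambda>y. g y - f y) x = ereal d"
    using fin[OF f, of x] fin[OF g, of x] fin[OF C1c_diff[OF f g], of x] fin[OF C1c_diff[OF g f], of x] by blast
  have "a \<le> b + c" "b \<le> a + d" using sub[OF f g, of x] sub[OF g f, of x] e by auto
  moreover have "c \<le> C * grad_potential (\<lambda>y. f y - g y) x" "d \<le> C * grad_potential (\<lambda>y. g y - f y) x"
    using bound[OF C1c_diff[OF f g], of x] bound[OF C1c_diff[OF g f], of x] e by auto
  ultimately show "\<bar>T f x - T g x\<bar> \<le> ereal (C * grad_potential (\<lambda>y. f y - g y) x)"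
    using e grad_potential_diff_commute[OF f g] by (auto simp: abs_le_iff)
qed

section \<open>Iterated Hardy--Littlewood maximal operators\<close>

lemma HL_iter_measurable: 
  fixes g :: "real ^ 'n \<Rightarrow> ennreal"
  shows "g \<in> borel_measurable borel \<Longrightarrow> (HL ^^ k) g \<in> borel_measurable borel"
  by (induction k) auto

lemma HL_iter_subadditive:
  fixes a b c :: "real ^ 'n \<Rightarrow> ennreal"
  assumes "\<And>y. a y \<le> b y + c y" and [measurable]: "b \<in> borel_measurable borel" "c \<in> borel_measurable borel"
  shows "(HL ^^ k) a x \<le> (HL ^^ k) b x + (HL ^^ k) c x"
proof (induction k arbitrary: x)
  case (Suc k)
  have "HL ((HL ^^ k) a) x \<le> HL (\<lambda>y. (HL ^^ k) b y + (HL ^^ k) c y) x"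
    by (intro HL_mono Suc)
  also have "\<dots> \<le> HL ((HL ^^ k) b) x + HL ((HL ^^ k) c) x"
    by (intro HL_subadditive HL_iter_measurable) measurable
  finally show ?case by simp
qed (use assms in simp)

lemma C1c_HL_iter_bound:
  fixes f :: "real ^ 'n \<Rightarrow> real"
  assumes f: "C1c f"
  shows "(HL ^^ Suc k) (\<lambda>y. ennreal \<bar>f y\<bar>) x \<le> ennreal (A1_const CARD('n) ^ k * max_const CARD('n)) * riesz (grad_abs f) x"
proof (induction k arbitrary: x)
  case 0
  then show ?case using C1c_HL_bound[OF f] by simp
next
  case (Suc k)
  have [measurable]: "grad f \<in> borel_measurable borel"
    using f by (intro grad_measurable) (simp add: C1c_def)
  let ?K = "A1_const CARD('n) ^ k * max_const CARD('n)"
  have "(HL ^^ Suc (Suc k)) (\<lambda>y. ennreal \<bar>f y\<bar>) x = HL ((HL ^^ Suc k) (\<lambda>y. ennreal \<bar>f y\<bar>)) x" by simp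
  also have "\<dots> \<le> HL (\<lambda>x. ennreal ?K * riesz (grad_abs f) x) x"
    by (rule HL_mono) (rule Suc)
  also have "\<dots> \<le> ennreal ?K * HL (riesz (grad_abs f)) x" by (rule HL_cmult) measurable
  also have "\<dots> \<le> ennreal ?K * (ennreal (A1_const CARD('n)) * riesz (grad_abs f) x)"
    by (intro mult_left_mono HL_riesz) auto
  also have "\<dots> = ennreal (A1_const CARD('n) ^ Suc k * max_const CARD('n)) * riesz (grad_abs f) x"
    unfolding mult.assoc[symmetric]
    by (subst ennreal_mult[symmetric]) (auto simp: max_const_nonneg A1_const_nonneg mult_ac)
  finally show ?case .
qed

lemma enn2ereal_leI: "0 \<le> r \<Longrightarrow> a \<le> ennreal r \<Longrightarrow> enn2ereal a \<le> ereal r"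
  by (metis enn2ereal_ennreal less_eq_ennreal.rep_eq)

lemma controlled_max_iter:
  assumes "1 \<le> k"
  shows "controlled_by_riesz (max_iter k :: 'n::finite operator)"
proof (rule controlled_by_rieszI_sublinear)
  obtain j where k: "k = Suc j" using assms by (cases k) auto
  let ?C = "A1_const CARD('n) ^ (k - 1) * max_const CARD('n)"
  show C: "0 \<le> ?C" by (simp add: A1_const_nonneg max_const_nonneg)
  have abs_meas: "(\<lambda>y. ennreal \<bar>f y\<bar>) \<in> borel_measurable borel" if "C1c f" for f :: "real^'n \<Rightarrow> real"
  proof -
    have [measurable]: "f \<in> borel_measurable borel" using that by (simp add: C1c_def C1_measurable)
    show ?thesis by measurable
  qed
  fix f g :: "real^'n \<Rightarrow> real" and x
  show "0 \<le> max_iter k f x" by (simp add: max_iter_def)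
  assume f: "C1c f"
  show "max_iter k f \<in> borel_measurable borel"
    unfolding max_iter_def[abs_def] using HL_iter_measurable[OF abs_meas[OF f], of k] by measurable
  have "(HL ^^ k) (\<lambda>y. ennreal \<bar>f y\<bar>) x \<le> ennreal (?C * grad_potential f x)"
    using C1c_HL_iter_bound[OF f, of j x] C
    by (simp add: k ennreal_mult grad_potential_nonneg ennreal_grad_potential[OF f])
  then show "max_iter k f x \<le> ereal (?C * grad_potential f x)"
    unfolding max_iter_def by (rule enn2ereal_leI[OF mult_nonneg_nonneg[OF C grad_potential_nonneg]])
  assume g: "C1c g"
  have "(HL ^^ k) (\<lambda>y. ennreal \<bar>f y\<bar>) x \<le> (HL ^^ k) (\<lambda>y. ennreal \<bar>g y\<bar>) x + (HL ^^ k) (\<lambda>y. ennreal \<bar>f y - g y\<bar>) x"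
    by (intro HL_iter_subadditive abs_meas g C1c_diff f) (simp flip: ennreal_plus)
  then show "max_iter k f x \<le> max_iter k g x + max_iter k (\<lambda>y. f y - g y) x"
    unfolding max_iter_def by (simp add: less_eq_ennreal.rep_eq plus_ennreal.rep_eq)
qed

lemma max_HL_eq: "max_HL = max_iter 1"
  by (simp add: fun_eq_iff max_HL_def max_iter_def)

section \<open>The Lorentz maximal operator\<close>

lemma powr_subadditive:
  fixes x y a :: real
  assumes "0 \<le> x" "0 \<le> y" "0 < a" "a \<le> 1"
  shows "(x + y) powr a \<le> x powr a + y powr a"
proof (cases "x + y = 0")
  case False
  then have s: "x + y > 0" using assms by simp
  have *: "z \<le> z powr a" if "0 \<le> z" "z \<le> 1" for z :: real
    using that assms powr_mono'[of a 1 z] by (cases "z = 0") auto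
  have "(x + y) powr a * (x / (x + y) + y / (x + y)) \<le> (x + y) powr a * ((x / (x + y)) powr a + (y / (x + y)) powr a)"
    using assms s by (intro mult_left_mono add_mono *) auto
  also have "\<dots> = x powr a + y powr a"
    using s assms by (simp add: distrib_left powr_divide)
  finally show ?thesis using s by (simp add: add_divide_distrib[symmetric])
qed (use assms in auto)

lemma epowr_subadditive:
  assumes "0 < a" "a \<le> 1"
  shows "epowr (x + y) a \<le> epowr x a + epowr y a"
proof (cases x; cases y)
  fix r s assume "0 \<le> r" "x = ennreal r" "0 \<le> s" "y = ennreal s"
  then show ?thesis
    using powr_subadditive[of r s a] assms
    by (simp add: epowr_def ennreal_leI flip: ennreal_plus)
qed (auto simp: epowr_def)

lemma sobolev_pow_subadditive:
  assumes "2 \<le> CARD('n::finite)"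
  shows "sobolev_pow TYPE('n) (x + y) \<le> sobolev_pow TYPE('n) x + sobolev_pow TYPE('n) y"
  using assms by (intro epowr_subadditive) (auto simp: inverse_conj_dim)

definition lorentz_integral :: "(real ^ 'n) set \<Rightarrow> (real ^ 'n \<Rightarrow> real) \<Rightarrow> ennreal" where
  "lorentz_integral Q f = (\<integral>\<^sup>+t\<in>{0<..}. sobolev_pow TYPE('n) (emeasure lborel {y\<in>Q. t < \<bar>f y\<bar>}) \<partial>lborel)"

lemma lorentz_integral_scale:
  fixes f :: "real ^ 'n \<Rightarrow> real"
  assumes [measurable]: "f \<in> borel_measurable borel" "Q \<in> sets borel" and c: "0 < c"
  shows "(\<integral>\<^sup>+t\<in>{0<..}. sobolev_pow TYPE('n) (emeasure lborel {y\<in>Q. c * t < \<bar>f y\<bar>}) \<partial>lborel)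
    = ennreal (1 / c) * lorentz_integral Q f"
proof -
  have [measurable]: "(\<lambda>t. sobolev_pow TYPE('n) (emeasure lborel {y\<in>Q. t < \<bar>f y\<bar>})) \<in> borel_measurable borel"
    by (rule sobolev_pow_measurable) measurable
  have "lorentz_integral Q f = ennreal \<bar>c\<bar> *
    (\<integral>\<^sup>+t. sobolev_pow TYPE('n) (emeasure lborel {y\<in>Q. 0 + c * t < \<bar>f y\<bar>}) * indicator {0<..} (0 + c * t) \<partial>lborel)"
    unfolding lorentz_integral_def by (rule nn_integral_real_affine) (use c in auto)
  also have "(\<integral>\<^sup>+t. sobolev_pow TYPE('n) (emeasure lborel {y\<in>Q. 0 + c * t < \<bar>f y\<bar>}) * indicator {0<..} (0 + c * t) \<partial>lborel)
    = (\<integral>\<^sup>+t\<in>{0<..}. sobolev_pow TYPE('n) (emeasure lborel {y\<in>Q. c * t < \<bar>f y\<bar>}) \<partial>lborel)"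
    using c by (intro nn_integral_cong) (simp add: indicator_def zero_less_mult_iff)
  finally have "ennreal (1 / c) * lorentz_integral Q f = (ennreal (1 / c) * ennreal c) * (\<integral>\<^sup>+t\<in>{0<..}. sobolev_pow TYPE('n) (emeasure lborel {y\<in>Q. c * t < \<bar>f y\<bar>}) \<partial>lborel)"
    using c by (simp add: mult.assoc)
  then show ?thesis unfolding ennreal_inverse_cancel[OF c] by simp
qed

text \<open>
  If \<open>|f| > t\<close> then \<open>|g| > (1 - \<epsilon>) t\<close> or \<open>|f - g| > \<epsilon> t\<close>. In contrast to splitting \<open>t\<close> in halves, the factor of the
  term with \<open>g\<close> tends to \<open>1\<close>, so differences can be controlled.
\<close>
lemma lorentz_integral_quasi:
  fixes f g :: "real ^ 'n \<Rightarrow> real"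
  assumes n: "2 \<le> CARD('n)" and [measurable]: "f \<in> borel_measurable borel" "g \<in> borel_measurable borel" "Q \<in> sets borel"
    and \<epsilon>: "0 < \<epsilon>" "\<epsilon> < 1"
  shows "lorentz_integral Q f \<le> ennreal (1 / (1 - \<epsilon>)) * lorentz_integral Q g + ennreal (1 / \<epsilon>) * lorentz_integral Q (\<lambda>y. f y - g y)"
proof -
  let ?p = "sobolev_pow TYPE('n)"
  have 1: "(\<lambda>t. ?p (emeasure lborel {y\<in>Q. (1 - \<epsilon>) * t < \<bar>g y\<bar>})) \<in> borel_measurable borel"
    by (rule measurable_compose[OF _ sobolev_pow_measurable[of g Q]]) measurable
  have 2: "(\<lambda>t. ?p (emeasure lborel {y\<in>Q. \<epsilon> * t < \<bar>f y - g y\<bar>})) \<in> borel_measurable borel"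
    by (rule measurable_compose[OF _ sobolev_pow_measurable[of "\<lambda>y. f y - g y" Q]]) measurable
  have "lorentz_integral Q f \<le> (\<integral>\<^sup>+t. ?p (emeasure lborel {y\<in>Q. (1 - \<epsilon>) * t < \<bar>g y\<bar>}) * indicator {0<..} t
     + ?p (emeasure lborel {y\<in>Q. \<epsilon> * t < \<bar>f y - g y\<bar>}) * indicator {0<..} t \<partial>lborel)"
    unfolding lorentz_integral_def
  proof (rule nn_integral_mono)
    fix t :: real
    have "{y\<in>Q. t < \<bar>f y\<bar>} \<subseteq> {y\<in>Q. (1 - \<epsilon>) * t < \<bar>g y\<bar>} \<union> {y\<in>Q. \<epsilon> * t < \<bar>f y - g y\<bar>}"
    proof (intro subsetI, rule ccontr)
      fix y assume a: "y \<in> {y\<in>Q. t < \<bar>f y\<bar>}" "y \<notin> {y\<in>Q. (1 - \<epsilon>) * t < \<bar>g y\<bar>} \<union> {y\<in>Q. \<epsilon> * t < \<bar>f y - g y\<bar>}"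
      then have "\<bar>g y\<bar> \<le> (1 - \<epsilon>) * t" "\<bar>f y - g y\<bar> \<le> \<epsilon> * t" by auto
      then have "\<bar>f y\<bar> \<le> (1 - \<epsilon>) * t + \<epsilon> * t" by linarith
      also have "\<dots> = t" by (simp add: algebra_simps)
      finally show False using a by simp
    qed
    then have "emeasure lborel {y\<in>Q. t < \<bar>f y\<bar>} \<le> emeasure lborel ({y\<in>Q. (1 - \<epsilon>) * t < \<bar>g y\<bar>} \<union> {y\<in>Q. \<epsilon> * t < \<bar>f y - g y\<bar>})"
      by (intro emeasure_mono) auto
    also have "\<dots> \<le> emeasure lborel {y\<in>Q. (1 - \<epsilon>) * t < \<bar>g y\<bar>} + emeasure lborel {y\<in>Q. \<epsilon> * t < \<bar>f y - g y\<bar>}"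
      by (rule emeasure_subadditive) auto
    finally have "?p (emeasure lborel {y\<in>Q. t < \<bar>f y\<bar>}) \<le> ?p (emeasure lborel {y\<in>Q. (1 - \<epsilon>) * t < \<bar>g y\<bar>} + emeasure lborel {y\<in>Q. \<epsilon> * t < \<bar>f y - g y\<bar>})"
      by (rule sobolev_pow_mono[OF n])
    also note sobolev_pow_subadditive[OF n]
    finally show "?p (emeasure lborel {y\<in>Q. t < \<bar>f y\<bar>}) * indicator {0<..} t
      \<le> ?p (emeasure lborel {y\<in>Q. (1 - \<epsilon>) * t < \<bar>g y\<bar>}) * indicator {0<..} t + ?p (emeasure lborel {y\<in>Q. \<epsilon> * t < \<bar>f y - g y\<bar>}) * indicator {0<..} t"
      by (auto simp: indicator_def)
  qed
  also have "\<dots> = (\<integral>\<^sup>+t\<in>{0<..}. ?p (emeasure lborel {y\<in>Q. (1 - \<epsilon>) * t < \<bar>g y\<bar>}) \<partial>lborel)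
     + (\<integral>\<^sup>+t\<in>{0<..}. ?p (emeasure lborel {y\<in>Q. \<epsilon> * t < \<bar>f y - g y\<bar>}) \<partial>lborel)"
    using 1 2 by (intro nn_integral_add) auto
  also have "\<dots> = ennreal (1 / (1 - \<epsilon>)) * lorentz_integral Q g + ennreal (1 / \<epsilon>) * lorentz_integral Q (\<lambda>y. f y - g y)"
    using \<epsilon> by (simp add: lorentz_integral_scale)
  finally show ?thesis .
qed

lemma max_lorentz_eq:
  fixes f :: "real ^ 'n \<Rightarrow> real"
  assumes n: "2 \<le> CARD('n)" and [measurable]: "f \<in> borel_measurable borel"
  shows "max_lorentz f x = enn2ereal (SUP (a, l)\<in>{(a, l). 0 < l \<and> x \<in> cube a l}.
     ennreal (conj_dim TYPE('n)) * lorentz_integral (cube a l) f / ennreal (l ^ (CARD('n) - 1)))"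
proof -
  have "lorentz_avg (cube a l) f = ennreal (conj_dim TYPE('n)) * lorentz_integral (cube a l) f / ennreal (l ^ (CARD('n) - 1))"
    if "0 < l" for a l
  proof -
    have "{y \<in> cube a l. t < \<bar>f y\<bar>} \<in> sets borel" for t
      using borel_closed[OF closed_cbox, of a "\<chi> i. a $ i + l"] by measurable
    then have "emeasure lebesgue {y \<in> cube a l. t < \<bar>f y\<bar>} = emeasure lborel {y \<in> cube a l. t < \<bar>f y\<bar>}" for t
      by simp
    then show ?thesis
      using that n by (simp add: lorentz_avg_def Let_def lorentz_integral_def emeasure_cube sobolev_pow_power less_imp_le)
  qed
  moreover have "{Q \<in> cubes. x \<in> Q} = (\<lambda>(a, l). cube a l) ` {(a, l). 0 < l \<and> x \<in> cube a l}"
    unfolding cubes_def by auto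
  ultimately show ?thesis
    unfolding max_lorentz_def by (auto simp: image_image intro!: arg_cong[of _ _ enn2ereal] SUP_cong)
qed

definition max_lorentz_const :: "'n::finite itself \<Rightarrow> real" where
  "max_lorentz_const n = conj_dim n * (local_const CARD('n) * (2 * CARD('n)) ^ (CARD('n) - 1))"

lemma conj_dim_nonneg: "2 \<le> CARD('n::finite) \<Longrightarrow> 0 \<le> conj_dim TYPE('n)"
  by (simp add: conj_dim_def)

lemma max_lorentz_const_nonneg: "2 \<le> CARD('n::finite) \<Longrightarrow> 0 \<le> max_lorentz_const TYPE('n)"
  by (simp add: max_lorentz_const_def local_const_nonneg conj_dim_nonneg)

lemma lorentz_integral_cube_bound:
  fixes f :: "real ^ 'n \<Rightarrow> real"
  assumes n: "2 \<le> CARD('n)" and f: "C1c f" and l: "0 < l" and x: "x \<in> cube a l"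
  shows "ennreal (conj_dim TYPE('n)) * lorentz_integral (cube a l) f / ennreal (l ^ (CARD('n) - 1))
    \<le> ennreal (max_lorentz_const TYPE('n) * grad_potential f x)"
proof -
  let ?n = "CARD('n)"
  \<comment> \<open>The diameter of the cube is at most \<open>n l\<close>; twice this gives an open ball around it.\<close>
  let ?R = "2 * real ?n * l"
  have R: "?R > 0" using l by simp
  have [measurable]: "f \<in> borel_measurable borel" using f by (simp add: C1c_def C1_measurable)
  have sub: "cube a l \<subseteq> ball x ?R"
  proof
    fix y assume "y \<in> cube a l"
    then have "norm (x - y) \<le> ?n * l" by (rule norm_diff_cube[OF x])
    also have "?n * l < ?R" using l by simp
    finally show "y \<in> ball x ?R" by (simp add: dist_norm)
  qed
  have "lorentz_integral (cube a l) f \<le> lorentz_integral (ball x ?R) f"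
    unfolding lorentz_integral_def using sub
    by (intro nn_integral_mono mult_right_mono sobolev_pow_mono n emeasure_mono) auto
  also have "\<dots> \<le> ennreal (local_const ?n * ?R ^ (?n - 1)) * riesz (grad_abs f) x"
    unfolding lorentz_integral_def by (rule C1c_lorentz_local[OF n f R])
  also have "\<dots> = ennreal (local_const ?n * ?R ^ (?n - 1) * grad_potential f x)"
    by (simp add: ennreal_grad_potential[OF f, symmetric] ennreal_mult'' grad_potential_nonneg)
  finally have "ennreal (conj_dim TYPE('n)) * lorentz_integral (cube a l) f
    \<le> ennreal (conj_dim TYPE('n)) * ennreal (local_const ?n * ?R ^ (?n - 1) * grad_potential f x)"
    by (rule mult_left_mono) simp
  also have "\<dots> = ennreal (conj_dim TYPE('n) * (local_const ?n * ?R ^ (?n - 1) * grad_potential f x))"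
    by (rule ennreal_mult'[symmetric, OF conj_dim_nonneg[OF n]])
  also have "conj_dim TYPE('n) * (local_const ?n * ?R ^ (?n - 1) * grad_potential f x)
    = l ^ (?n - 1) * (max_lorentz_const TYPE('n) * grad_potential f x)"
    by (simp add: max_lorentz_const_def power_mult_distrib)
  also have "ennreal \<dots> = ennreal (l ^ (?n - 1)) * ennreal (max_lorentz_const TYPE('n) * grad_potential f x)"
    using l by (intro ennreal_mult') simp
  finally show ?thesis using l by (intro divide_le_posI_ennreal) auto
qed

text \<open>
  Inserting \<open>1 / (1 - \<epsilon>) \<le> 1 + 2 \<epsilon>\<close> in the quasi-triangle inequality bounds \<open>T f - T g\<close> by
  \<open>2 \<epsilon> T g + T (f - g) / \<epsilon>\<close>.
\<close>
lemma controlled_max_lorentz: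
  assumes n: "2 \<le> CARD('n::finite)"
  shows "controlled_by_riesz (max_lorentz :: 'n operator)"
proof -
  let ?C = "max_lorentz_const TYPE('n)" and ?n = "CARD('n)" and ?c = "ennreal (conj_dim TYPE('n))"
  define L where "L f x = (SUP (a, l)\<in>{(a, l). 0 < l \<and> x \<in> cube a l}.
     ?c * lorentz_integral (cube a l) f / ennreal (l ^ (?n - 1)))" for f :: "real^'n \<Rightarrow> real" and x
  have C: "0 \<le> ?C" by (rule max_lorentz_const_nonneg[OF n])
  have fm: "f \<in> borel_measurable borel" if "C1c f" for f :: "real^'n \<Rightarrow> real"
    using that by (simp add: C1c_def C1_measurable)
  have eq: "max_lorentz f x = enn2ereal (L f x)" if "C1c f" for f :: "real^'n \<Rightarrow> real" and x
    unfolding L_def by (rule max_lorentz_eq[OF n fm[OF that]])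
  have bound: "L f x \<le> ennreal (?C * grad_potential f x)" if "C1c f" for f :: "real^'n \<Rightarrow> real" and x
    unfolding L_def by (intro SUP_least, clarify) (rule lorentz_integral_cube_bound[OF n that])
  have meas: "L f \<in> borel_measurable borel" if f: "C1c f" for f :: "real^'n \<Rightarrow> real"
  proof (rule borel_measurableI_greater)
    fix y
    have [measurable]: "f \<in> borel_measurable borel" by (rule fm[OF f])
    have "open {x. y < L f x}"
      unfolding L_def
    proof (rule open_superlevel_cube_sup)
      fix a b :: "real^'n" and l m :: real
      assume sub: "cube a l \<subseteq> cube b m"
      have "cube b m \<in> sets borel" by simp
      then show "?c * lorentz_integral (cube a l) f \<le> ?c * lorentz_integral (cube b m) f"
        unfolding lorentz_integral_def using sub
        by (intro mult_left_mono nn_integral_mono mult_right_mono sobolev_pow_mono n emeasure_mono) auto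
    qed (auto intro!: continuous_intros)
    then show "{x \<in> space borel. y < L f x} \<in> sets borel" by simp
  qed
  have sub: "L f x \<le> ennreal (1 / (1 - \<epsilon>)) * L g x + ennreal (1 / \<epsilon>) * L (\<lambda>y. f y - g y) x"
    if f: "C1c f" and g: "C1c g" and \<epsilon>: "0 < \<epsilon>" "\<epsilon> < 1" for f g :: "real^'n \<Rightarrow> real" and x \<epsilon>
    unfolding L_def[of f x]
  proof (intro SUP_least, clarify)
    fix a l assume l: "0 < l" and x: "x \<in> cube a l"
    have [measurable]: "cube a l \<in> sets borel" by simp
    have *: "?c * lorentz_integral (cube a l) h / ennreal (l ^ (?n - 1)) \<le> L h x" for h
      unfolding L_def using l x by (intro SUP_upper2[of "(a, l)"]) auto
    have "?c * lorentz_integral (cube a l) f / ennreal (l ^ (?n - 1))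
      \<le> ?c * (ennreal (1 / (1 - \<epsilon>)) * lorentz_integral (cube a l) g + ennreal (1 / \<epsilon>) * lorentz_integral (cube a l) (\<lambda>y. f y - g y)) / ennreal (l ^ (?n - 1))"
      by (intro divide_right_mono_ennreal mult_left_mono lorentz_integral_quasi n fm f g \<epsilon>) auto
    also have "\<dots> = ennreal (1 / (1 - \<epsilon>)) * (?c * lorentz_integral (cube a l) g / ennreal (l ^ (?n - 1)))
      + ennreal (1 / \<epsilon>) * (?c * lorentz_integral (cube a l) (\<lambda>y. f y - g y) / ennreal (l ^ (?n - 1)))"
      by (simp add: distrib_left add_divide_distrib_ennreal mult.left_commute ennreal_times_divide)
    also have "\<dots> \<le> ennreal (1 / (1 - \<epsilon>)) * L g x + ennreal (1 / \<epsilon>) * L (\<lambda>y. f y - g y) x"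
      by (intro add_mono mult_left_mono *) auto
    finally show "?c * lorentz_integral (cube a l) f / ennreal (l ^ (?n - 1))
      \<le> ennreal (1 / (1 - \<epsilon>)) * L g x + ennreal (1 / \<epsilon>) * L (\<lambda>y. f y - g y) x" .
  qed
  define K where "K f x = enn2real (L f x)" for f :: "real^'n \<Rightarrow> real" and x
  have K: "max_lorentz f x = ereal (K f x)" "0 \<le> K f x" "K f x \<le> ?C * grad_potential f x" "L f x = ennreal (K f x)"
    if "C1c f" for f :: "real^'n \<Rightarrow> real" and x
  proof -
    show LK: "L f x = ennreal (K f x)" using le_less_trans[OF bound[OF that, of x] ennreal_less_top] by (simp add: K_def)
    show K0: "0 \<le> K f x" by (simp add: K_def)
    show "max_lorentz f x = ereal (K f x)" using eq[OF that, of x] LK K0 by simp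
    show "K f x \<le> ?C * grad_potential f x"
      using bound[OF that, of x] C unfolding LK by (subst (asm) ennreal_le_iff) (auto simp: grad_potential_nonneg)
  qed
  have diff: "K f x - K g x \<le> 2 * \<epsilon> * (?C * grad_potential g x) + ?C * grad_potential (\<lambda>y. f y - g y) x / \<epsilon>"
    if f: "C1c f" and g: "C1c g" and \<epsilon>: "0 < \<epsilon>" "\<epsilon> \<le> 1 / 2" for f g :: "real^'n \<Rightarrow> real" and x \<epsilon>
  proof -
    have d: "C1c (\<lambda>y. f y - g y)" by (rule C1c_diff[OF f g])
    have "ennreal (K f x) \<le> ennreal (1 / (1 - \<epsilon>)) * ennreal (K g x) + ennreal (1 / \<epsilon>) * ennreal (K (\<lambda>y. f y - g y) x)"
      using sub[OF f g \<epsilon>(1), of x] \<epsilon> K(4) f g d by simp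
    also have "\<dots> = ennreal (1 / (1 - \<epsilon>) * K g x + 1 / \<epsilon> * K (\<lambda>y. f y - g y) x)"
      using \<epsilon> K(2)[OF g, of x] K(2)[OF d, of x] by (simp add: ennreal_mult' ennreal_plus del: times_divide_eq_left times_divide_eq_right)
    finally have "K f x \<le> 1 / (1 - \<epsilon>) * K g x + 1 / \<epsilon> * K (\<lambda>y. f y - g y) x"
      using \<epsilon> K(2)[OF g, of x] K(2)[OF d, of x] by (subst (asm) ennreal_le_iff) auto
    also have "1 / (1 - \<epsilon>) * K g x \<le> (1 + 2 * \<epsilon>) * K g x"
    proof (rule mult_right_mono[OF _ K(2)[OF g]])
      have "\<epsilon> * (2 * \<epsilon>) \<le> \<epsilon> * 1" using \<epsilon> by (intro mult_left_mono) auto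
      then show "1 / (1 - \<epsilon>) \<le> 1 + 2 * \<epsilon>" using \<epsilon> by (simp add: field_simps)
    qed
    also have "1 / \<epsilon> * K (\<lambda>y. f y - g y) x \<le> 1 / \<epsilon> * (?C * grad_potential (\<lambda>y. f y - g y) x)"
      using \<epsilon> by (intro mult_left_mono K(3)[OF d]) auto
    finally have "K f x - K g x \<le> 2 * \<epsilon> * K g x + 1 / \<epsilon> * (?C * grad_potential (\<lambda>y. f y - g y) x)"
      by (simp add: algebra_simps)
    also have "2 * \<epsilon> * K g x \<le> 2 * \<epsilon> * (?C * grad_potential g x)"
      using \<epsilon> by (intro mult_left_mono K(3)[OF g]) auto
    finally show ?thesis by simp
  qed
  show ?thesis
    unfolding controlled_by_riesz_def
  proof (intro exI[of _ "2 * ?C"] conjI allI impI)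
    show "0 \<le> 2 * ?C" using C by simp
    fix f g :: "real^'n \<Rightarrow> real" and x assume f: "C1c f" and g: "C1c g"
    have "max_lorentz f = (\<lambda>x. enn2ereal (L f x))" using eq[OF f] by auto
    then show "max_lorentz f \<in> borel_measurable borel" using meas[OF f] by simp
    have "0 \<le> ?C * grad_potential f x" using C by (simp add: grad_potential_nonneg)
    then show "\<bar>max_lorentz f x\<bar> \<le> ereal (2 * ?C * grad_potential f x)"
      using K(1-3)[OF f, of x] by simp
    fix \<epsilon> :: real assume \<epsilon>: "0 < \<epsilon>" "\<epsilon> \<le> 1 / 2"
    let ?d = "grad_potential (\<lambda>y. f y - g y) x"
    have 0: "0 \<le> \<epsilon> * (?C * grad_potential f x)" "0 \<le> \<epsilon> * (?C * grad_potential g x)" "0 \<le> ?C * ?d / \<epsilon>"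
      using C \<epsilon> by (auto intro!: mult_nonneg_nonneg divide_nonneg_nonneg simp: grad_potential_nonneg)
    have "\<bar>K f x - K g x\<bar> \<le> 2 * (\<epsilon> * (?C * grad_potential f x)) + 2 * (\<epsilon> * (?C * grad_potential g x)) + 2 * (?C * ?d / \<epsilon>)"
      using diff[OF f g \<epsilon>, of x] diff[OF g f \<epsilon>, of x] 0 by (simp add: grad_potential_diff_commute[OF g f] abs_le_iff)
    also have "\<dots> = 2 * ?C * (\<epsilon> * (grad_potential f x + grad_potential g x) + ?d / \<epsilon>)"
      by (simp add: algebra_simps)
    finally show "\<bar>max_lorentz f x - max_lorentz g x\<bar> \<le> ereal (2 * ?C * (\<epsilon> * (grad_potential f x + grad_potential g x) + ?d / \<epsilon>))"
      using K(1)[OF f] K(1)[OF g] by simp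
  qed
qed

section \<open>The spherical maximal operator\<close>

text \<open>
  Suprema of seminorms that depend continuously on \<open>x\<close>: the supremum is lower semicontinuous and sublinear.
\<close>
lemma controlled_by_riesz_SUP:
  fixes T :: "'n::finite operator" and S :: "real \<Rightarrow> (real ^ 'n \<Rightarrow> real) \<Rightarrow> real ^ 'n \<Rightarrow> real"
  assumes C: "0 \<le> C"
    and T: "\<And>f x. C1c f \<Longrightarrow> T f x = (SUP t\<in>{0<..}. ereal (S t f x))"
    and T0: "\<And>f x. 0 \<le> T f x"
    and cont: "\<And>t f. 0 < t \<Longrightarrow> C1c f \<Longrightarrow> continuous_on UNIV (S t f)"
    and bound: "\<And>t f x. 0 < t \<Longrightarrow> C1c f \<Longrightarrow> S t f x \<le> C * grad_potential f x"
    and sub: "\<And>t f g x. 0 < t \<Longrightarrow> C1c f \<Longrightarrow> C1c g \<Longrightarrow> S t f x \<le> S t g x + S t (\<lambda>y. f y - g y) x"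
  shows "controlled_by_riesz T"
proof (rule controlled_by_rieszI_sublinear[OF C _ T0])
  fix f g :: "real^'n \<Rightarrow> real" and x assume f: "C1c f"
  show "T f \<in> borel_measurable borel"
  proof (rule borel_measurableI_greater)
    fix y
    have "{x. y < T f x} = (\<Union>t\<in>{0<..}. {x. y < ereal (S t f x)})"
      by (auto simp: T[OF f] less_SUP_iff)
    moreover have "open {x. y < ereal (S t f x)}" if "0 < t" for t
      using cont[OF that f] by (intro open_Collect_less) (auto intro!: continuous_intros continuous_on_ereal)
    ultimately have "open {x. y < T f x}" by (auto intro: open_UN)
    then show "{x \<in> space borel. y < T f x} \<in> sets borel" by simp
  qed
  show "T f x \<le> ereal (C * grad_potential f x)"
    unfolding T[OF f] using bound[OF _ f] by (intro SUP_least) auto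
  assume g: "C1c g"
  note fg = C1c_diff[OF f g]
  show "T f x \<le> T g x + T (\<lambda>y. f y - g y) x"
    unfolding T[OF f]
  proof (rule SUP_least)
    fix t :: real assume t: "t \<in> {0<..}"
    then have "ereal (S t f x) \<le> ereal (S t g x) + ereal (S t (\<lambda>y. f y - g y) x)" using sub[OF _ f g] by simp
    also have "\<dots> \<le> T g x + T (\<lambda>y. f y - g y) x"
      unfolding T[OF g] T[OF fg] using t by (intro add_mono SUP_upper) auto
    finally show "ereal (S t f x) \<le> T g x + T (\<lambda>y. f y - g y) x" .
  qed
qed

lemma continuous_param_integral:
  fixes f :: "real ^ 'n \<Rightarrow> real" and w :: "'a \<Rightarrow> real"
  assumes w: "integrable M w" and h[measurable]: "h \<in> M \<rightarrow>\<^sub>M borel"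
    and f: "continuous_on UNIV f" "\<And>x. \<bar>f x\<bar> \<le> B"
  shows "continuous_on S (\<lambda>x. LINT y|M. w y * f (x - h y))"
proof -
  have [measurable]: "f \<in> borel_measurable borel" using f(1) by (rule borel_measurable_continuous_onI)
  have [measurable]: "w \<in> borel_measurable M" using w by simp
  have "isCont (\<lambda>x. LINT y|M. w y * f (x - h y)) x" for x
    unfolding continuous_at_sequentially comp_def
  proof safe
    fix X :: "nat \<Rightarrow> real^'n" assume X: "X \<longlonglongrightarrow> x"
    show "(\<lambda>i. LINT y|M. w y * f (X i - h y)) \<longlonglongrightarrow> (LINT y|M. w y * f (x - h y))"
    proof (rule integral_dominated_convergence[where w = "\<lambda>y. B * \<bar>w y\<bar>"])
      show "integrable M (\<lambda>y. B * \<bar>w y\<bar>)" using w by simp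
      have "isCont f z" for z using f(1) by (simp add: continuous_on_eq_continuous_at)
      then have "(\<lambda>i. f (X i - h y)) \<longlonglongrightarrow> f (x - h y)" for y
        by (rule isCont_tendsto_compose) (intro tendsto_intros X)
      then show "AE y in M. (\<lambda>i. w y * f (X i - h y)) \<longlonglongrightarrow> w y * f (x - h y)"
        by (intro always_eventually allI tendsto_intros)
      show "AE y in M. norm (w y * f (X i - h y)) \<le> B * \<bar>w y\<bar>" for i
        using f(2) by (intro always_eventually allI) (simp add: abs_mult mult.commute[of "\<bar>w _\<bar>"] mult_right_mono)
    qed measurable
  qed
  then show ?thesis by (simp add: continuous_at_imp_continuous_on)
qed

definition surface0 :: "(real ^ 'n) measure" where
  "surface0 = scale_measure (of_nat CARD('n))
     (distr (lebesgue_on (ball 0 1 - {0})) (restrict_space borel (sphere 0 1)) sgn)"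

lemma surface_eq: "surface = completion surface0"
  by (simp add: surface_def surface0_def)

lemma borel_measurable_sgn_vec[measurable]: "sgn \<in> borel_measurable (borel :: (real^'n) measure)"
  unfolding sgn_div_norm[abs_def] by measurable

lemma sgn_measurable_sphere:
  "sgn \<in> lebesgue_on (ball 0 1 - {0}) \<rightarrow>\<^sub>M restrict_space borel (sphere (0::real^'n) 1)"
proof (rule measurable_restrict_space2)
  show "sgn \<in> space (lebesgue_on (ball 0 1 - {0::real^'n})) \<rightarrow> sphere 0 1"
    by (auto simp: space_restrict_space norm_sgn)
  show "sgn \<in> lebesgue_on (ball 0 1 - {0::real^'n}) \<rightarrow>\<^sub>M borel"
    by (intro measurable_restrict_space1 measurable_completion) simp
qed

lemma sets_surface0: "sets surface0 = sets (restrict_space borel (sphere (0::real^'n) 1))"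
  by (simp add: surface0_def)

lemma space_surface0: "space surface0 = sphere (0::real^'n) 1"
  by (simp add: surface0_def space_scale_measure space_restrict_space)

lemma nn_integral_surface0:
  fixes G :: "real ^ 'n \<Rightarrow> ennreal"
  assumes G: "G \<in> borel_measurable (restrict_space borel (sphere 0 1))"
  shows "(\<integral>\<^sup>+y. G y \<partial>surface0) = ennreal CARD('n) * (\<integral>\<^sup>+y\<in>ball 0 1. G (sgn y) \<partial>lborel)"
proof -
  have "(\<integral>\<^sup>+y. G y \<partial>surface0) = of_nat CARD('n) * (\<integral>\<^sup>+y. G y \<partial>distr (lebesgue_on (ball 0 1 - {0})) (restrict_space borel (sphere 0 1)) sgn)"
    unfolding surface0_def using G by (intro nn_integral_scale_measure) simp
  also have "(\<integral>\<^sup>+y. G y \<partial>distr (lebesgue_on (ball 0 1 - {0})) (restrict_space borel (sphere 0 1)) sgn)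
    = (\<integral>\<^sup>+y. G (sgn y) \<partial>lebesgue_on (ball 0 1 - {0}))"
    by (rule nn_integral_distr[OF sgn_measurable_sphere]) (use G in simp)
  also have "\<dots> = (\<integral>\<^sup>+y. G (sgn y) * indicator (ball 0 1 - {0}) y \<partial>lebesgue)"
    by (rule nn_integral_restrict_space) simp
  also have "\<dots> = (\<integral>\<^sup>+y. G (sgn y) * indicator (ball 0 1 - {0}) y \<partial>lborel)"
    by (simp add: nn_integral_completion)
  also have "\<dots> = (\<integral>\<^sup>+y\<in>ball 0 1. G (sgn y) \<partial>lborel)"
  proof (rule nn_integral_cong_AE)
    show "AE y in lborel. G (sgn y) * indicator (ball 0 1 - {0}) y = G (sgn y) * indicator (ball 0 1) y"
      using AE_lborel_singleton[of 0] by eventually_elim (auto simp: indicator_def)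
  qed
  finally show ?thesis by (simp add: ennreal_of_nat_eq_real_of_nat)
qed

lemma measurable_sphere_borel:
  "f \<in> borel \<rightarrow>\<^sub>M N \<Longrightarrow> f \<in> restrict_space borel (sphere (0::real^'n) 1) \<rightarrow>\<^sub>M N"
  by (rule measurable_restrict_space1)

lemma finite_surface: "finite_measure (surface :: (real^'n) measure)"
proof (rule finite_measureI)
  have "emeasure (surface :: (real^'n) measure) (space surface) = (\<integral>\<^sup>+y. 1 \<partial>(surface :: (real^'n) measure))" by simp
  also have "\<dots> = (\<integral>\<^sup>+y. 1 \<partial>(surface0 :: (real^'n) measure))"
    unfolding surface_eq by (rule nn_integral_completion)
  also have "\<dots> = ennreal CARD('n) * emeasure lborel (ball (0::real^'n) 1)"
    by (subst nn_integral_surface0) auto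
  also have "\<dots> \<noteq> \<infinity>" by (simp add: emeasure_ball ennreal_mult_eq_top_iff)
  finally show "emeasure (surface :: (real^'n) measure) (space surface) \<noteq> \<infinity>" .
qed

lemma surface_measurable: "f \<in> borel_measurable borel \<Longrightarrow> f \<in> surface \<rightarrow>\<^sub>M borel"
  unfolding surface_eq
  by (intro measurable_completion) (simp add: measurable_sphere_borel measurable_cong_sets[OF sets_surface0 refl])

lemma controlled_max_sphere: "controlled_by_riesz (max_sphere :: 'n::finite operator)"
proof (rule controlled_by_riesz_SUP[where C = 1 and S = "\<lambda>t f x. \<bar>LINT y|surface. f (x - t *\<^sub>R y)\<bar>"])
  interpret finite_measure "surface :: (real^'n) measure" by (rule finite_surface)
  fix f g :: "real^'n \<Rightarrow> real" and x
  show "max_sphere f x = (SUP t\<in>{0<..}. ereal \<bar>LINT y|surface. f (x - t *\<^sub>R y)\<bar>)"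
    by (simp add: max_sphere_def)
  show "0 \<le> max_sphere f x"
    unfolding max_sphere_def by (intro SUP_upper2[of 1]) auto
  fix t :: real assume t: "0 < t"
  have int: "integrable surface (\<lambda>y. f (x - t *\<^sub>R y))" if f: "C1c f" for f :: "real^'n \<Rightarrow> real" and x
  proof -
    obtain M where M: "\<And>x. \<bar>f x\<bar> \<le> M" using C1c_bounded[OF f] by blast
    have [measurable]: "f \<in> borel_measurable borel" using f by (simp add: C1c_def C1_measurable)
    have "(\<lambda>y. f (x - t *\<^sub>R y)) \<in> borel_measurable borel" by measurable
    then show ?thesis
      by (intro integrable_const_bound[of _ M] always_eventually surface_measurable) (auto simp: M)
  qed
  assume f: "C1c f"
  obtain M where M: "\<And>x. \<bar>f x\<bar> \<le> M" using C1c_bounded[OF f] by blast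
  have "continuous_on UNIV (\<lambda>x. LINT y|surface. 1 * f (x - t *\<^sub>R y))"
    using f by (intro continuous_param_integral[OF _ _ _ M] surface_measurable) (auto simp: C1c_def C1_continuous)
  then show "continuous_on UNIV (\<lambda>x. \<bar>LINT y|surface. f (x - t *\<^sub>R y)\<bar>)"
    by (intro continuous_intros) simp
  show "\<bar>LINT y|surface. f (x - t *\<^sub>R y)\<bar> \<le> 1 * grad_potential f x"
  proof -
    have [measurable]: "f \<in> borel_measurable borel" using f by (simp add: C1c_def C1_measurable)
    have "ennreal \<bar>LINT y|surface. f (x - t *\<^sub>R y)\<bar> \<le> (\<integral>\<^sup>+y. ennreal \<bar>f (x - t *\<^sub>R y)\<bar> \<partial>surface)"
      using integral_norm_bound_ennreal[OF int[OF f, of x]] by simp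
    also have "\<dots> = (\<integral>\<^sup>+y. ennreal \<bar>f (x - t *\<^sub>R y)\<bar> \<partial>surface0)"
      unfolding surface_eq by (rule nn_integral_completion)
    also have "\<dots> = ennreal CARD('n) * (\<integral>\<^sup>+y\<in>ball 0 1. ennreal \<bar>f (x - t *\<^sub>R sgn y)\<bar> \<partial>lborel)"
      by (intro nn_integral_surface0 measurable_sphere_borel) measurable
    also have "\<dots> \<le> riesz (grad_abs f) x" using t by (intro C1c_sphere_bound f) simp
    also have "\<dots> = ennreal (grad_potential f x)" by (simp add: ennreal_grad_potential[OF f])
    finally show ?thesis by (simp add: grad_potential_nonneg)
  qed
  assume g: "C1c g"
  have "(LINT y|surface. f (x - t *\<^sub>R y) - g (x - t *\<^sub>R y)) = (LINT y|surface. f (x - t *\<^sub>R y)) - (LINT y|surface. g (x - t *\<^sub>R y))"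
    by (rule Bochner_Integration.integral_diff[OF int[OF f] int[OF g]])
  then show "\<bar>LINT y|surface. f (x - t *\<^sub>R y)\<bar> \<le> \<bar>LINT y|surface. g (x - t *\<^sub>R y)\<bar> + \<bar>LINT y|surface. f (x - t *\<^sub>R y) - g (x - t *\<^sub>R y)\<bar>"
    by linarith
qed simp

section \<open>Rough kernels as Borel functions\<close>

text \<open>
  For functions that are homogeneous of degree zero, integrals over all balls are determined by the unit ball,
  hence by the surface measure.
\<close>
lemma nn_integral_homogeneous:
  fixes H :: "real ^ 'n \<Rightarrow> ennreal"
  assumes [measurable]: "H \<in> borel_measurable borel" and hom: "\<And>c y. 0 < c \<Longrightarrow> H (c *\<^sub>R y) = H y" and R: "0 < R"
  shows "(\<integral>\<^sup>+y\<in>ball 0 R. H y \<partial>lborel) = ennreal (R ^ CARD('n)) * (\<integral>\<^sup>+y\<in>ball 0 1. H y \<partial>lborel)"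
proof -
  have "(\<integral>\<^sup>+y\<in>ball 0 R. H y \<partial>lborel) = ennreal (\<bar>R\<bar> ^ DIM(real^'n)) * (\<integral>\<^sup>+y. H (0 + R *\<^sub>R y) * indicator (ball 0 R) (0 + R *\<^sub>R y) \<partial>lborel)"
    by (rule nn_integral_lborel_affine) (use R in auto)
  also have "(\<integral>\<^sup>+y. H (0 + R *\<^sub>R y) * indicator (ball 0 R) (0 + R *\<^sub>R y) \<partial>lborel) = (\<integral>\<^sup>+y\<in>ball 0 1. H y \<partial>lborel)"
    using R by (intro nn_integral_cong) (simp add: hom indicator_def)
  finally show ?thesis using R by simp
qed

text \<open>
  The form that membership of the kernel in \<open>L\<^sup>n\<^sup>,\<^sup>\<infinity>\<close> of the sphere takes on balls, by homogeneity: the bound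
  depends only on the ratio of the radius to the height.
\<close>
definition rough_borel :: "(real ^ 'n \<Rightarrow> real) \<Rightarrow> real \<Rightarrow> bool" where
  "rough_borel W A \<longleftrightarrow> W \<in> borel_measurable borel \<and> 0 \<le> A \<and>
     (\<forall>R>0. \<forall>\<tau>>0. emeasure lborel {y\<in>ball 0 R. \<tau> < \<bar>W y\<bar>} \<le> ennreal (A * (R / \<tau>) ^ CARD('n)))"

text \<open>
  The mean of \<open>W\<close> over every ball about the origin vanishes, stated through positive and negative parts so
  that it can be dilated inside \<^typ>\<open>ennreal\<close>.
\<close>
definition balanced :: "(real ^ 'n \<Rightarrow> real) \<Rightarrow> bool" where
  "balanced W \<longleftrightarrow> (\<forall>R>0. (\<integral>\<^sup>+y\<in>ball 0 R. ennreal (W y) \<partial>lborel) = (\<integral>\<^sup>+y\<in>ball 0 R. ennreal (- W y) \<partial>lborel))"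

text \<open>
  The kernel is measurable only for the completed surface measure. It has a Borel version on the sphere, whose
  extension along rays agrees with it off a cone. That cone is null in the unit ball, hence null in the whole
  space by dilation.
\<close>
lemma rough_kernel_borel:
  fixes \<Omega> :: "real ^ 'n \<Rightarrow> real"
  assumes \<Omega>: "rough_kernel \<Omega>"
  obtains W A where "rough_borel W A" "AE y in lborel. \<Omega> y = W y" "mean_zero \<Omega> \<Longrightarrow> balanced W"
proof -
  let ?n = "CARD('n)"
  have hom: "\<Omega> (r *\<^sub>R y) = \<Omega> y" if "0 < r" "y \<noteq> 0" for r y
    using \<Omega> that by (auto simp: rough_kernel_def homogeneous0_def)
  have "(\<lambda>y. ereal (\<Omega> y)) \<in> borel_measurable surface" using \<Omega> by (simp add: rough_kernel_def fun_space_def)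
  then have \<Omega>_surface: "\<Omega> \<in> borel_measurable surface" by simp
  then obtain \<Omega>' where \<Omega>'0: "\<Omega>' \<in> borel_measurable surface0" and eq: "AE x in surface0. \<Omega> x = \<Omega>' x"
    unfolding surface_eq using completion_ex_borel_measurable_real by blast
  then have \<Omega>'[measurable]: "\<Omega>' \<in> borel_measurable (restrict_space borel (sphere 0 1))"
    by (simp add: measurable_cong_sets[OF sets_surface0 refl])
  define W where "W y = (if y = 0 then 0 else \<Omega>' (sgn y))" for y
  have W_meas[measurable]: "W \<in> borel_measurable borel"
  proof -
    have "sgn \<in> restrict_space borel (- {0}) \<rightarrow>\<^sub>M restrict_space borel (sphere (0::real^'n) 1)"
      by (rule measurable_restrict_space2) (auto simp: space_restrict_space norm_sgn intro: measurable_restrict_space1)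
    from measurable_compose[OF this \<Omega>']
    have "(\<lambda>y. indicator (- {0}) y *\<^sub>R \<Omega>' (sgn y)) \<in> borel_measurable borel"
      by (subst (asm) borel_measurable_restrict_space_iff) auto
    also have "(\<lambda>y. indicator (- {0}) y *\<^sub>R \<Omega>' (sgn y)) = W" by (auto simp: W_def fun_eq_iff)
    finally show ?thesis .
  qed
  have W_hom: "W (c *\<^sub>R y) = W y" if "0 < c" for c y
    using that by (simp add: W_def sgn_scaleR)
  have W_AE: "AE y in lborel. \<Omega> y = W y"
  proof -
    from eq obtain N where N: "{x\<in>space surface0. \<Omega> x \<noteq> \<Omega>' x} \<subseteq> N" "N \<in> null_sets surface0"
      by (auto elim: AE_E3 simp: AE_iff_null_sets eventually_ae_filter)
    then have N_sets: "N \<in> sets (restrict_space borel (sphere 0 1))" by (auto simp: sets_surface0)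
    then have N_borel[measurable]: "N \<in> sets borel" by (subst (asm) sets_restrict_space_iff) auto
    let ?H = "\<lambda>y. indicator N (sgn y) :: ennreal"
    have "emeasure surface0 N = (\<integral>\<^sup>+y. indicator N y \<partial>surface0)"
      using N by (intro nn_integral_indicator[symmetric]) auto
    also have "\<dots> = ennreal ?n * (\<integral>\<^sup>+y\<in>ball 0 1. ?H y \<partial>lborel)"
      by (rule nn_integral_surface0) (use N_sets in simp)
    finally have 0: "(\<integral>\<^sup>+y\<in>ball 0 1. ?H y \<partial>lborel) = 0"
      using N by (auto simp: null_sets_def)
    have k0: "AE y in lborel. ?H y * indicator (ball 0 (real (Suc k))) y = 0" for k
    proof -
      have "(\<integral>\<^sup>+y\<in>ball 0 (real (Suc k)). ?H y \<partial>lborel) = 0"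
        by (subst nn_integral_homogeneous) (auto simp: 0 sgn_scaleR)
      then show ?thesis by (subst (asm) nn_integral_0_iff_AE) auto
    qed
    have "AE y in lborel. \<forall>k. ?H y * indicator (ball 0 (real (Suc k))) y = 0"
      unfolding AE_all_countable by (intro allI k0)
    with AE_lborel_singleton[of 0] show ?thesis
    proof eventually_elim
      case (elim y)
      obtain k where "norm y < real k" using reals_Archimedean2 by blast
      then have "y \<in> ball 0 (real (Suc k))" by simp
      with elim(2) have "?H y = 0" by (metis indicator_simps(1) mult_1_right)
      then have "sgn y \<notin> N" by (simp add: indicator_def split: if_splits)
      then have "\<Omega> (sgn y) = \<Omega>' (sgn y)"
        using subsetD[OF N(1), of "sgn y"] elim(1) by (auto simp: space_surface0 norm_sgn)
      moreover have "\<Omega> (sgn y) = \<Omega> y"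
        using hom[of "inverse (norm y)" y] elim(1) by (simp add: sgn_div_norm)
      ultimately show "\<Omega> y = W y" using elim(1) by (simp add: W_def)
    qed
  qed
  \<comment> \<open>With an arbitrary Borel function \<open>\<phi>\<close> this serves for the superlevel sets as well as for both signs of the mean.\<close>
  have surf: "(\<integral>\<^sup>+y. ennreal (\<phi> (\<Omega> y)) \<partial>surface) = ennreal ?n * (\<integral>\<^sup>+y\<in>ball 0 1. ennreal (\<phi> (W y)) \<partial>lborel)"
    if [measurable]: "\<phi> \<in> borel_measurable borel" for \<phi> :: "real \<Rightarrow> real"
  proof -
    have "(\<integral>\<^sup>+y. ennreal (\<phi> (\<Omega> y)) \<partial>surface) = (\<integral>\<^sup>+y. ennreal (\<phi> (\<Omega> y)) \<partial>surface0)"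
      unfolding surface_eq by (rule nn_integral_completion)
    also have "\<dots> = (\<integral>\<^sup>+y. ennreal (\<phi> (\<Omega>' y)) \<partial>surface0)"
    proof (rule nn_integral_cong_AE)
      show "AE y in surface0. ennreal (\<phi> (\<Omega> y)) = ennreal (\<phi> (\<Omega>' y))"
        using eq by eventually_elim simp
    qed
    also have "\<dots> = ennreal ?n * (\<integral>\<^sup>+y\<in>ball 0 1. ennreal (\<phi> (\<Omega>' (sgn y))) \<partial>lborel)"
      by (rule nn_integral_surface0) measurable
    also have "(\<integral>\<^sup>+y\<in>ball 0 1. ennreal (\<phi> (\<Omega>' (sgn y))) \<partial>lborel) = (\<integral>\<^sup>+y\<in>ball 0 1. ennreal (\<phi> (W y)) \<partial>lborel)"
    proof (rule nn_integral_cong_AE)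
      show "AE y in lborel. ennreal (\<phi> (\<Omega>' (sgn y))) * indicator (ball 0 1) y = ennreal (\<phi> (W y)) * indicator (ball 0 1) y"
        using AE_lborel_singleton[of 0] by eventually_elim (simp add: W_def)
    qed
    finally show ?thesis .
  qed
  define K where "K = enn2real (weak_Lq_norm ?n surface (\<lambda>y. ereal (\<Omega> y)))"
  have K: "ennreal K = weak_Lq_norm ?n surface (\<lambda>y. ereal (\<Omega> y))" "0 \<le> K"
    using \<Omega> by (auto simp: K_def rough_kernel_def fun_space_def less_top[symmetric])
  have weak: "emeasure lborel {y\<in>ball 0 R. \<tau> < \<bar>W y\<bar>} \<le> ennreal (K ^ ?n * (R / \<tau>) ^ ?n)"
    if R: "0 < R" and \<tau>: "0 < \<tau>" for R \<tau>
  proof -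
    let ?m = "emeasure surface {y\<in>space surface. ereal \<tau> < \<bar>ereal (\<Omega> y)\<bar>}"
    have m: "?m = (\<integral>\<^sup>+y. ennreal (indicator {s. \<tau> < \<bar>s\<bar>} (\<Omega> y)) \<partial>surface)"
    proof -
      have "{y\<in>space surface. ereal \<tau> < \<bar>ereal (\<Omega> y)\<bar>} \<in> sets surface" using \<Omega>_surface by measurable
      from nn_integral_indicator[OF this, symmetric] show ?thesis
        by (auto intro!: nn_integral_cong simp: indicator_def)
    qed
    also have "\<dots> = ennreal ?n * (\<integral>\<^sup>+y\<in>ball 0 1. ennreal (indicator {s. \<tau> < \<bar>s\<bar>} (W y)) \<partial>lborel)"
      by (rule surf) measurable
    finally have m2: "?m = ennreal ?n * (\<integral>\<^sup>+y\<in>ball 0 1. ennreal (indicator {s. \<tau> < \<bar>s\<bar>} (W y)) \<partial>lborel)" .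
    have "?m < \<infinity>"
      using finite_measure.emeasure_finite[OF finite_surface, of "{y\<in>space surface. ereal \<tau> < \<bar>ereal (\<Omega> y)\<bar>}"]
      by (simp add: less_top)
    then obtain \<rho> where \<rho>: "0 \<le> \<rho>" "?m = ennreal (\<rho> ^ ?n)" by (rule ennreal_eq_power[of _ ?n]) auto
    have "ennreal \<tau> * epowr ?m (1 / ?n) \<le> ennreal K"
      unfolding K weak_Lq_norm_def using \<tau> by (intro SUP_upper) auto
    also have "epowr ?m (1 / ?n) = ennreal \<rho>"
      using \<rho> by (cases "\<rho> = 0") (auto simp: epowr_def power_0_left powr_realpow[symmetric] powr_powr)
    finally have "\<tau> * \<rho> \<le> K" using \<tau> \<rho> K(2) by (simp flip: ennreal_mult)
    then have "\<rho> \<le> K / \<tau>" using \<tau> by (simp add: field_simps)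
    then have \<rho>2: "\<rho> ^ ?n \<le> (K / \<tau>) ^ ?n" using \<rho> by (intro power_mono)
    have "emeasure lborel {y\<in>ball 0 R. \<tau> < \<bar>W y\<bar>} = (\<integral>\<^sup>+y. indicator {y\<in>ball 0 R. \<tau> < \<bar>W y\<bar>} y \<partial>lborel)"
      by (rule nn_integral_indicator[symmetric]) measurable
    also have "\<dots> = (\<integral>\<^sup>+y\<in>ball 0 R. ennreal (indicator {s. \<tau> < \<bar>s\<bar>} (W y)) \<partial>lborel)"
      by (intro nn_integral_cong) (auto simp: indicator_def)
    also have "\<dots> = ennreal (R ^ ?n) * (\<integral>\<^sup>+y\<in>ball 0 1. ennreal (indicator {s. \<tau> < \<bar>s\<bar>} (W y)) \<partial>lborel)"
      by (rule nn_integral_homogeneous) (use R W_hom in auto)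
    also have "(\<integral>\<^sup>+y\<in>ball 0 1. ennreal (indicator {s. \<tau> < \<bar>s\<bar>} (W y)) \<partial>lborel)
        \<le> ennreal ?n * (\<integral>\<^sup>+y\<in>ball 0 1. ennreal (indicator {s. \<tau> < \<bar>s\<bar>} (W y)) \<partial>lborel)" (is "?I \<le> _")
    proof -
      have "1 * ?I \<le> ennreal ?n * ?I" by (rule mult_right_mono) (auto simp: Suc_leI)
      then show ?thesis by simp
    qed
    also have "\<dots> \<le> ennreal ((K / \<tau>) ^ ?n)" unfolding m2[symmetric] \<rho> using \<rho>2 by (rule ennreal_leI)
    finally have "emeasure lborel {y\<in>ball 0 R. \<tau> < \<bar>W y\<bar>} \<le> ennreal (R ^ ?n) * ennreal ((K / \<tau>) ^ ?n)"
      by (simp add: mult_left_mono)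
    also have "\<dots> = ennreal (K ^ ?n * (R / \<tau>) ^ ?n)"
      using R by (simp add: power_divide mult.commute flip: ennreal_mult')
    finally show ?thesis .
  qed
  show ?thesis
  proof (rule that[OF _ W_AE])
    show "rough_borel W (K ^ ?n)" unfolding rough_borel_def using weak K by auto
    show "balanced W" if "mean_zero \<Omega>"
      unfolding balanced_def
    proof (intro allI impI)
      fix R :: real assume R: "0 < R"
      have int: "integrable surface \<Omega>" and 0: "(LINT y|surface. \<Omega> y) = 0"
        using that by (auto simp: mean_zero_def)
      have fin: "(\<integral>\<^sup>+y. ennreal (\<Omega> y) \<partial>surface) \<noteq> \<infinity>" "(\<integral>\<^sup>+y. ennreal (- \<Omega> y) \<partial>surface) \<noteq> \<infinity>"
        using int by (auto simp: real_integrable_def)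
      have "(\<integral>\<^sup>+y. ennreal (\<Omega> y) \<partial>surface) = (\<integral>\<^sup>+y. ennreal (- \<Omega> y) \<partial>surface)"
      proof -
        have "enn2real (\<integral>\<^sup>+y. ennreal (\<Omega> y) \<partial>surface) = enn2real (\<integral>\<^sup>+y. ennreal (- \<Omega> y) \<partial>surface)"
          using 0 unfolding real_lebesgue_integral_def[OF int] by simp
        with fin show ?thesis
          by (cases "\<integral>\<^sup>+y. ennreal (\<Omega> y) \<partial>surface"; cases "\<integral>\<^sup>+y. ennreal (- \<Omega> y) \<partial>surface") auto
      qed
      then have "ennreal ?n * (\<integral>\<^sup>+y\<in>ball 0 1. ennreal (W y) \<partial>lborel) = ennreal ?n * (\<integral>\<^sup>+y\<in>ball 0 1. ennreal (- W y) \<partial>lborel)"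
        using surf[of "\<lambda>x. x"] surf[of "\<lambda>x. - x"] by simp
      then have "(\<integral>\<^sup>+y\<in>ball 0 1. ennreal (W y) \<partial>lborel) = (\<integral>\<^sup>+y\<in>ball 0 1. ennreal (- W y) \<partial>lborel)"
        by (subst (asm) ennreal_mult_cancel_left) auto
      then show "(\<integral>\<^sup>+y\<in>ball 0 R. ennreal (W y) \<partial>lborel) = (\<integral>\<^sup>+y\<in>ball 0 R. ennreal (- W y) \<partial>lborel)"
        using nn_integral_homogeneous[of "\<lambda>y. ennreal (W y)" R] nn_integral_homogeneous[of "\<lambda>y. ennreal (- W y)" R] R
        by (simp only: W_hom) simp
    qed
  qed
qed

section \<open>Hoelder's inequality for rough kernels\<close>

lemma nn_integral_layer_cake:
  fixes w :: "'a::euclidean_space \<Rightarrow> ennreal" and F :: "'a \<Rightarrow> real"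
  assumes [measurable]: "w \<in> borel_measurable borel" "F \<in> borel_measurable borel"
  shows "(\<integral>\<^sup>+y. w y * ennreal \<bar>F y\<bar> \<partial>lborel) = (\<integral>\<^sup>+s\<in>{0<..}. (\<integral>\<^sup>+y\<in>{y. s < \<bar>F y\<bar>}. w y \<partial>lborel) \<partial>lborel)"
proof -
  have a: "ennreal a = (\<integral>\<^sup>+s. (if 0 < s \<and> s < a then 1 else 0) \<partial>lborel)" if "0 \<le> a" for a :: real
  proof -
    have "(\<integral>\<^sup>+s. (if 0 < s \<and> s < a then 1 else 0) \<partial>lborel) = (\<integral>\<^sup>+s. indicator {0<..<a} s \<partial>lborel)"
      by (intro nn_integral_cong) (simp add: indicator_def)
    then show ?thesis using that by simp
  qed
  have "(\<integral>\<^sup>+y. w y * ennreal \<bar>F y\<bar> \<partial>lborel) = (\<integral>\<^sup>+y. \<integral>\<^sup>+s. w y * (if 0 < s \<and> s < \<bar>F y\<bar> then 1 else 0) \<partial>lborel \<partial>lborel)"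
    by (subst a) (auto simp: nn_integral_cmult)
  also have "\<dots> = (\<integral>\<^sup>+s. \<integral>\<^sup>+y. w y * (if 0 < s \<and> s < \<bar>F y\<bar> then 1 else 0) \<partial>lborel \<partial>lborel)"
    by (rule tonelli_lborel) measurable
  also have "\<dots> = (\<integral>\<^sup>+s\<in>{0<..}. (\<integral>\<^sup>+y\<in>{y. s < \<bar>F y\<bar>}. w y \<partial>lborel) \<partial>lborel)"
  proof (rule nn_integral_cong)
    fix s :: real
    show "(\<integral>\<^sup>+y. w y * (if 0 < s \<and> s < \<bar>F y\<bar> then 1 else 0) \<partial>lborel) = (\<integral>\<^sup>+y\<in>{y. s < \<bar>F y\<bar>}. w y \<partial>lborel) * indicator {0<..} s"
      by (cases "0 < s") (auto intro!: nn_integral_cong simp: indicator_def)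
  qed
  finally show ?thesis .
qed

lemma rough_borel_measurable: "rough_borel W A \<Longrightarrow> W \<in> borel_measurable borel"
  by (simp add: rough_borel_def)

text \<open>
  Half of Hoelder's inequality between \<open>L\<^sup>n\<^sup>,\<^sup>\<infinity>\<close> and \<open>L\<^sup>n\<^sup>'\<^sup>,\<^sup>1\<close>: with \<open>|E| = \<rho>\<^sup>n\<close>, the superlevel sets in
  \<open>E\<close> are bounded by \<open>|E|\<close> for heights up to \<open>R / \<rho>\<close> and by the weak-type bound above.
\<close>
lemma rough_borel_set:
  fixes W :: "real ^ 'n \<Rightarrow> real"
  assumes n: "2 \<le> CARD('n)" and W: "rough_borel W A" and R: "0 < R"
    and E[measurable]: "E \<in> sets borel" and ER: "E \<subseteq> ball 0 R"
  shows "(\<integral>\<^sup>+y\<in>E. ennreal \<bar>W y\<bar> \<partial>lborel) \<le> ennreal ((1 + A) * R) * sobolev_pow TYPE('n) (emeasure lborel E)"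
proof -
  let ?n = "CARD('n)"
  have [measurable]: "W \<in> borel_measurable borel" by (rule rough_borel_measurable[OF W])
  have A: "0 \<le> A" using W by (simp add: rough_borel_def)
  have weak: "emeasure lborel {y\<in>ball 0 R. \<tau> < \<bar>W y\<bar>} \<le> ennreal (A * (R / \<tau>) ^ ?n)" if "0 < \<tau>" for \<tau>
    using W R that by (simp add: rough_borel_def)
  have "emeasure lborel E \<le> emeasure lborel (ball (0::real^'n) R)" by (rule emeasure_mono[OF ER]) simp
  also have "\<dots> < \<infinity>" by (rule emeasure_bounded_finite) simp
  finally obtain \<rho> where \<rho>: "0 \<le> \<rho>" "emeasure lborel E = ennreal (\<rho> ^ ?n)" by (rule ennreal_eq_power[of _ ?n]) auto
  show ?thesis
  proof (cases "\<rho> = 0")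
    case True
    then have "E \<in> null_sets lborel" using \<rho> n by (auto simp: null_sets_def power_0_left)
    then have "(\<integral>\<^sup>+y\<in>E. ennreal \<bar>W y\<bar> \<partial>lborel) = 0"
      by (subst nn_integral_0_iff_AE) (auto dest!: AE_not_in simp: indicator_def elim!: eventually_mono)
    then show ?thesis by simp
  next
    case False
    then have \<rho>0: "\<rho> > 0" using \<rho> by simp
    obtain m where m: "?n = Suc m" "1 \<le> m" using n by (cases ?n) auto
    have "(\<integral>\<^sup>+y\<in>E. ennreal \<bar>W y\<bar> \<partial>lborel) = (\<integral>\<^sup>+y. indicator E y * ennreal \<bar>W y\<bar> \<partial>lborel)"
      by (simp add: mult.commute)
    also have "\<dots> = (\<integral>\<^sup>+s\<in>{0<..}. (\<integral>\<^sup>+y\<in>{y. s < \<bar>W y\<bar>}. indicator E y \<partial>lborel) \<partial>lborel)"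
      by (rule nn_integral_layer_cake) measurable
    also have "\<dots> \<le> (\<integral>\<^sup>+s. ennreal (\<rho> ^ ?n) * indicator {0..R / \<rho>} s + ennreal (A * R ^ ?n) * (ennreal (1 / s ^ Suc m) * indicator {R / \<rho><..} s) \<partial>lborel)"
    proof (rule nn_integral_mono)
      fix s :: real
      have e: "(\<integral>\<^sup>+y\<in>{y. s < \<bar>W y\<bar>}. indicator E y \<partial>lborel) = emeasure lborel (E \<inter> {y. s < \<bar>W y\<bar>})"
      proof -
        have "(\<integral>\<^sup>+y\<in>{y. s < \<bar>W y\<bar>}. indicator E y \<partial>lborel) = (\<integral>\<^sup>+y. indicator (E \<inter> {y. s < \<bar>W y\<bar>}) y \<partial>lborel)"
          by (intro nn_integral_cong) (auto simp: indicator_def)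
        also have "\<dots> = emeasure lborel (E \<inter> {y. s < \<bar>W y\<bar>})" by (rule nn_integral_indicator) measurable
        finally show ?thesis .
      qed
      show "(\<integral>\<^sup>+y\<in>{y. s < \<bar>W y\<bar>}. indicator E y \<partial>lborel) * indicator {0<..} s
        \<le> ennreal (\<rho> ^ ?n) * indicator {0..R / \<rho>} s + ennreal (A * R ^ ?n) * (ennreal (1 / s ^ Suc m) * indicator {R / \<rho><..} s)"
      proof (cases "0 < s")
        case s: True
        show ?thesis
        proof (cases "s \<le> R / \<rho>")
          case True
          have "emeasure lborel (E \<inter> {y. s < \<bar>W y\<bar>}) \<le> ennreal (\<rho> ^ ?n)"
            unfolding \<rho>(2)[symmetric] by (rule emeasure_mono) auto
          then show ?thesis unfolding e using s True by simp
        next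
          case False
          have "emeasure lborel (E \<inter> {y. s < \<bar>W y\<bar>}) \<le> emeasure lborel {y\<in>ball 0 R. s < \<bar>W y\<bar>}"
            using ER by (intro emeasure_mono) auto
          also have "\<dots> \<le> ennreal (A * (R / s) ^ ?n)" by (rule weak[OF s])
          also have "\<dots> = ennreal (A * R ^ ?n) * ennreal (1 / s ^ Suc m)"
            using s A R by (simp add: m power_divide flip: ennreal_mult)
          finally show ?thesis unfolding e using s False by simp
        qed
      qed simp
    qed
    also have "\<dots> = ennreal (\<rho> ^ ?n) * ennreal (R / \<rho>) + ennreal (A * R ^ ?n) * ennreal (1 / (real m * (R / \<rho>) ^ m))"
      using R \<rho>0 m by (subst nn_integral_add) (auto simp: nn_integral_cmult nn_integral_cmult_indicator nn_integral_tail_power simp del: power_Suc)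
    also have "\<dots> = ennreal (\<rho> ^ ?n * (R / \<rho>) + A * R ^ ?n * (1 / (real m * (R / \<rho>) ^ m)))"
    proof -
      have "ennreal (\<rho> ^ ?n) * ennreal (R / \<rho>) = ennreal (\<rho> ^ ?n * (R / \<rho>))"
        by (rule ennreal_mult[symmetric]) (use R \<rho> in auto)
      moreover have "ennreal (A * R ^ ?n) * ennreal (1 / (real m * (R / \<rho>) ^ m)) = ennreal (A * R ^ ?n * (1 / (real m * (R / \<rho>) ^ m)))"
        by (rule ennreal_mult[symmetric]) (use R \<rho> A in auto)
      moreover have "ennreal (\<rho> ^ ?n * (R / \<rho>)) + ennreal (A * R ^ ?n * (1 / (real m * (R / \<rho>) ^ m))) = ennreal (\<rho> ^ ?n * (R / \<rho>) + A * R ^ ?n * (1 / (real m * (R / \<rho>) ^ m)))"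
        by (rule ennreal_plus[symmetric]) (use R \<rho> A in auto)
      ultimately show ?thesis by simp
    qed
    also have "\<rho> ^ ?n * (R / \<rho>) + A * R ^ ?n * (1 / (real m * (R / \<rho>) ^ m)) = R * \<rho> ^ m + A / real m * (R * \<rho> ^ m)"
      using R \<rho>0 m by (simp add: m power_divide field_simps)
    also have "\<dots> \<le> R * \<rho> ^ m + A * (R * \<rho> ^ m)"
      using R \<rho> m A by (intro add_left_mono mult_right_mono) (auto simp: field_simps mult_le_cancel_left1)
    also have "\<dots> = (1 + A) * R * \<rho> ^ (?n - 1)" by (simp add: m algebra_simps)
    also have "ennreal ((1 + A) * R * \<rho> ^ (?n - 1)) = ennreal ((1 + A) * R) * sobolev_pow TYPE('n) (emeasure lborel E)"
      unfolding \<rho>(2) sobolev_pow_power[OF n \<rho>(1)] by (rule ennreal_mult) (use R \<rho> A in auto)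
    finally show ?thesis by (simp add: ennreal_leI)
  qed
qed

text \<open>
  The layer cake formula for \<open>f\<close> reduces the pairing to the integrals of \<open>W\<close> over superlevel sets.
\<close>
lemma rough_borel_hoelder:
  fixes W f :: "real ^ 'n \<Rightarrow> real"
  assumes n: "2 \<le> CARD('n)" and W: "rough_borel W A" and R: "0 < R"
    and [measurable]: "f \<in> borel_measurable borel"
  shows "(\<integral>\<^sup>+y\<in>ball 0 R. ennreal \<bar>W y\<bar> * ennreal \<bar>f (x - y)\<bar> \<partial>lborel)
    \<le> ennreal ((1 + A) * R) * lorentz_integral (ball x R) f"
proof -
  have [measurable]: "W \<in> borel_measurable borel" by (rule rough_borel_measurable[OF W])
  let ?E = "\<lambda>s. {y\<in>ball 0 R. s < \<bar>f (x - y)\<bar>}"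
  have E[measurable]: "?E s \<in> sets borel" for s by measurable
  have "(\<integral>\<^sup>+y\<in>ball 0 R. ennreal \<bar>W y\<bar> * ennreal \<bar>f (x - y)\<bar> \<partial>lborel)
     = (\<integral>\<^sup>+y. (ennreal \<bar>W y\<bar> * indicator (ball 0 R) y) * ennreal \<bar>f (x - y)\<bar> \<partial>lborel)"
    by (simp add: mult_ac)
  also have "\<dots> = (\<integral>\<^sup>+s\<in>{0<..}. (\<integral>\<^sup>+y\<in>{y. s < \<bar>f (x - y)\<bar>}. ennreal \<bar>W y\<bar> * indicator (ball 0 R) y \<partial>lborel) \<partial>lborel)"
    by (rule nn_integral_layer_cake) measurable
  also have "\<dots> = (\<integral>\<^sup>+s\<in>{0<..}. (\<integral>\<^sup>+y\<in>?E s. ennreal \<bar>W y\<bar> \<partial>lborel) \<partial>lborel)"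
  proof (rule nn_integral_cong)
    fix s :: real
    have "(\<integral>\<^sup>+y\<in>{y. s < \<bar>f (x - y)\<bar>}. ennreal \<bar>W y\<bar> * indicator (ball 0 R) y \<partial>lborel) = (\<integral>\<^sup>+y\<in>?E s. ennreal \<bar>W y\<bar> \<partial>lborel)"
      by (intro nn_integral_cong) (auto simp: indicator_def)
    then show "(\<integral>\<^sup>+y\<in>{y. s < \<bar>f (x - y)\<bar>}. ennreal \<bar>W y\<bar> * indicator (ball 0 R) y \<partial>lborel) * indicator {0<..} s
      = (\<integral>\<^sup>+y\<in>?E s. ennreal \<bar>W y\<bar> \<partial>lborel) * indicator {0<..} s"
      by (simp only:)
  qed
  also have "\<dots> \<le> (\<integral>\<^sup>+s\<in>{0<..}. (ennreal ((1 + A) * R) * sobolev_pow TYPE('n) (emeasure lborel (?E s))) \<partial>lborel)"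
    by (intro nn_integral_mono mult_right_mono rough_borel_set n W R E) auto
  also have "\<dots> = (\<integral>\<^sup>+s. ennreal ((1 + A) * R) * (sobolev_pow TYPE('n) (emeasure lborel {y\<in>ball x R. s < \<bar>f y\<bar>}) * indicator {0<..} s) \<partial>lborel)"
  proof (rule nn_integral_cong)
    fix s
    have "emeasure lborel (?E s) = (\<integral>\<^sup>+y. indicator {z\<in>ball x R. s < \<bar>f z\<bar>} (x - y) \<partial>lborel)"
    proof -
      have "emeasure lborel (?E s) = (\<integral>\<^sup>+y. indicator (?E s) y \<partial>lborel)" by (rule nn_integral_indicator[symmetric]) measurable
      also have "\<dots> = (\<integral>\<^sup>+y. indicator {z\<in>ball x R. s < \<bar>f z\<bar>} (x - y) \<partial>lborel)"
        by (intro nn_integral_cong) (auto simp: indicator_def dist_norm)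
      finally show ?thesis .
    qed
    also have "\<dots> = (\<integral>\<^sup>+y. indicator {z\<in>ball x R. s < \<bar>f z\<bar>} y \<partial>lborel)"
      by (rule nn_integral_lborel_reflect) measurable
    also have "\<dots> = emeasure lborel {z\<in>ball x R. s < \<bar>f z\<bar>}" by (rule nn_integral_indicator) measurable
    finally show "ennreal ((1 + A) * R) * sobolev_pow TYPE('n) (emeasure lborel (?E s)) * indicator {0<..} s
      = ennreal ((1 + A) * R) * (sobolev_pow TYPE('n) (emeasure lborel {y\<in>ball x R. s < \<bar>f y\<bar>}) * indicator {0<..} s)"
      by (simp add: mult.assoc)
  qed
  also have "\<dots> = ennreal ((1 + A) * R) * lorentz_integral (ball x R) f"
    unfolding lorentz_integral_def
    by (rule nn_integral_cmult) (use sobolev_pow_measurable[of f "ball x R"] in simp)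
  finally show ?thesis .
qed

lemma rough_borel_integrable_ball:
  fixes W :: "real ^ 'n \<Rightarrow> real"
  assumes n: "2 \<le> CARD('n)" and W: "rough_borel W A"
  shows "integrable lborel (\<lambda>y. indicator (ball 0 R) y * W y)"
proof (cases "0 < R")
  case True
  have [measurable]: "W \<in> borel_measurable borel" by (rule rough_borel_measurable[OF W])
  have "emeasure lborel (ball (0::real^'n) R) < \<infinity>" by (rule emeasure_bounded_finite) simp
  then obtain \<rho> where \<rho>: "0 \<le> \<rho>" "emeasure lborel (ball (0::real^'n) R) = ennreal (\<rho> ^ CARD('n))"
    by (rule ennreal_eq_power[of _ "CARD('n)"]) auto
  have "(\<integral>\<^sup>+y. ennreal (norm (indicator (ball 0 R) y * W y)) \<partial>lborel) = (\<integral>\<^sup>+y\<in>ball 0 R. ennreal \<bar>W y\<bar> \<partial>lborel)"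
    by (intro nn_integral_cong) (simp add: indicator_def)
  also have "\<dots> \<le> ennreal ((1 + A) * R) * sobolev_pow TYPE('n) (emeasure lborel (ball (0::real^'n) R))"
    by (rule rough_borel_set[OF n W True]) auto
  also have "\<dots> < \<infinity>" unfolding \<rho>(2) sobolev_pow_power[OF n \<rho>(1)] by (simp add: ennreal_mult_less_top)
  finally show ?thesis by (intro integrableI_bounded) auto
next
  case False
  then have e: "ball (0::real^'n) R = {}" by simp
  show ?thesis unfolding e by simp
qed

section \<open>Integrals of rough kernels over annuli\<close>

lemma balanced_annulus:
  fixes W :: "real ^ 'n \<Rightarrow> real"
  assumes n: "2 \<le> CARD('n)" and W: "rough_borel W A" and bal: "balanced W" and t: "0 \<le> t"
  shows "(LINT y|lborel. indicator {y. t < norm y \<and> norm y < r} y * W y) = 0"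
proof (cases "t < r")
  case True
  have [measurable]: "W \<in> borel_measurable borel" by (rule rough_borel_measurable[OF W])
  note int = rough_borel_integrable_ball[OF n W]
  have ball: "(LINT y|lborel. indicator (ball 0 R) y * W y) = 0" for R
  proof (cases "0 < R")
    case True
    have "(\<integral>\<^sup>+y. ennreal (indicator (ball 0 R) y * W y) \<partial>lborel) = (\<integral>\<^sup>+y\<in>ball 0 R. ennreal (W y) \<partial>lborel)"
      "(\<integral>\<^sup>+y. ennreal (- (indicator (ball 0 R) y * W y)) \<partial>lborel) = (\<integral>\<^sup>+y\<in>ball 0 R. ennreal (- W y) \<partial>lborel)"
      by (intro nn_integral_cong, simp add: indicator_def)+
    then show ?thesis
      using bal True unfolding real_lebesgue_integral_def[OF int] balanced_def by simp
  next
    case False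
    then have e: "ball (0::real^'n) R = {}" by simp
    show ?thesis unfolding e by simp
  qed
  have "(LINT y|lborel. indicator {y. t < norm y \<and> norm y < r} y * W y)
    = (LINT y|lborel. indicator (ball 0 r) y * W y - indicator (ball 0 t) y * W y)"
  proof (rule integral_cong_AE)
    have "negligible (sphere (0::real^'n) t)" by (rule negligible_sphere)
    then have "sphere (0::real^'n) t \<in> null_sets lborel"
      by (simp add: negligible_iff_null_sets null_sets_completion_iff)
    from AE_not_in[OF this]
    show "AE y in lborel. indicator {y. t < norm y \<and> norm y < r} y * W y = indicator (ball 0 r) y * W y - indicator (ball 0 t) y * W y"
      by eventually_elim (use True in \<open>auto simp: indicator_def\<close>)
  qed measurable
  also have "\<dots> = 0" using ball by (subst Bochner_Integration.integral_diff[OF int int]) simp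
  finally show ?thesis .
next
  case False
  then have "{y::real^'n. t < norm y \<and> norm y < r} = {}" by auto
  then show ?thesis by simp
qed

definition annulus_integral :: "(real ^ 'n \<Rightarrow> real) \<Rightarrow> (real ^ 'n \<Rightarrow> real) \<Rightarrow> real ^ 'n \<Rightarrow> real \<Rightarrow> real \<Rightarrow> real" where
  "annulus_integral W f x t r = (LINT y|lborel. indicator {y. t < norm y \<and> norm y < r} y * (W y * f (x - y)))"

lemma rough_times_integrable:
  fixes W f :: "real ^ 'n \<Rightarrow> real"
  assumes n: "2 \<le> CARD('n)" and W: "rough_borel W A" and f: "C1c f"
  shows "integrable lborel (\<lambda>y. W y * f (x - y))"
proof -
  have [measurable]: "W \<in> borel_measurable borel" by (rule rough_borel_measurable[OF W])
  have [measurable]: "f \<in> borel_measurable borel" using f by (simp add: C1c_def C1_measurable)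
  obtain B where B: "\<And>x. B \<le> norm x \<Longrightarrow> f x = 0" using C1c_support[OF f] by blast
  obtain M where M: "0 \<le> M" "\<And>x. \<bar>f x\<bar> \<le> M" using C1c_bounded[OF f] by blast
  have "integrable lborel (\<lambda>y. M * \<bar>indicator (ball 0 (B + norm x)) y * W y\<bar>)"
    using rough_borel_integrable_ball[OF n W] by simp
  then show ?thesis
  proof (rule Bochner_Integration.integrable_bound)
    have "\<bar>W y * f (x - y)\<bar> \<le> M * \<bar>indicator (ball 0 (B + norm x)) y * W y\<bar>" for y
    proof (cases "norm y < B + norm x")
      case True
      then show ?thesis using M(2)[of "x - y"] by (simp add: abs_mult mult.commute[of "\<bar>W y\<bar>"] mult_right_mono)
    next
      case False
      then have "B \<le> norm (x - y)" using norm_triangle_ineq2[of y x] by (simp add: norm_minus_commute)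
      then show ?thesis using B M by simp
    qed
    then show "AE y in lborel. norm (W y * f (x - y)) \<le> norm (M * \<bar>indicator (ball 0 (B + norm x)) y * W y\<bar>)"
      using M by (intro always_eventually) (simp add: abs_mult)
  qed measurable
qed

text \<open>
  Since \<open>W\<close> has mean zero on the annulus, \<open>f\<close> may be replaced by \<open>f - c\<close> before absolute values are taken.
\<close>
lemma annulus_integral_bound:
  fixes W f :: "real ^ 'n \<Rightarrow> real"
  assumes n: "2 \<le> CARD('n)" and W: "rough_borel W A" and bal: "balanced W" and t: "0 \<le> t" and r: "0 < r" and f: "C1c f"
  shows "ennreal \<bar>annulus_integral W f x t r\<bar>
    \<le> ennreal ((1 + A) * r) * (ennreal (oscillation_const CARD('n)) * (\<integral>\<^sup>+y\<in>ball x (2 * r). grad_abs f y \<partial>lborel))"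
proof -
  let ?S = "{y. t < norm y \<and> norm y < r}"
  have [measurable]: "W \<in> borel_measurable borel" by (rule rough_borel_measurable[OF W])
  have f1: "C1 f" using f by (simp add: C1c_def)
  have [measurable]: "f \<in> borel_measurable borel" using f1 by (rule C1_measurable)
  obtain c where c: "lorentz_integral (ball x r) (\<lambda>y. f y - c) \<le> ennreal (oscillation_const CARD('n)) * (\<integral>\<^sup>+y\<in>ball x (2 * r). grad_abs f y \<partial>lborel)"
    unfolding lorentz_integral_def by (rule C1_lorentz_poincare[OF n f1 r])
  have int1: "integrable lborel (\<lambda>y. indicator ?S y * (W y * f (x - y)))"
    using rough_times_integrable[OF n W f] by (rule integrable_real_mult_indicator[rotated, unfolded mult.commute[of _ "indicator _ _"]]) measurable
  have int2: "integrable lborel (\<lambda>y. indicator ?S y * W y)"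
    by (rule Bochner_Integration.integrable_bound[OF rough_borel_integrable_ball[OF n W, of r]])
      (auto simp: indicator_def)
  have "annulus_integral W f x t r = (LINT y|lborel. indicator ?S y * (W y * f (x - y))) - c * (LINT y|lborel. indicator ?S y * W y)"
    using balanced_annulus[OF n W bal t] by (simp add: annulus_integral_def)
  also have "\<dots> = (LINT y|lborel. indicator ?S y * (W y * f (x - y)) - c * (indicator ?S y * W y))"
    using int1 int2 by simp
  finally have eq: "annulus_integral W f x t r = (LINT y|lborel. indicator ?S y * (W y * f (x - y)) - c * (indicator ?S y * W y))" .
  have "ennreal \<bar>annulus_integral W f x t r\<bar> \<le> (\<integral>\<^sup>+y. ennreal (norm (indicator ?S y * (W y * f (x - y)) - c * (indicator ?S y * W y))) \<partial>lborel)"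
    unfolding eq real_norm_def[symmetric] using int1 int2 by (intro integral_norm_bound_ennreal) simp
  also have "\<dots> \<le> (\<integral>\<^sup>+y\<in>ball 0 r. ennreal \<bar>W y\<bar> * ennreal \<bar>f (x - y) - c\<bar> \<partial>lborel)"
  proof (rule nn_integral_mono)
    fix y
    show "ennreal (norm (indicator ?S y * (W y * f (x - y)) - c * (indicator ?S y * W y)))
      \<le> ennreal \<bar>W y\<bar> * ennreal \<bar>f (x - y) - c\<bar> * indicator (ball 0 r) y"
    proof (cases "y \<in> ?S")
      case True
      then have "norm (indicator ?S y * (W y * f (x - y)) - c * (indicator ?S y * W y)) = \<bar>W y\<bar> * \<bar>f (x - y) - c\<bar>"
        by (simp add: abs_mult[symmetric] algebra_simps)
      then show ?thesis using True by (simp add: ennreal_mult)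
    qed simp
  qed
  also have "\<dots> \<le> ennreal ((1 + A) * r) * lorentz_integral (ball x r) (\<lambda>y. f y - c)"
    using rough_borel_hoelder[OF n W r, of "\<lambda>y. f y - c" x] by simp
  also have "\<dots> \<le> ennreal ((1 + A) * r) * (ennreal (oscillation_const CARD('n)) * (\<integral>\<^sup>+y\<in>ball x (2 * r). grad_abs f y \<partial>lborel))"
    by (intro mult_left_mono c) simp
  finally show ?thesis .
qed

text \<open>
  The potential is the superposition of the integrals over balls of all radii: a point \<open>z\<close> is counted for
  \<open>r > |x - z| / 2\<close>.
\<close>
lemma nn_integral_all_scales:
  fixes g :: "real ^ 'n \<Rightarrow> ennreal"
  assumes n: "2 \<le> CARD('n)" and [measurable]: "g \<in> borel_measurable borel"
  shows "(\<integral>\<^sup>+r\<in>{0<..}. ennreal (1 / r ^ CARD('n)) * (\<integral>\<^sup>+z\<in>ball x (2 * r). g z \<partial>lborel) \<partial>lborel)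
    \<le> ennreal (2 ^ (CARD('n) - 1)) * riesz g x"
proof -
  obtain m where m: "CARD('n) = Suc m" "1 \<le> m" using n by (cases "CARD('n)") auto
  have "(\<integral>\<^sup>+r\<in>{0<..}. ennreal (1 / r ^ CARD('n)) * (\<integral>\<^sup>+z\<in>ball x (2 * r). g z \<partial>lborel) \<partial>lborel)
    = (\<integral>\<^sup>+r. \<integral>\<^sup>+z. g z * (if norm (x - z) / 2 < r then ennreal (1 / r ^ Suc m) else 0) \<partial>lborel \<partial>lborel)"
  proof (rule nn_integral_cong)
    fix r :: real
    show "ennreal (1 / r ^ CARD('n)) * (\<integral>\<^sup>+z\<in>ball x (2 * r). g z \<partial>lborel) * indicator {0<..} r
       = (\<integral>\<^sup>+z. g z * (if norm (x - z) / 2 < r then ennreal (1 / r ^ Suc m) else 0) \<partial>lborel)"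
    proof (cases "0 < r")
      case True
      then show ?thesis
        by (simp add: m nn_integral_cmult[symmetric] del: power_Suc)
          (intro nn_integral_cong, auto simp: indicator_def dist_norm mult.commute)
    next
      case False
      have "\<not> norm (x - z) / 2 < r" for z using False norm_ge_zero[of "x - z"] by linarith
      then show ?thesis using False by simp
    qed
  qed
  also have "\<dots> = (\<integral>\<^sup>+z. \<integral>\<^sup>+r. g z * (if norm (x - z) / 2 < r then ennreal (1 / r ^ Suc m) else 0) \<partial>lborel \<partial>lborel)"
    by (rule tonelli_lborel) measurable
  also have "\<dots> \<le> (\<integral>\<^sup>+z. ennreal (2 ^ m) * (g z * riesz_kernel (x - z)) \<partial>lborel)"
  proof (rule nn_integral_mono_AE)
    show "AE z in lborel. (\<integral>\<^sup>+r. g z * (if norm (x - z) / 2 < r then ennreal (1 / r ^ Suc m) else 0) \<partial>lborel)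
       \<le> ennreal (2 ^ m) * (g z * riesz_kernel (x - z))"
      using AE_lborel_singleton[of x]
    proof eventually_elim
      case (elim z)
      let ?d = "norm (x - z)"
      have d: "0 < ?d" using elim by simp
      have "(\<integral>\<^sup>+r. g z * (if ?d / 2 < r then ennreal (1 / r ^ Suc m) else 0) \<partial>lborel)
        = g z * (\<integral>\<^sup>+r. ennreal (1 / r ^ Suc m) * indicator {?d / 2<..} r \<partial>lborel)"
        by (subst nn_integral_cmult[symmetric]) (auto intro!: nn_integral_cong simp: indicator_def)
      also have "\<dots> = g z * ennreal (1 / (real m * (?d / 2) ^ m))"
        using d m(2) by (subst nn_integral_tail_power) auto
      also have "\<dots> \<le> g z * ennreal (2 ^ m * (1 / ?d ^ m))"
        using d m(2) by (intro mult_left_mono ennreal_leI) (auto simp: power_divide field_simps)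
      also have "\<dots> = ennreal (2 ^ m) * (g z * riesz_kernel (x - z))"
      proof -
        have "riesz_kernel (x - z) = ennreal (1 / ?d ^ m)" using elim by (subst riesz_kernel_eq) (auto simp: m)
        moreover have "ennreal (2 ^ m * (1 / ?d ^ m)) = ennreal (2 ^ m) * ennreal (1 / ?d ^ m)"
          by (rule ennreal_mult) auto
        ultimately show ?thesis by (simp only: mult_ac)
      qed
      finally show ?case .
    qed
  qed
  also have "\<dots> = ennreal (2 ^ (CARD('n) - 1)) * riesz g x"
    unfolding riesz_def using m(1) by (simp add: nn_integral_cmult)
  finally show ?thesis .
qed

text \<open>
  Fubini's theorem for \<open>|y|\<^sup>-\<^sup>n = n \<integral> r\<^sup>-\<^sup>n\<^sup>-\<^sup>1 dr\<close>, the integral being over \<open>r > |y|\<close>. Cancellation in \<open>y\<close> can then be used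
  at each radius \<open>r\<close> separately.
\<close>
lemma truncation_identity:
  fixes H :: "'a::euclidean_space \<Rightarrow> real"
  assumes H: "integrable lborel H" and t: "0 < t" and n: "1 \<le> n"
  shows "(LINT y|lborel. indicator {y. t < norm y} y * (H y / norm y ^ n))
    = (LINT r|lborel. indicator {t<..} r * (real n / r ^ Suc n) * (LINT y|lborel. indicator {y. t < norm y \<and> norm y < r} y * H y))"
proof -
  define G where "G y r = (if t < norm y \<and> norm y < r then H y * (real n / r ^ Suc n) else 0)" for y :: 'a and r :: real
  have H_meas[measurable]: "H \<in> borel_measurable borel" using H by auto
  have G_meas: "case_prod G \<in> borel_measurable (borel \<Otimes>\<^sub>M borel)" unfolding G_def by measurable
  then have G_meas2: "case_prod G \<in> borel_measurable (lborel \<Otimes>\<^sub>M lborel)"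
    by (simp cong: measurable_cong_sets sets_pair_measure_cong)
  have tail: "(\<integral>\<^sup>+r. ennreal (norm (G y r)) \<partial>lborel) = ennreal (indicator {y. t < norm y} y * (\<bar>H y\<bar> / norm y ^ n))" for y
  proof (cases "t < norm y")
    case True
    have "(\<integral>\<^sup>+r. ennreal (norm (G y r)) \<partial>lborel) = (\<integral>\<^sup>+r. ennreal (\<bar>H y\<bar> * real n) * (ennreal (1 / r ^ Suc n) * indicator {norm y<..} r) \<partial>lborel)"
    proof (rule nn_integral_cong)
      fix r
      show "ennreal (norm (G y r)) = ennreal (\<bar>H y\<bar> * real n) * (ennreal (1 / r ^ Suc n) * indicator {norm y<..} r)"
      proof (cases "norm y < r")
        case r: True
        then have "0 < r" using norm_ge_zero[of y] by linarith
        then show ?thesis using r True by (simp add: G_def abs_mult flip: ennreal_mult)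
      qed (simp add: G_def)
    qed
    also have "\<dots> = ennreal (\<bar>H y\<bar> * real n) * ennreal (1 / (real n * norm y ^ n))"
    proof -
      have "0 < norm y" using True t by linarith
      from nn_integral_tail_power[OF this n] show ?thesis
        by (subst nn_integral_cmult) (auto simp del: power_Suc)
    qed
    also have "\<dots> = ennreal (\<bar>H y\<bar> * real n * (1 / (real n * norm y ^ n)))"
      by (rule ennreal_mult[symmetric]) auto
    finally show ?thesis using True n by simp
  qed (simp add: G_def)
  have int: "integrable (lborel \<Otimes>\<^sub>M lborel) (case_prod G)"
  proof (rule integrableI_bounded[OF G_meas2])
    have "(\<integral>\<^sup>+p. ennreal (norm (case_prod G p)) \<partial>(lborel \<Otimes>\<^sub>M lborel)) = (\<integral>\<^sup>+y. \<integral>\<^sup>+r. ennreal (norm (case_prod G (y, r))) \<partial>lborel \<partial>lborel)"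
      by (rule lborel.nn_integral_fst[symmetric]) (use G_meas2 in measurable)
    also have "\<dots> = (\<integral>\<^sup>+y. ennreal (indicator {y. t < norm y} y * (\<bar>H y\<bar> / norm y ^ n)) \<partial>lborel)"
      by (simp add: tail[simplified])
    also have "\<dots> \<le> (\<integral>\<^sup>+y. ennreal (1 / t ^ n) * ennreal (norm (H y)) \<partial>lborel)"
    proof (rule nn_integral_mono)
      fix y
      have "indicator {y. t < norm y} y * (\<bar>H y\<bar> / norm y ^ n) \<le> \<bar>H y\<bar> / t ^ n"
      proof (cases "t < norm y")
        case True
        then have "0 < norm y" using t by linarith
        then show ?thesis using True t by (auto intro!: divide_left_mono power_mono mult_pos_pos zero_less_power)
      qed (use t in auto)
      then show "ennreal (indicator {y. t < norm y} y * (\<bar>H y\<bar> / norm y ^ n)) \<le> ennreal (1 / t ^ n) * ennreal (norm (H y))"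
        using t by (simp add: ennreal_leI flip: ennreal_mult)
    qed
    also have "\<dots> = ennreal (1 / t ^ n) * (\<integral>\<^sup>+y. ennreal (norm (H y)) \<partial>lborel)" by (rule nn_integral_cmult) measurable
    also have "\<dots> < \<infinity>" using H by (auto simp: integrable_iff_bounded ennreal_mult_less_top)
    finally show "(\<integral>\<^sup>+p. ennreal (norm (case_prod G p)) \<partial>(lborel \<Otimes>\<^sub>M lborel)) < \<infinity>" .
  qed
  have inner_r: "(LINT r|lborel. G y r) = indicator {y. t < norm y} y * (H y / norm y ^ n)" for y
  proof -
    have "(LINT r|lborel. \<bar>G y r\<bar>) = indicator {y. t < norm y} y * (\<bar>H y\<bar> / norm y ^ n)"
      by (rule integral_eq_nn_integral[THEN trans]) (use tail[of y] in \<open>auto simp: G_def\<close>)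
    moreover have "G y r = sgn (H y) * \<bar>G y r\<bar>" for r
    proof (cases "t < norm y \<and> norm y < r")
      case True
      then have "0 < r" using norm_ge_zero[of y] by linarith
      then show ?thesis by (simp add: G_def abs_mult mult.assoc[symmetric] mult_sgn_abs)
    qed (auto simp: G_def)
    then have "(LINT r|lborel. G y r) = sgn (H y) * (LINT r|lborel. \<bar>G y r\<bar>)"
      by (metis (no_types, lifting) Bochner_Integration.integral_cong integral_mult_right_zero)
    ultimately show ?thesis by (simp add: indicator_def mult_sgn_abs)
  qed
  have inner_y: "(LINT y|lborel. G y r) = indicator {t<..} r * (real n / r ^ Suc n) * (LINT y|lborel. indicator {y. t < norm y \<and> norm y < r} y * H y)" for r
  proof (cases "t < r")
    case True
    have "(LINT y|lborel. G y r) = (LINT y|lborel. (real n / r ^ Suc n) * (indicator {y. t < norm y \<and> norm y < r} y * H y))"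
      by (intro Bochner_Integration.integral_cong) (auto simp: G_def)
    also have "\<dots> = (real n / r ^ Suc n) * (LINT y|lborel. indicator {y. t < norm y \<and> norm y < r} y * H y)"
      by (rule integral_mult_right_zero)
    finally show ?thesis using True by simp
  next
    case False
    then have "G y r = 0" for y by (auto simp: G_def)
    then show ?thesis using False by simp
  qed
  have "(LINT y|lborel. LINT r|lborel. G y r) = (LINT r|lborel. LINT y|lborel. G y r)"
    by (rule lborel_pair.Fubini_integral[OF int, symmetric])
  then show ?thesis unfolding inner_r inner_y .
qed

section \<open>Truncated singular integrals and principal values\<close>

definition trunc_borel :: "(real ^ 'n \<Rightarrow> real) \<Rightarrow> real \<Rightarrow> (real ^ 'n \<Rightarrow> real) \<Rightarrow> real ^ 'n \<Rightarrow> real" where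
  "trunc_borel W t f x = (LINT y|lborel. indicator {y. t < norm y} y * (W y * f (x - y) / norm y ^ CARD('n)))"

lemma lebesgue_measurable_AE_eq:
  fixes \<Omega> W :: "'a::euclidean_space \<Rightarrow> real"
  assumes W: "W \<in> borel_measurable borel" and eq: "AE y in lborel. \<Omega> y = W y"
  shows "\<Omega> \<in> borel_measurable lebesgue"
proof (rule measurableI)
  fix B :: "real set" assume B: "B \<in> sets borel"
  show "\<Omega> -` B \<inter> space lebesgue \<in> sets lebesgue"
  proof (rule completion.in_sets_AE)
    show "AE x in lebesgue. (x \<in> W -` B) = (x \<in> \<Omega> -` B \<inter> space lebesgue)"
      by (rule AE_completion) (use eq in \<open>eventually_elim, simp\<close>)
    show "W -` B \<in> sets lebesgue"
      using measurable_sets[OF W B] by (intro sets_completionI_sets) simp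
  qed simp
qed simp

lemma truncated_eq:
  fixes \<Omega> W :: "real ^ 'n \<Rightarrow> real"
  assumes W: "W \<in> borel_measurable borel" and eq: "AE y in lborel. \<Omega> y = W y" and f: "C1c f"
  shows "truncated \<Omega> t f x = trunc_borel W t f x"
proof -
  have [measurable]: "f \<in> borel_measurable borel" using f by (simp add: C1c_def C1_measurable)
  note [measurable] = W
  have [measurable]: "\<Omega> \<in> borel_measurable lebesgue" by (rule lebesgue_measurable_AE_eq[OF W eq])
  have m: "(\<lambda>y. indicator {y. t < norm y} y * (W y * f (x - y) / norm y ^ CARD('n))) \<in> borel_measurable borel"
    by measurable
  have m1: "(\<lambda>y. f (x - y)) \<in> borel_measurable lebesgue" "(\<lambda>y::real^'n. norm y ^ CARD('n)) \<in> borel_measurable lebesgue"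
    "{y::real^'n. t < norm y} \<in> sets lebesgue"
    by (intro measurable_completion, measurable)+ (intro sets_completionI_sets, measurable)
  have "truncated \<Omega> t f x = (LINT y|lebesgue. indicator {y. t < norm y} y * (W y * f (x - y) / norm y ^ CARD('n)))"
    unfolding truncated_def set_lebesgue_integral_def
  proof (rule integral_cong_AE)
    show "(\<lambda>y. indicator {y. t < norm y} y *\<^sub>R (\<Omega> y / norm y ^ CARD('n) * f (x - y))) \<in> borel_measurable lebesgue"
      using m1 by measurable
    show "(\<lambda>y. indicator {y. t < norm y} y * (W y * f (x - y) / norm y ^ CARD('n))) \<in> borel_measurable lebesgue"
      by (intro measurable_completion) (use m in simp)
    show "AE y in lebesgue. indicator {y. t < norm y} y *\<^sub>R (\<Omega> y / norm y ^ CARD('n) * f (x - y))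
       = indicator {y. t < norm y} y * (W y * f (x - y) / norm y ^ CARD('n))"
      by (rule AE_completion) (use eq in \<open>eventually_elim, simp\<close>)
  qed
  also have "\<dots> = trunc_borel W t f x"
    unfolding trunc_borel_def by (rule integral_completion) (use m in simp)
  finally show ?thesis .
qed

lemma trunc_borel_integrable:
  fixes W f :: "real ^ 'n \<Rightarrow> real"
  assumes n: "2 \<le> CARD('n)" and W: "rough_borel W A" and f: "C1c f" and t: "0 < t"
  shows "integrable lborel (\<lambda>y. indicator {y. t < norm y} y * (W y * f (x - y) / norm y ^ CARD('n)))"
proof -
  have [measurable]: "W \<in> borel_measurable borel" by (rule rough_borel_measurable[OF W])
  have [measurable]: "f \<in> borel_measurable borel" using f by (simp add: C1c_def C1_measurable)
  have "integrable lborel (\<lambda>y. (1 / t ^ CARD('n)) * (W y * f (x - y)))"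
    using rough_times_integrable[OF n W f] by (rule integrable_mult_right)
  then show ?thesis
  proof (rule Bochner_Integration.integrable_bound)
    have "norm (indicator {y. t < norm y} y * (W y * f (x - y) / norm y ^ CARD('n))) \<le> norm ((1 / t ^ CARD('n)) * (W y * f (x - y)))" for y
    proof (cases "t < norm y")
      case True
      then have "0 < norm y" using t by linarith
      then show ?thesis using True t
        by (auto simp: abs_mult intro!: divide_left_mono power_mono mult_pos_pos zero_less_power)
    qed simp
    then show "AE y in lborel. norm (indicator {y. t < norm y} y * (W y * f (x - y) / norm y ^ CARD('n))) \<le> norm ((1 / t ^ CARD('n)) * (W y * f (x - y)))"
      by (intro always_eventually allI)
  qed measurable
qed

lemma trunc_borel_diff:
  fixes W f g :: "real ^ 'n \<Rightarrow> real"
  assumes n: "2 \<le> CARD('n)" and W: "rough_borel W A" and f: "C1c f" and g: "C1c g" and t: "0 < t"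
  shows "trunc_borel W t (\<lambda>y. f y - g y) x = trunc_borel W t f x - trunc_borel W t g x"
  unfolding trunc_borel_def
  by (subst Bochner_Integration.integral_diff[symmetric, OF trunc_borel_integrable[OF n W f t] trunc_borel_integrable[OF n W g t]])
    (intro Bochner_Integration.integral_cong, simp_all add: algebra_simps diff_divide_distrib)

text \<open>
  For \<open>x\<close> in a ball only a bounded part of the kernel is seen, and this part is integrable.
\<close>
lemma trunc_borel_continuous:
  fixes W f :: "real ^ 'n \<Rightarrow> real"
  assumes n: "2 \<le> CARD('n)" and W: "rough_borel W A" and f: "C1c f" and t: "0 < t"
  shows "continuous_on UNIV (trunc_borel W t f)"
proof -
  have [measurable]: "W \<in> borel_measurable borel" by (rule rough_borel_measurable[OF W])
  obtain B where B: "\<And>x. B \<le> norm x \<Longrightarrow> f x = 0" using C1c_support[OF f] by blast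
  obtain M where M: "\<And>x. \<bar>f x\<bar> \<le> M" using C1c_bounded[OF f] by blast
  have "continuous_on (ball 0 \<rho>) (trunc_borel W t f)" for \<rho>
  proof -
    let ?w = "\<lambda>y. indicator {y. t < norm y} y * (indicator (ball 0 (\<rho> + B)) y * W y / norm y ^ CARD('n))"
    have w: "integrable lborel ?w"
    proof (rule Bochner_Integration.integrable_bound)
      show "integrable lborel (\<lambda>y. (1 / t ^ CARD('n)) * (indicator (ball 0 (\<rho> + B)) y * W y))"
        using rough_borel_integrable_ball[OF n W] by (rule integrable_mult_right)
      have "norm (?w y) \<le> norm ((1 / t ^ CARD('n)) * (indicator (ball 0 (\<rho> + B)) y * W y))" for y
      proof (cases "t < norm y")
        case True
        then have "0 < norm y" using t by linarith
        then show ?thesis using True t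
          by (auto simp: abs_mult indicator_def intro!: divide_left_mono power_mono mult_pos_pos zero_less_power)
      qed simp
      then show "AE y in lborel. norm (?w y) \<le> norm ((1 / t ^ CARD('n)) * (indicator (ball 0 (\<rho> + B)) y * W y))"
        by (intro always_eventually allI)
    qed measurable
    have "continuous_on (ball 0 \<rho>) (\<lambda>x. LINT y|lborel. ?w y * f (x - y))"
      by (rule continuous_param_integral[OF w _ _ M]) (use f in \<open>auto simp: C1c_def C1_continuous\<close>)
    moreover have "(LINT y|lborel. ?w y * f (x - y)) = trunc_borel W t f x" if "x \<in> ball 0 \<rho>" for x
      unfolding trunc_borel_def
    proof (rule Bochner_Integration.integral_cong[OF refl])
      fix y
      have "f (x - y) = 0" if "y \<notin> ball 0 (\<rho> + B)"
      proof (rule B)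
        have "\<rho> + B \<le> norm y" "norm x < \<rho>" using that \<open>x \<in> ball 0 \<rho>\<close> by auto
        then show "B \<le> norm (x - y)" using norm_triangle_ineq2[of y x] by (simp add: norm_minus_commute)
      qed
      then show "?w y * f (x - y) = indicator {y. t < norm y} y * (W y * f (x - y) / norm y ^ CARD('n))"
        by (auto simp: indicator_def)
    qed
    ultimately show ?thesis by (rule continuous_on_eq)
  qed
  then have "continuous_on (\<Union>\<rho>. ball 0 \<rho>) (trunc_borel W t f)" by (intro continuous_on_open_UN) auto
  also have "(\<Union>\<rho>. ball (0::real^'n) \<rho>) = UNIV"
  proof (intro equalityI subsetI UNIV_I)
    fix x :: "real^'n"
    show "x \<in> (\<Union>\<rho>. ball 0 \<rho>)" by (intro UN_I[of "norm x + 1"]) auto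
  qed
  finally show ?thesis .
qed

text \<open>
  The integrand in \<open>r\<close> of the truncation identity. The value \<open>t = 0\<close> stands for the principal value.
\<close>
definition radial_density :: "(real ^ 'n \<Rightarrow> real) \<Rightarrow> (real ^ 'n \<Rightarrow> real) \<Rightarrow> real ^ 'n \<Rightarrow> real \<Rightarrow> real \<Rightarrow> real" where
  "radial_density W f x t r = indicator {t<..} r * (real CARD('n) / r ^ Suc CARD('n)) * annulus_integral W f x t r"

text \<open>
  A majorant of the radial density that does not depend on the truncation, with integral at most
  \<open>C I\<^sub>1|\<nabla>f|\<close>. It bounds all truncations and also justifies the passage to the limit.
\<close>
definition radial_majorant :: "real \<Rightarrow> (real ^ 'n \<Rightarrow> real) \<Rightarrow> real ^ 'n \<Rightarrow> real \<Rightarrow> ennreal" where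
  "radial_majorant A f x r = ennreal (CARD('n) * ((1 + A) * oscillation_const CARD('n))) *
     (ennreal (1 / r ^ CARD('n)) * (\<integral>\<^sup>+z\<in>ball x (2 * r). grad_abs f z \<partial>lborel) * indicator {0<..} r)"

lemma oscillation_const_nonneg: "0 \<le> oscillation_const n"
  by (simp add: oscillation_const_def lorentz_const_nonneg)

lemma radial_density_bound:
  fixes W f :: "real ^ 'n \<Rightarrow> real"
  assumes n: "2 \<le> CARD('n)" and W: "rough_borel W A" and bal: "balanced W" and f: "C1c f" and t: "0 \<le> t"
  shows "ennreal \<bar>radial_density W f x t r\<bar> \<le> radial_majorant A f x r"
proof (cases "t < r")
  case True
  then have r: "0 < r" using t by linarith
  have A: "0 \<le> A" using W by (simp add: rough_borel_def)
  let ?n = "real CARD('n)" and ?o = "oscillation_const CARD('n)"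
  let ?G = "\<integral>\<^sup>+z\<in>ball x (2 * r). grad_abs f z \<partial>lborel"
  have "ennreal \<bar>radial_density W f x t r\<bar> = ennreal (?n / r ^ Suc CARD('n)) * ennreal \<bar>annulus_integral W f x t r\<bar>"
  proof -
    have "\<bar>radial_density W f x t r\<bar> = ?n / r ^ Suc CARD('n) * \<bar>annulus_integral W f x t r\<bar>"
      using True r by (simp add: radial_density_def abs_mult del: power_Suc)
    then show ?thesis using r by (simp only:) (rule ennreal_mult', simp)
  qed
  also have "\<dots> \<le> ennreal (?n / r ^ Suc CARD('n)) * (ennreal ((1 + A) * r) * (ennreal ?o * ?G))"
    by (intro mult_left_mono annulus_integral_bound n W bal t r f) simp
  also have "\<dots> = (ennreal (?n / r ^ Suc CARD('n)) * (ennreal ((1 + A) * r) * ennreal ?o)) * ?G"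
    by (simp only: mult.assoc)
  also have "ennreal (?n / r ^ Suc CARD('n)) * (ennreal ((1 + A) * r) * ennreal ?o) = ennreal (?n / r ^ Suc CARD('n) * ((1 + A) * r * ?o))"
  proof -
    have "ennreal ((1 + A) * r) * ennreal ?o = ennreal ((1 + A) * r * ?o)"
      by (rule ennreal_mult[symmetric]) (use A r oscillation_const_nonneg in auto)
    moreover have "ennreal (?n / r ^ Suc CARD('n)) * ennreal ((1 + A) * r * ?o) = ennreal (?n / r ^ Suc CARD('n) * ((1 + A) * r * ?o))"
      by (rule ennreal_mult[symmetric]) (use A r oscillation_const_nonneg in auto)
    ultimately show ?thesis by simp
  qed
  also have "?n / r ^ Suc CARD('n) * ((1 + A) * r * ?o) = ?n * ((1 + A) * ?o) * (1 / r ^ CARD('n))"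
    using r by simp
  also have "ennreal (?n * ((1 + A) * ?o) * (1 / r ^ CARD('n))) = ennreal (?n * ((1 + A) * ?o)) * ennreal (1 / r ^ CARD('n))"
    by (rule ennreal_mult) (use A r oscillation_const_nonneg in auto)
  finally show ?thesis using r by (simp add: radial_majorant_def mult.assoc)
qed (simp add: radial_density_def)

definition rough_const :: "nat \<Rightarrow> real \<Rightarrow> real" where
  "rough_const n A = n * ((1 + A) * oscillation_const n) * 2 ^ (n - 1)"

lemma radial_majorant_measurable[measurable]:
  fixes f :: "real ^ 'n \<Rightarrow> real"
  assumes f: "C1c f"
  shows "radial_majorant A f x \<in> borel_measurable borel"
proof -
  have [measurable]: "grad f \<in> borel_measurable borel" using f by (intro grad_measurable) (simp add: C1c_def)
  have "(\<integral>\<^sup>+z\<in>ball x (2 * r). grad_abs f z \<partial>lborel) = (\<integral>\<^sup>+z. (if dist x z < 2 * r then grad_abs f z else 0) \<partial>lborel)" for r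
    by (intro nn_integral_cong) (simp add: indicator_def)
  then show ?thesis unfolding radial_majorant_def[abs_def] by simp
qed

lemma nn_integral_radial_majorant:
  fixes f :: "real ^ 'n \<Rightarrow> real"
  assumes n: "2 \<le> CARD('n)" and A: "0 \<le> A" and f: "C1c f"
  shows "(\<integral>\<^sup>+r. radial_majorant A f x r \<partial>lborel) \<le> ennreal (rough_const CARD('n) A * grad_potential f x)"
proof -
  let ?K = "CARD('n) * ((1 + A) * oscillation_const CARD('n))"
  have K: "0 \<le> ?K" using A oscillation_const_nonneg by simp
  have [measurable]: "grad f \<in> borel_measurable borel" using f by (intro grad_measurable) (simp add: C1c_def)
  have "(\<integral>\<^sup>+z\<in>ball x (2 * r). grad_abs f z \<partial>lborel) = (\<integral>\<^sup>+z. (if dist x z < 2 * r then grad_abs f z else 0) \<partial>lborel)" for r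
    by (intro nn_integral_cong) (simp add: indicator_def)
  then have m: "(\<lambda>r. ennreal (1 / r ^ CARD('n)) * (\<integral>\<^sup>+z\<in>ball x (2 * r). grad_abs f z \<partial>lborel) * indicator {0<..} r) \<in> borel_measurable lborel"
    by simp
  have "(\<integral>\<^sup>+r. radial_majorant A f x r \<partial>lborel) = ennreal ?K * (\<integral>\<^sup>+r\<in>{0<..}. ennreal (1 / r ^ CARD('n)) * (\<integral>\<^sup>+z\<in>ball x (2 * r). grad_abs f z \<partial>lborel) \<partial>lborel)"
    unfolding radial_majorant_def by (rule nn_integral_cmult[OF m])
  also have "\<dots> \<le> ennreal ?K * (ennreal (2 ^ (CARD('n) - 1)) * riesz (grad_abs f) x)"
    by (intro mult_left_mono nn_integral_all_scales n) auto
  also have "\<dots> = ennreal (?K * 2 ^ (CARD('n) - 1) * grad_potential f x)"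
    unfolding ennreal_grad_potential[OF f, symmetric] mult.assoc[of ?K]
    by (subst ennreal_mult'[OF K], subst ennreal_mult') auto
  finally show ?thesis by (simp add: rough_const_def)
qed

lemma annulus_integral_measurable:
  fixes W f :: "real ^ 'n \<Rightarrow> real"
  assumes [measurable]: "W \<in> borel_measurable borel" "f \<in> borel_measurable borel"
  shows "annulus_integral W f x t \<in> borel_measurable borel"
proof -
  have "(LINT y|lborel. indicator {y. t < norm y \<and> norm y < r} y * (W y * f (x - y)))
     = (LINT y|lborel. (if t < norm y \<and> norm y < r then W y * f (x - y) else 0))" for r
    by (intro Bochner_Integration.integral_cong) (auto simp: indicator_def)
  then show ?thesis unfolding annulus_integral_def[abs_def] by simp
qed

lemma radial_density_measurable:
  fixes W f :: "real ^ 'n \<Rightarrow> real"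
  assumes "W \<in> borel_measurable borel" "f \<in> borel_measurable borel"
  shows "radial_density W f x t \<in> borel_measurable borel"
proof -
  note [measurable] = annulus_integral_measurable[OF assms]
  show ?thesis unfolding radial_density_def[abs_def] by measurable
qed

lemma trunc_borel_radial:
  fixes W f :: "real ^ 'n \<Rightarrow> real"
  assumes n: "2 \<le> CARD('n)" and W: "rough_borel W A" and f: "C1c f" and t: "0 < t"
  shows "trunc_borel W t f x = (LINT r|lborel. radial_density W f x t r)"
  unfolding trunc_borel_def radial_density_def annulus_integral_def
  by (rule truncation_identity[OF rough_times_integrable[OF n W f] t]) (use n in simp)

lemma radial_density_integrable:
  fixes W f :: "real ^ 'n \<Rightarrow> real"
  assumes n: "2 \<le> CARD('n)" and W: "rough_borel W A" and bal: "balanced W" and f: "C1c f" and t: "0 \<le> t"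
  shows "integrable lborel (radial_density W f x t)"
    and "\<bar>LINT r|lborel. radial_density W f x t r\<bar> \<le> rough_const CARD('n) A * grad_potential f x"
proof -
  have A: "0 \<le> A" using W by (simp add: rough_borel_def)
  have "(\<integral>\<^sup>+r. ennreal (norm (radial_density W f x t r)) \<partial>lborel) \<le> (\<integral>\<^sup>+r. radial_majorant A f x r \<partial>lborel)"
    using radial_density_bound[OF n W bal f t] by (intro nn_integral_mono) simp
  also note nn_integral_radial_majorant[OF n A f]
  finally have *: "(\<integral>\<^sup>+r. ennreal (norm (radial_density W f x t r)) \<partial>lborel) \<le> ennreal (rough_const CARD('n) A * grad_potential f x)" .
  have "radial_density W f x t \<in> borel_measurable borel"
    by (rule radial_density_measurable[OF rough_borel_measurable[OF W]]) (use f in \<open>simp add: C1c_def C1_measurable\<close>)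
  then show int: "integrable lborel (radial_density W f x t)"
    using le_less_trans[OF * ennreal_less_top] by (intro integrableI_bounded) auto
  have "0 \<le> rough_const CARD('n) A * grad_potential f x"
    using A by (simp add: rough_const_def grad_potential_nonneg oscillation_const_nonneg)
  moreover have "ennreal \<bar>LINT r|lborel. radial_density W f x t r\<bar> \<le> ennreal (rough_const CARD('n) A * grad_potential f x)"
    using integral_norm_bound_ennreal[OF int] * by simp
  ultimately show "\<bar>LINT r|lborel. radial_density W f x t r\<bar> \<le> rough_const CARD('n) A * grad_potential f x"
    by (simp add: ennreal_le_iff)
qed

lemma trunc_borel_bound:
  fixes W f :: "real ^ 'n \<Rightarrow> real"
  assumes n: "2 \<le> CARD('n)" and W: "rough_borel W A" and bal: "balanced W" and f: "C1c f" and t: "0 < t"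
  shows "\<bar>trunc_borel W t f x\<bar> \<le> rough_const CARD('n) A * grad_potential f x"
  unfolding trunc_borel_radial[OF n W f t] using t by (intro radial_density_integrable(2)[OF n W bal f]) simp

definition principal_value :: "(real ^ 'n \<Rightarrow> real) \<Rightarrow> (real ^ 'n \<Rightarrow> real) \<Rightarrow> real ^ 'n \<Rightarrow> real" where
  "principal_value W f x = (LINT r|lborel. radial_density W f x 0 r)"

text \<open>
  Dominated convergence twice, in \<open>y\<close> for the annuli and then in \<open>r\<close>.
\<close>
lemma trunc_borel_tendsto:
  fixes W f :: "real ^ 'n \<Rightarrow> real"
  assumes n: "2 \<le> CARD('n)" and W: "rough_borel W A" and bal: "balanced W" and f: "C1c f"
  shows "((\<lambda>t. trunc_borel W t f x) \<longlongrightarrow> principal_value W f x) (at_right 0)"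
proof (rule tendsto_at_right_sequentially[of 0 1])
  fix S :: "nat \<Rightarrow> real"
  assume S0: "\<And>k. 0 < S k" and S: "S \<longlonglongrightarrow> 0"
  have A: "0 \<le> A" using W by (simp add: rough_borel_def)
  have [measurable]: "W \<in> borel_measurable borel" by (rule rough_borel_measurable[OF W])
  have [measurable]: "f \<in> borel_measurable borel" using f by (simp add: C1c_def C1_measurable)
  have [measurable]: "grad f \<in> borel_measurable borel" using f by (intro grad_measurable) (simp add: C1c_def)
  have rd[measurable]: "radial_density W f x t \<in> borel_measurable borel" for t by (rule radial_density_measurable) measurable
  have rm[measurable]: "radial_majorant A f x \<in> borel_measurable borel" by (rule radial_majorant_measurable[OF f])
  have fin: "radial_majorant A f x r < \<infinity>" for r
  proof (cases "0 < r")
    case True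
    have "(\<integral>\<^sup>+z\<in>ball x (2 * r). grad_abs f z \<partial>lborel) \<le> ennreal ((2 * r) ^ (CARD('n) - 1)) * riesz (grad_abs f) x"
      by (rule nn_integral_ball_le_riesz) (use True in auto)
    also have "\<dots> < \<infinity>" using riesz_grad_finite[OF f, of x] by (simp add: ennreal_mult_less_top)
    finally show ?thesis using True by (simp add: radial_majorant_def ennreal_mult_less_top)
  qed (simp add: radial_majorant_def)
  have ann: "(\<lambda>k. annulus_integral W f x (S k) r) \<longlonglongrightarrow> annulus_integral W f x 0 r" for r
    unfolding annulus_integral_def
  proof (rule integral_dominated_convergence[where w = "\<lambda>y. \<bar>W y * f (x - y)\<bar>"])
    show "integrable lborel (\<lambda>y. \<bar>W y * f (x - y)\<bar>)" using rough_times_integrable[OF n W f] by (rule integrable_abs)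
    show "AE y in lborel. norm (indicator {y. S k < norm y \<and> norm y < r} y * (W y * f (x - y))) \<le> \<bar>W y * f (x - y)\<bar>" for k
      by (intro always_eventually allI) (simp add: indicator_def)
    have "(\<lambda>k. indicator {y. S k < norm y \<and> norm y < r} y * (W y * f (x - y))) \<longlonglongrightarrow> indicator {y. 0 < norm y \<and> norm y < r} y * (W y * f (x - y))" for y
    proof (cases "y = 0")
      case True
      have z: "indicator {y. S k < norm y \<and> norm y < r} y = (0 :: real)" for k
        using True S0[of k] by (simp add: indicator_def)
      show ?thesis unfolding z by (simp add: True)
    next
      case False
      then have "eventually (\<lambda>k. S k < norm y) sequentially" by (intro order_tendstoD[OF S]) simp
      then have "eventually (\<lambda>k. indicator {y. S k < norm y \<and> norm y < r} y * (W y * f (x - y))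
          = indicator {y. 0 < norm y \<and> norm y < r} y * (W y * f (x - y))) sequentially"
        by eventually_elim (use False in \<open>simp add: indicator_def\<close>)
      then show ?thesis by (rule tendsto_eventually)
    qed
    then show "AE y in lborel. (\<lambda>k. indicator {y. S k < norm y \<and> norm y < r} y * (W y * f (x - y))) \<longlonglongrightarrow> indicator {y. 0 < norm y \<and> norm y < r} y * (W y * f (x - y))"
      by (intro always_eventually allI)
  qed measurable
  have "(\<lambda>k. LINT r|lborel. radial_density W f x (S k) r) \<longlonglongrightarrow> (LINT r|lborel. radial_density W f x 0 r)"
  proof (rule integral_dominated_convergence[where w = "\<lambda>r. enn2real (radial_majorant A f x r)"])
    have "(\<integral>\<^sup>+r. ennreal (norm (enn2real (radial_majorant A f x r))) \<partial>lborel) = (\<integral>\<^sup>+r. radial_majorant A f x r \<partial>lborel)"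
      using fin by (intro nn_integral_cong) (simp add: less_top)
    also have "\<dots> < \<infinity>" using le_less_trans[OF nn_integral_radial_majorant[OF n A f] ennreal_less_top] by simp
    finally show "integrable lborel (\<lambda>r. enn2real (radial_majorant A f x r))" by (intro integrableI_bounded) auto
    show "AE r in lborel. norm (radial_density W f x (S k) r) \<le> enn2real (radial_majorant A f x r)" for k
    proof (intro always_eventually allI)
      fix r
      have "ennreal \<bar>radial_density W f x (S k) r\<bar> \<le> radial_majorant A f x r"
        using S0[of k] by (intro radial_density_bound[OF n W bal f]) simp
      also have "\<dots> = ennreal (enn2real (radial_majorant A f x r))" using fin[of r] by (simp add: less_top)
      finally show "norm (radial_density W f x (S k) r) \<le> enn2real (radial_majorant A f x r)" by simp
    qed
    have "(\<lambda>k. radial_density W f x (S k) r) \<longlonglongrightarrow> radial_density W f x 0 r" for r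
    proof (cases "0 < r")
      case True
      then have "eventually (\<lambda>k. S k < r) sequentially" by (intro order_tendstoD[OF S]) simp
      then have "eventually (\<lambda>k. (real CARD('n) / r ^ Suc CARD('n)) * annulus_integral W f x (S k) r = radial_density W f x (S k) r) sequentially"
        by eventually_elim (simp add: radial_density_def)
      moreover have "(\<lambda>k. (real CARD('n) / r ^ Suc CARD('n)) * annulus_integral W f x (S k) r) \<longlonglongrightarrow> (real CARD('n) / r ^ Suc CARD('n)) * annulus_integral W f x 0 r"
        by (intro tendsto_mult_left ann)
      ultimately show ?thesis using True by (simp add: radial_density_def Lim_transform_eventually)
    next
      case False
      then have "\<not> S k < r" for k using S0[of k] by linarith
      then show ?thesis using False by (simp add: radial_density_def)
    qed
    then show "AE r in lborel. (\<lambda>k. radial_density W f x (S k) r) \<longlonglongrightarrow> radial_density W f x 0 r"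
      by (intro always_eventually allI)
  qed (use rd in auto)
  then show "(\<lambda>k. trunc_borel W (S k) f x) \<longlonglongrightarrow> principal_value W f x"
    unfolding principal_value_def using trunc_borel_radial[OF n W f S0] by simp
qed simp

section \<open>Rough operators\<close>

lemma controlled_max_sing_rough:
  fixes \<Omega> :: "real ^ 'n \<Rightarrow> real"
  assumes n: "2 \<le> CARD('n)" and \<Omega>: "rough_kernel \<Omega>" "mean_zero \<Omega>"
  shows "controlled_by_riesz (max_sing_rough \<Omega>)"
proof -
  obtain W A where W: "rough_borel W A" and eq: "AE y in lborel. \<Omega> y = W y" and bal: "balanced W"
    using rough_kernel_borel[OF \<Omega>(1)] \<Omega>(2) by blast
  have A: "0 \<le> A" using W by (simp add: rough_borel_def)
  show ?thesis
  proof (rule controlled_by_riesz_SUP[where C = "rough_const CARD('n) A" and S = "\<lambda>t f x. \<bar>trunc_borel W t f x\<bar>"])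
    show "0 \<le> rough_const CARD('n) A" using A by (simp add: rough_const_def oscillation_const_nonneg)
    fix f g :: "real^'n \<Rightarrow> real" and x
    show "0 \<le> max_sing_rough \<Omega> f x" unfolding max_sing_rough_def by (intro SUP_upper2[of 1]) auto
    assume f: "C1c f"
    show "max_sing_rough \<Omega> f x = (SUP t\<in>{0<..}. ereal \<bar>trunc_borel W t f x\<bar>)"
      unfolding max_sing_rough_def truncated_eq[OF rough_borel_measurable[OF W] eq f] ..
    fix t :: real assume t: "0 < t"
    show "continuous_on UNIV (\<lambda>x. \<bar>trunc_borel W t f x\<bar>)"
      using trunc_borel_continuous[OF n W f t] by (intro continuous_intros)
    show "\<bar>trunc_borel W t f x\<bar> \<le> rough_const CARD('n) A * grad_potential f x"
      by (rule trunc_borel_bound[OF n W bal f t])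
    assume g: "C1c g"
    show "\<bar>trunc_borel W t f x\<bar> \<le> \<bar>trunc_borel W t g x\<bar> + \<bar>trunc_borel W t (\<lambda>y. f y - g y) x\<bar>"
      using trunc_borel_diff[OF n W f g t, of x] by simp
  qed
qed

lemma controlled_sing_rough:
  fixes \<Omega> :: "real ^ 'n \<Rightarrow> real"
  assumes n: "2 \<le> CARD('n)" and \<Omega>: "rough_kernel \<Omega>" "mean_zero \<Omega>"
  shows "controlled_by_riesz (sing_rough \<Omega>)"
proof -
  obtain W A where W: "rough_borel W A" and eq: "AE y in lborel. \<Omega> y = W y" and bal: "balanced W"
    using rough_kernel_borel[OF \<Omega>(1)] \<Omega>(2) by blast
  have A: "0 \<le> A" using W by (simp add: rough_borel_def)
  have T: "sing_rough \<Omega> f x = ereal (principal_value W f x)" if f: "C1c f" for f x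
    unfolding sing_rough_def truncated_eq[OF rough_borel_measurable[OF W] eq f]
    using tendsto_Lim[OF trivial_limit_at_right_real trunc_borel_tendsto[OF n W bal f]] by simp
  have bound: "\<bar>principal_value W f x\<bar> \<le> rough_const CARD('n) A * grad_potential f x" if f: "C1c f" for f x
    unfolding principal_value_def by (rule radial_density_integrable(2)[OF n W bal f]) simp
  have diff: "principal_value W f x - principal_value W g x = principal_value W (\<lambda>y. f y - g y) x"
    if f: "C1c f" and g: "C1c g" for f g x
  proof (rule tendsto_unique[OF trivial_limit_at_right_real])
    show "((\<lambda>t. trunc_borel W t f x - trunc_borel W t g x) \<longlongrightarrow> principal_value W f x - principal_value W g x) (at_right 0)"
      by (intro tendsto_diff trunc_borel_tendsto[OF n W bal] f g)
    have "eventually (\<lambda>t::real. 0 < t) (at_right 0)" by (simp add: eventually_at_filter)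
    then have "eventually (\<lambda>t. trunc_borel W t (\<lambda>y. f y - g y) x = trunc_borel W t f x - trunc_borel W t g x) (at_right 0)"
      by eventually_elim (rule trunc_borel_diff[OF n W f g])
    with trunc_borel_tendsto[OF n W bal C1c_diff[OF f g]]
    show "((\<lambda>t. trunc_borel W t f x - trunc_borel W t g x) \<longlongrightarrow> principal_value W (\<lambda>y. f y - g y) x) (at_right 0)"
      by (rule Lim_transform_eventually)
  qed
  show ?thesis
  proof (rule controlled_by_rieszI_Lipschitz)
    show "0 \<le> rough_const CARD('n) A" using A by (simp add: rough_const_def oscillation_const_nonneg)
    fix f g :: "real^'n \<Rightarrow> real" and x
    assume f: "C1c f"
    have "principal_value W f \<in> borel_measurable borel"
    proof (rule borel_measurable_LIMSEQ_real)
      fix x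
      have "filterlim (\<lambda>k. inverse (real (Suc k))) (at_right 0) sequentially"
        using LIMSEQ_inverse_real_of_nat unfolding filterlim_at by (auto simp del: of_nat_Suc)
      then show "(\<lambda>k. trunc_borel W (inverse (real (Suc k))) f x) \<longlonglongrightarrow> principal_value W f x"
        by (rule filterlim_compose[OF trunc_borel_tendsto[OF n W bal f]])
      show "trunc_borel W (inverse (real (Suc k))) f \<in> borel_measurable borel" for k
        by (intro borel_measurable_continuous_onI trunc_borel_continuous[OF n W f]) simp
    qed
    moreover have "sing_rough \<Omega> f = (\<lambda>x. ereal (principal_value W f x))" using T[OF f] by auto
    ultimately show "sing_rough \<Omega> f \<in> borel_measurable borel" by simp
    show "\<bar>sing_rough \<Omega> f x\<bar> \<le> ereal (rough_const CARD('n) A * grad_potential f x)"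
      using bound[OF f] by (simp add: T[OF f])
    assume g: "C1c g"
    show "\<bar>sing_rough \<Omega> f x - sing_rough \<Omega> g x\<bar> \<le> ereal (rough_const CARD('n) A * grad_potential (\<lambda>y. f y - g y) x)"
      using bound[OF C1c_diff[OF f g], of x] diff[OF f g, of x] by (simp add: T[OF f] T[OF g])
  qed
qed

lemma enn2ereal_SUP:
  assumes "I \<noteq> {}"
  shows "enn2ereal (SUP i\<in>I. f i) = (SUP i\<in>I. enn2ereal (f i))"
proof -
  obtain i where "i \<in> I" using assms by blast
  then have "0 \<le> (SUP i\<in>I. enn2ereal (f i))" by (rule SUP_upper2) simp
  then show ?thesis by (simp add: Sup_ennreal.rep_eq image_image sup_absorb2)
qed

definition rough_average :: "(real ^ 'n \<Rightarrow> real) \<Rightarrow> real \<Rightarrow> (real ^ 'n \<Rightarrow> real) \<Rightarrow> real ^ 'n \<Rightarrow> real" where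
  "rough_average W t f x = (LINT y|lborel. \<bar>indicator (ball 0 t) y * W y\<bar> * \<bar>f (x - y)\<bar>) / t ^ CARD('n)"

lemma controlled_max_rough:
  fixes \<Omega> :: "real ^ 'n \<Rightarrow> real"
  assumes n: "2 \<le> CARD('n)" and \<Omega>: "rough_kernel \<Omega>"
  shows "controlled_by_riesz (max_rough \<Omega>)"
proof -
  obtain W A where W: "rough_borel W A" and eq: "AE y in lborel. \<Omega> y = W y"
    using rough_kernel_borel[OF \<Omega>(1)] by blast
  have A: "0 \<le> A" using W by (simp add: rough_borel_def)
  have [measurable]: "W \<in> borel_measurable borel" by (rule rough_borel_measurable[OF W])
  let ?C = "(1 + A) * local_const CARD('n)"
  have int: "integrable lborel (\<lambda>y. \<bar>indicator (ball 0 t) y * W y\<bar> * \<bar>f (x - y)\<bar>)" if f: "C1c f" for f t x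
  proof (rule Bochner_Integration.integrable_bound[OF rough_times_integrable[OF n W f, of x]])
    have [measurable]: "f \<in> borel_measurable borel" using f by (simp add: C1c_def C1_measurable)
    show "(\<lambda>y. \<bar>indicator (ball 0 t) y * W y\<bar> * \<bar>f (x - y)\<bar>) \<in> borel_measurable lborel" by measurable
    show "AE y in lborel. norm (\<bar>indicator (ball 0 t) y * W y\<bar> * \<bar>f (x - y)\<bar>) \<le> norm (W y * f (x - y))"
      by (intro always_eventually allI) (simp add: abs_mult indicator_def)
  qed
  have avg: "(\<integral>\<^sup>+y\<in>ball 0 t. ennreal \<bar>\<Omega> y * f (x - y)\<bar> \<partial>lebesgue) = (\<integral>\<^sup>+y\<in>ball 0 t. ennreal \<bar>W y\<bar> * ennreal \<bar>f (x - y)\<bar> \<partial>lborel)" for t f x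
    unfolding nn_integral_completion
  proof (rule nn_integral_cong_AE)
    show "AE y in lborel. ennreal \<bar>\<Omega> y * f (x - y)\<bar> * indicator (ball 0 t) y = ennreal \<bar>W y\<bar> * ennreal \<bar>f (x - y)\<bar> * indicator (ball 0 t) y"
      using eq by eventually_elim (simp add: abs_mult ennreal_mult)
  qed
  have nn: "(\<integral>\<^sup>+y\<in>ball 0 t. ennreal \<bar>W y\<bar> * ennreal \<bar>f (x - y)\<bar> \<partial>lborel) / ennreal (t ^ CARD('n)) = ennreal (rough_average W t f x)"
    if f: "C1c f" and t: "0 < t" for f t x
  proof -
    have "(\<integral>\<^sup>+y\<in>ball 0 t. ennreal \<bar>W y\<bar> * ennreal \<bar>f (x - y)\<bar> \<partial>lborel) = (\<integral>\<^sup>+y. ennreal (\<bar>indicator (ball 0 t) y * W y\<bar> * \<bar>f (x - y)\<bar>) \<partial>lborel)"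
      by (intro nn_integral_cong) (simp add: indicator_def ennreal_mult)
    also have "\<dots> = ennreal (LINT y|lborel. \<bar>indicator (ball 0 t) y * W y\<bar> * \<bar>f (x - y)\<bar>)"
      by (rule nn_integral_eq_integral[OF int[OF f]]) simp
    finally show ?thesis using t by (simp add: rough_average_def divide_ennreal)
  qed
  show ?thesis
  proof (rule controlled_by_riesz_SUP[where C = ?C and S = "rough_average W"])
    show "0 \<le> ?C" using A local_const_nonneg by simp
    fix f g :: "real^'n \<Rightarrow> real" and x
    show "0 \<le> max_rough \<Omega> f x" by (simp add: max_rough_def)
    have pos: "0 \<le> rough_average W t h x" if "0 < t" for t h using that by (simp add: rough_average_def)
    assume f: "C1c f"
    have fm[measurable]: "f \<in> borel_measurable borel" using f by (simp add: C1c_def C1_measurable)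
    have "(SUP t\<in>{0<..}. (\<integral>\<^sup>+y\<in>ball 0 t. ennreal \<bar>\<Omega> y * f (x - y)\<bar> \<partial>lebesgue) / ennreal (t ^ CARD('n)))
      = (SUP t\<in>{0<..}. ennreal (rough_average W t f x))"
      by (intro SUP_cong refl) (simp add: avg nn[OF f])
    then show "max_rough \<Omega> f x = (SUP t\<in>{0<..}. ereal (rough_average W t f x))"
      unfolding max_rough_def by (subst enn2ereal_SUP[symmetric, of "{0<..}" "\<lambda>t. ennreal (rough_average W t f x)", THEN trans[rotated]])
        (auto simp: enn2ereal_SUP pos intro!: SUP_cong)
    fix t :: real assume t: "0 < t"
    obtain M where M: "\<And>x. \<bar>f x\<bar> \<le> M" using C1c_bounded[OF f] by blast
    have "continuous_on UNIV (\<lambda>x. LINT y|lborel. \<bar>indicator (ball 0 t) y * W y\<bar> * \<bar>f (x - y)\<bar>)"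
      by (rule continuous_param_integral[where B = M and f = "\<lambda>z. \<bar>f z\<bar>"])
        (use f M rough_borel_integrable_ball[OF n W, of t] in \<open>auto simp: C1c_def C1_continuous intro!: continuous_intros\<close>)
    then show "continuous_on UNIV (rough_average W t f)"
      unfolding rough_average_def[abs_def] using t by (intro continuous_intros) auto
    show "rough_average W t f x \<le> ?C * grad_potential f x"
    proof -
      have "(\<integral>\<^sup>+y\<in>ball 0 t. ennreal \<bar>W y\<bar> * ennreal \<bar>f (x - y)\<bar> \<partial>lborel) \<le> ennreal ((1 + A) * t) * lorentz_integral (ball x t) f"
        by (rule rough_borel_hoelder[OF n W t fm])
      also have "\<dots> \<le> ennreal ((1 + A) * t) * (ennreal (local_const CARD('n) * t ^ (CARD('n) - 1)) * riesz (grad_abs f) x)"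
        unfolding lorentz_integral_def by (intro mult_left_mono C1c_lorentz_local n f t) simp
      also have "\<dots> = ennreal ((1 + A) * t * (local_const CARD('n) * t ^ (CARD('n) - 1)) * grad_potential f x)"
        unfolding ennreal_grad_potential[OF f, symmetric] mult.assoc
        using A t local_const_nonneg
        by (simp add: ennreal_mult' grad_potential_nonneg mult.assoc)
      also have "(1 + A) * t * (local_const CARD('n) * t ^ (CARD('n) - 1)) * grad_potential f x = t ^ CARD('n) * (?C * grad_potential f x)"
        by (cases "CARD('n)") (auto simp: mult_ac)
      also have "ennreal (t ^ CARD('n) * (?C * grad_potential f x)) = ennreal (t ^ CARD('n)) * ennreal (?C * grad_potential f x)"
        using t by (intro ennreal_mult') simp
      finally have "(\<integral>\<^sup>+y\<in>ball 0 t. ennreal \<bar>W y\<bar> * ennreal \<bar>f (x - y)\<bar> \<partial>lborel) / ennreal (t ^ CARD('n)) \<le> ennreal (?C * grad_potential f x)"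
        using t by (intro divide_le_posI_ennreal) auto
      then show ?thesis unfolding nn[OF f t] using A local_const_nonneg by (subst (asm) ennreal_le_iff) (auto simp: grad_potential_nonneg)
    qed
    assume g: "C1c g"
    note fg = C1c_diff[OF f g]
    have "(LINT y|lborel. \<bar>indicator (ball 0 t) y * W y\<bar> * \<bar>f (x - y)\<bar>)
      \<le> (LINT y|lborel. \<bar>indicator (ball 0 t) y * W y\<bar> * \<bar>g (x - y)\<bar> + \<bar>indicator (ball 0 t) y * W y\<bar> * \<bar>f (x - y) - g (x - y)\<bar>)"
    proof (rule integral_mono[OF int[OF f] Bochner_Integration.integrable_add[OF int[OF g] int[OF fg]]])
      fix y
      have "\<bar>f (x - y)\<bar> \<le> \<bar>g (x - y)\<bar> + \<bar>f (x - y) - g (x - y)\<bar>" by linarith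
      then show "\<bar>indicator (ball 0 t) y * W y\<bar> * \<bar>f (x - y)\<bar>
        \<le> \<bar>indicator (ball 0 t) y * W y\<bar> * \<bar>g (x - y)\<bar> + \<bar>indicator (ball 0 t) y * W y\<bar> * \<bar>f (x - y) - g (x - y)\<bar>"
        unfolding distrib_left[symmetric] by (rule mult_left_mono) simp
    qed
    also have "\<dots> = (LINT y|lborel. \<bar>indicator (ball 0 t) y * W y\<bar> * \<bar>g (x - y)\<bar>) + (LINT y|lborel. \<bar>indicator (ball 0 t) y * W y\<bar> * \<bar>f (x - y) - g (x - y)\<bar>)"
      by (rule Bochner_Integration.integral_add[OF int[OF g] int[OF fg]])
    finally show "rough_average W t f x \<le> rough_average W t g x + rough_average W t (\<lambda>y. f y - g y) x"
      unfolding rough_average_def using t by (simp add: add_divide_distrib[symmetric] divide_right_mono)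
  qed
qed

section \<open>Lebesgue and weak Lebesgue norms\<close>

lemma epowr_root_le_iff:
  assumes q: "0 < q" and a: "0 \<le> a"
  shows "epowr m (1 / q) \<le> ennreal a \<longleftrightarrow> m \<le> ennreal (a powr q)"
proof (cases m)
  case (real r)
  have "r powr (1 / q) \<le> a \<longleftrightarrow> r \<le> a powr q"
  proof
    assume "r powr (1 / q) \<le> a"
    then have "(r powr (1 / q)) powr q \<le> a powr q" using q by (intro powr_mono2) auto
    then show "r \<le> a powr q" using q real by (simp add: powr_powr)
  next
    assume "r \<le> a powr q"
    then have "r powr (1 / q) \<le> (a powr q) powr (1 / q)" using q real by (intro powr_mono2) auto
    then show "r powr (1 / q) \<le> a" using q a by (simp add: powr_powr)
  qed
  then show ?thesis using real a by (simp add: epowr_def)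
qed (simp add: epowr_def top_unique)

lemma epowr_root_scale:
  assumes q: "0 < q" and c: "0 < c"
  shows "epowr (ennreal (c powr q) * m) (1 / q) = ennreal c * epowr m (1 / q)"
proof (cases m)
  case (real r)
  have "(c powr q * r) powr (1 / q) = c * r powr (1 / q)"
    using q c real by (simp add: powr_mult powr_powr)
  then show ?thesis using real c by (simp add: epowr_def flip: ennreal_mult)
qed (use c in \<open>simp add: epowr_def ennreal_mult_top\<close>)

text \<open>
  What the argument uses of the norms \<open>L\<^sup>q\<close> and \<open>L\<^sup>q\<^sup>,\<^sup>\<infinity>\<close>. The constant \<open>2\<close> in the triangle inequality covers
  the weak norm; sharp constants in the limit are recovered from \<open>fatou\<close>.
\<close>
locale function_norm =
  fixes N :: "'a measure \<Rightarrow> ('a \<Rightarrow> ereal) \<Rightarrow> ennreal" and q :: real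
  assumes q: "1 \<le> q"
    and mono: "\<And>M F G. F \<in> borel_measurable M \<Longrightarrow> G \<in> borel_measurable M \<Longrightarrow> AE x in M. \<bar>F x\<bar> \<le> \<bar>G x\<bar> \<Longrightarrow> N M F \<le> N M G"
    and scale: "\<And>M f c. f \<in> borel_measurable M \<Longrightarrow> 0 < c \<Longrightarrow> N M (\<lambda>x. ereal (c * f x)) \<le> ennreal c * N M (\<lambda>x. ereal (f x))"
    and quasi_triangle: "\<And>M f g. f \<in> borel_measurable M \<Longrightarrow> g \<in> borel_measurable M \<Longrightarrow>
      N M (\<lambda>x. ereal (f x + g x)) \<le> 2 * (N M (\<lambda>x. ereal (f x)) + N M (\<lambda>x. ereal (g x)))"
    and chebyshev: "\<And>M f t. f \<in> borel_measurable M \<Longrightarrow> 0 < t \<Longrightarrow>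
      ennreal t * epowr (emeasure M {x\<in>space M. t < \<bar>f x\<bar>}) (1 / q) \<le> N M (\<lambda>x. ereal (f x))"
    and fatou: "\<And>M f g a. (\<And>k. f k \<in> borel_measurable M) \<Longrightarrow> g \<in> borel_measurable M \<Longrightarrow>
      AE x in M. (\<lambda>k. f k x) \<longlonglongrightarrow> g x \<Longrightarrow> 0 \<le> a \<Longrightarrow> (\<And>k. N M (\<lambda>x. ereal (f k x)) \<le> ennreal a) \<Longrightarrow>
      N M (\<lambda>x. ereal (g x)) \<le> ennreal a"

lemma epowr_ereal: "epowr (e2ennreal \<bar>ereal y\<bar>) q = ennreal (\<bar>y\<bar> powr q)"
  by (simp add: epowr_def e2ennreal_ereal)

lemma Lq_norm_real: "Lq_norm q M (\<lambda>x. ereal (f x)) = epowr (\<integral>\<^sup>+x. ennreal (\<bar>f x\<bar> powr q) \<partial>M) (1 / q)"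
  unfolding Lq_norm_def epowr_ereal ..

lemma Lq_norm_le_iff:
  assumes "0 < q" "0 \<le> a"
  shows "Lq_norm q M (\<lambda>x. ereal (f x)) \<le> ennreal a \<longleftrightarrow> (\<integral>\<^sup>+x. ennreal (\<bar>f x\<bar> powr q) \<partial>M) \<le> ennreal (a powr q)"
  unfolding Lq_norm_real by (rule epowr_root_le_iff[OF assms])

lemma powr_convex_combination:
  fixes X Y s q :: real
  assumes "0 \<le> X" "0 \<le> Y" "0 \<le> s" "s \<le> 1" "1 \<le> q"
  shows "(s * X + (1 - s) * Y) powr q \<le> s * X powr q + (1 - s) * Y powr q"
proof -
  have small: "z powr q \<le> z" if "0 \<le> z" "z \<le> 1" for z :: real
    using that assms powr_mono'[of 1 q z] by (cases "z = 0") auto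
  consider "X = 0" | "Y = 0" | "0 < X" "0 < Y" using assms by linarith
  then show ?thesis
  proof cases
    case 1
    then show ?thesis using small[of "1 - s"] assms by (simp add: powr_mult mult_right_mono)
  next
    case 2
    then show ?thesis using small[of s] assms by (simp add: powr_mult mult_right_mono)
  next
    case 3
    then show ?thesis
      using convex_onD[OF powr_convex[OF \<open>1 \<le> q\<close>], of "1 - s" X Y] assms by simp
  qed
qed

text \<open>
  Minkowski's inequality by convexity of the power: for bounds \<open>a\<close> and \<open>b\<close> of the two norms, \<open>f + g\<close> is
  \<open>a + b\<close> times a convex combination of \<open>f / a\<close> and \<open>g / b\<close>. Strict upper bounds avoid the case of norm zero.
\<close>
lemma Lq_norm_triangle:
  fixes f g :: "'a \<Rightarrow> real"
  assumes q: "1 \<le> q" and [measurable]: "f \<in> borel_measurable M" "g \<in> borel_measurable M"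
  shows "Lq_norm q M (\<lambda>x. ereal (f x + g x)) \<le> Lq_norm q M (\<lambda>x. ereal (f x)) + Lq_norm q M (\<lambda>x. ereal (g x))" (is "?L \<le> ?F + ?G")
proof (rule ennreal_le_epsilon)
  fix e :: real assume fin: "?F + ?G < top" and e: "0 < e"
  have q0: "0 < q" using q by simp
  obtain a0 b0 where ab0: "?F = ennreal a0" "0 \<le> a0" "?G = ennreal b0" "0 \<le> b0"
    using fin by (cases ?F; cases ?G) auto
  \<comment> \<open>Enlarging the norms makes both divisors positive.\<close>
  define a b where "a = a0 + e / 2" and "b = b0 + e / 2"
  have a: "0 < a" and b: "0 < b" using ab0 e by (auto simp: a_def b_def)
  have F: "(\<integral>\<^sup>+x. ennreal (\<bar>f x\<bar> powr q) \<partial>M) \<le> ennreal (a powr q)"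
    using Lq_norm_le_iff[OF q0, of a M f] ab0 a e by (simp add: a_def ennreal_leI)
  have G: "(\<integral>\<^sup>+x. ennreal (\<bar>g x\<bar> powr q) \<partial>M) \<le> ennreal (b powr q)"
    using Lq_norm_le_iff[OF q0, of b M g] ab0 b e by (simp add: b_def ennreal_leI)
  let ?s = "a / (a + b)" and ?c = "(a + b) powr q"
  have s: "0 \<le> ?s" "?s \<le> 1" "1 - ?s = b / (a + b)" using a b by (auto simp: field_simps)
  have pt: "\<bar>f x + g x\<bar> powr q \<le> ?c * ?s / a powr q * \<bar>f x\<bar> powr q + ?c * (b / (a + b)) / b powr q * \<bar>g x\<bar> powr q" for x
  proof -
    have "\<bar>f x + g x\<bar> powr q \<le> ((a + b) * (?s * (\<bar>f x\<bar> / a) + (1 - ?s) * (\<bar>g x\<bar> / b))) powr q"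
      using a b q by (intro powr_mono2) (auto simp: s(3) distrib_left)
    also have "\<dots> = ?c * (?s * (\<bar>f x\<bar> / a) + (1 - ?s) * (\<bar>g x\<bar> / b)) powr q"
      using a b s by (subst powr_mult) auto
    also have "\<dots> \<le> ?c * (?s * (\<bar>f x\<bar> / a) powr q + (1 - ?s) * (\<bar>g x\<bar> / b) powr q)"
      using a b s(1,2) q by (intro mult_left_mono powr_convex_combination) auto
    also have "\<dots> = ?c * ?s / a powr q * \<bar>f x\<bar> powr q + ?c * (b / (a + b)) / b powr q * \<bar>g x\<bar> powr q"
      unfolding s(3) using a b by (simp add: powr_divide distrib_left)
    finally show ?thesis .
  qed
  let ?c1 = "?c * ?s / a powr q" and ?c2 = "?c * (b / (a + b)) / b powr q"
  have c12: "0 \<le> ?c1" "0 \<le> ?c2" using a b by auto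
  have "(\<integral>\<^sup>+x. ennreal (\<bar>f x + g x\<bar> powr q) \<partial>M) \<le> (\<integral>\<^sup>+x. ennreal ?c1 * ennreal (\<bar>f x\<bar> powr q) + ennreal ?c2 * ennreal (\<bar>g x\<bar> powr q) \<partial>M)"
  proof (rule nn_integral_mono)
    fix x
    have "ennreal ?c1 * ennreal (\<bar>f x\<bar> powr q) = ennreal (?c1 * \<bar>f x\<bar> powr q)" "ennreal ?c2 * ennreal (\<bar>g x\<bar> powr q) = ennreal (?c2 * \<bar>g x\<bar> powr q)"
      using ennreal_mult'[OF c12(1)] ennreal_mult'[OF c12(2)] by metis+
    moreover have "ennreal (?c1 * \<bar>f x\<bar> powr q + ?c2 * \<bar>g x\<bar> powr q) = ennreal (?c1 * \<bar>f x\<bar> powr q) + ennreal (?c2 * \<bar>g x\<bar> powr q)"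
      by (rule ennreal_plus[OF mult_nonneg_nonneg[OF c12(1)] mult_nonneg_nonneg[OF c12(2)]]) auto
    ultimately show "ennreal (\<bar>f x + g x\<bar> powr q) \<le> ennreal ?c1 * ennreal (\<bar>f x\<bar> powr q) + ennreal ?c2 * ennreal (\<bar>g x\<bar> powr q)"
      using ennreal_leI[OF pt[of x]] by simp
  qed
  also have "\<dots> = ennreal ?c1 * (\<integral>\<^sup>+x. ennreal (\<bar>f x\<bar> powr q) \<partial>M) + ennreal ?c2 * (\<integral>\<^sup>+x. ennreal (\<bar>g x\<bar> powr q) \<partial>M)"
    by (subst nn_integral_add) (auto simp: nn_integral_cmult)
  also have "\<dots> \<le> ennreal ?c1 * ennreal (a powr q) + ennreal ?c2 * ennreal (b powr q)"
    by (intro add_mono mult_left_mono F G) auto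
  also have "\<dots> = ennreal (?c1 * a powr q + ?c2 * b powr q)"
  proof -
    have "ennreal ?c1 * ennreal (a powr q) = ennreal (?c1 * a powr q)" "ennreal ?c2 * ennreal (b powr q) = ennreal (?c2 * b powr q)"
      using ennreal_mult'[OF c12(1)] ennreal_mult'[OF c12(2)] by metis+
    moreover have "ennreal (?c1 * a powr q + ?c2 * b powr q) = ennreal (?c1 * a powr q) + ennreal (?c2 * b powr q)"
      by (rule ennreal_plus[OF mult_nonneg_nonneg[OF c12(1)] mult_nonneg_nonneg[OF c12(2)]]) auto
    ultimately show ?thesis by simp
  qed
  also have "?c1 * a powr q + ?c2 * b powr q = ?c * (?s + b / (a + b))"
    using a b by (simp add: distrib_left)
  also have "?s + b / (a + b) = 1" using a b by (simp add: add_divide_distrib[symmetric])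
  finally have "(\<integral>\<^sup>+x. ennreal (\<bar>f x + g x\<bar> powr q) \<partial>M) \<le> ennreal ((a + b) powr q)" by simp
  then have "?L \<le> ennreal (a + b)" 
    using Lq_norm_le_iff[OF q0, of "a + b" M "\<lambda>x. f x + g x"] a b by simp
  also have "ennreal (a + b) = ?F + ?G + ennreal e"
    using ab0 e by (simp add: a_def b_def flip: ennreal_plus)
  finally show "?L \<le> ?F + ?G + ennreal e" .
qed

lemma Lq_norm_mono:
  assumes q: "1 \<le> q" and le: "AE x in M. \<bar>F x\<bar> \<le> \<bar>G x\<bar>"
  shows "Lq_norm q M F \<le> Lq_norm q M G"
  unfolding Lq_norm_def
proof (intro epowr_mono nn_integral_mono_AE)
  show "AE x in M. epowr (e2ennreal \<bar>F x\<bar>) q \<le> epowr (e2ennreal \<bar>G x\<bar>) q"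
    using le by eventually_elim (use q in \<open>auto intro!: epowr_mono e2ennreal_mono\<close>)
qed (use q in auto)

lemma function_norm_Lq:
  assumes q: "1 \<le> q"
  shows "function_norm (Lq_norm q) q"
proof
  have q0: "0 < q" using q by simp
  show "1 \<le> q" by fact
  fix M :: "'a measure"
  show "Lq_norm q M F \<le> Lq_norm q M G" if "AE x in M. \<bar>F x\<bar> \<le> \<bar>G x\<bar>" for F G
    using q that by (rule Lq_norm_mono)
  show "Lq_norm q M (\<lambda>x. ereal (c * f x)) \<le> ennreal c * Lq_norm q M (\<lambda>x. ereal (f x))"
    if [measurable]: "f \<in> borel_measurable M" and c: "0 < c" for f :: "'a \<Rightarrow> real" and c
  proof -
    have "(\<integral>\<^sup>+x. ennreal (\<bar>c * f x\<bar> powr q) \<partial>M) = ennreal (c powr q) * (\<integral>\<^sup>+x. ennreal (\<bar>f x\<bar> powr q) \<partial>M)"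
      using c by (subst nn_integral_cmult[symmetric]) (auto simp: abs_mult powr_mult ennreal_mult)
    then show ?thesis unfolding Lq_norm_real using epowr_root_scale[OF q0 c] by simp
  qed
  show "Lq_norm q M (\<lambda>x. ereal (f x + g x)) \<le> 2 * (Lq_norm q M (\<lambda>x. ereal (f x)) + Lq_norm q M (\<lambda>x. ereal (g x)))"
    if "f \<in> borel_measurable M" "g \<in> borel_measurable M" for f g :: "'a \<Rightarrow> real"
  proof -
    note Lq_norm_triangle[OF q that]
    also have "X \<le> 2 * X" for X :: ennreal using mult_right_mono[of 1 2 X] by simp
    finally show ?thesis .
  qed
  show "ennreal t * epowr (emeasure M {x\<in>space M. t < \<bar>f x\<bar>}) (1 / q) \<le> Lq_norm q M (\<lambda>x. ereal (f x))"
    if [measurable]: "f \<in> borel_measurable M" and t: "0 < t" for f :: "'a \<Rightarrow> real" and t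
  proof -
    have "ennreal (t powr q) * emeasure M {x\<in>space M. t < \<bar>f x\<bar>} = (\<integral>\<^sup>+x. ennreal (t powr q) * indicator {x\<in>space M. t < \<bar>f x\<bar>} x \<partial>M)"
      by (rule nn_integral_cmult_indicator[symmetric]) measurable
    also have "\<dots> \<le> (\<integral>\<^sup>+x. ennreal (\<bar>f x\<bar> powr q) \<partial>M)"
      using t q by (intro nn_integral_mono) (auto simp: indicator_def intro!: ennreal_leI powr_mono2)
    finally show ?thesis
      unfolding Lq_norm_real epowr_root_scale[OF q0 t, symmetric] using q by (intro epowr_mono) auto
  qed
  show "Lq_norm q M (\<lambda>x. ereal (g x)) \<le> ennreal a"
    if [measurable]: "\<And>k. f k \<in> borel_measurable M" "g \<in> borel_measurable M"
      and lim: "AE x in M. (\<lambda>k. f k x) \<longlonglongrightarrow> g x" and a: "0 \<le> a" and le: "\<And>k. Lq_norm q M (\<lambda>x. ereal (f k x)) \<le> ennreal a"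
    for f :: "nat \<Rightarrow> 'a \<Rightarrow> real" and g a
  proof -
    have le': "(\<integral>\<^sup>+x. ennreal (\<bar>f k x\<bar> powr q) \<partial>M) \<le> ennreal (a powr q)" for k
      using le[of k] Lq_norm_le_iff[OF q0 a] by blast
    have "(\<integral>\<^sup>+x. ennreal (\<bar>g x\<bar> powr q) \<partial>M) = (\<integral>\<^sup>+x. liminf (\<lambda>k. ennreal (\<bar>f k x\<bar> powr q)) \<partial>M)"
    proof (rule nn_integral_cong_AE)
      show "AE x in M. ennreal (\<bar>g x\<bar> powr q) = liminf (\<lambda>k. ennreal (\<bar>f k x\<bar> powr q))"
        using lim
      proof eventually_elim
        case (elim x)
        have "(\<lambda>k. \<bar>f k x\<bar> powr q) \<longlonglongrightarrow> \<bar>g x\<bar> powr q"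
          using q0 by (intro tendsto_powr' tendsto_rabs elim tendsto_const) auto
        then have "(\<lambda>k. ennreal (\<bar>f k x\<bar> powr q)) \<longlonglongrightarrow> ennreal (\<bar>g x\<bar> powr q)" by (rule tendsto_ennrealI)
        then show ?case by (rule lim_imp_Liminf[OF sequentially_bot, symmetric])
      qed
    qed
    also have "\<dots> \<le> liminf (\<lambda>k. \<integral>\<^sup>+x. ennreal (\<bar>f k x\<bar> powr q) \<partial>M)" by (rule nn_integral_liminf) measurable
    also have "\<dots> \<le> limsup (\<lambda>k. \<integral>\<^sup>+x. ennreal (\<bar>f k x\<bar> powr q) \<partial>M)" by (rule Liminf_le_Limsup) simp
    also have "\<dots> \<le> ennreal (a powr q)" using le' by (intro Limsup_bounded always_eventually) auto
    finally show ?thesis using Lq_norm_le_iff[OF q0 a] by blast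
  qed
qed

lemma weak_Lq_norm_ge:
  "0 < t \<Longrightarrow> ennreal t * epowr (emeasure M {x\<in>space M. ereal t < \<bar>F x\<bar>}) (1 / q) \<le> weak_Lq_norm q M F"
  unfolding weak_Lq_norm_def by (rule SUP_upper) simp

lemma weak_Lq_norm_leI:
  "(\<And>t. 0 < t \<Longrightarrow> ennreal t * epowr (emeasure M {x\<in>space M. ereal t < \<bar>F x\<bar>}) (1 / q) \<le> B) \<Longrightarrow> weak_Lq_norm q M F \<le> B"
  unfolding weak_Lq_norm_def by (rule SUP_least) simp

lemma ennreal_mult_epowr_le_iff:
  assumes q: "0 < q" and t: "0 < t" and a: "0 \<le> a"
  shows "ennreal t * epowr m (1 / q) \<le> ennreal a \<longleftrightarrow> m \<le> ennreal ((a / t) powr q)"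
proof -
  have "ennreal a = ennreal t * ennreal (a / t)" using t a by (simp flip: ennreal_mult)
  then have "ennreal t * epowr m (1 / q) \<le> ennreal a \<longleftrightarrow> epowr m (1 / q) \<le> ennreal (a / t)"
    using t by (simp add: ennreal_mult_le_mult_iff)
  also have "\<dots> \<longleftrightarrow> m \<le> ennreal ((a / t) powr q)" using t a by (intro epowr_root_le_iff q) simp
  finally show ?thesis .
qed

lemma function_norm_weak_Lq:
  assumes q: "1 \<le> q"
  shows "function_norm (weak_Lq_norm q) q"
proof
  have q0: "0 < q" using q by simp
  show "1 \<le> q" by fact
  fix M :: "'a measure"
  show "weak_Lq_norm q M F \<le> weak_Lq_norm q M G"
    if [measurable]: "F \<in> borel_measurable M" "G \<in> borel_measurable M" and le: "AE x in M. \<bar>F x\<bar> \<le> \<bar>G x\<bar>" for F G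
  proof (rule weak_Lq_norm_leI)
    fix t :: real assume t: "0 < t"
    have "emeasure M {x\<in>space M. ereal t < \<bar>F x\<bar>} \<le> emeasure M {x\<in>space M. ereal t < \<bar>G x\<bar>}"
    proof (rule emeasure_mono_AE)
      show "AE x in M. x \<in> {x\<in>space M. ereal t < \<bar>F x\<bar>} \<longrightarrow> x \<in> {x\<in>space M. ereal t < \<bar>G x\<bar>}"
        using le by eventually_elim auto
    qed measurable
    then have "ennreal t * epowr (emeasure M {x\<in>space M. ereal t < \<bar>F x\<bar>}) (1 / q)
      \<le> ennreal t * epowr (emeasure M {x\<in>space M. ereal t < \<bar>G x\<bar>}) (1 / q)"
      using q by (intro mult_left_mono epowr_mono) auto
    also have "\<dots> \<le> weak_Lq_norm q M G" using t by (rule weak_Lq_norm_ge)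
    finally show "ennreal t * epowr (emeasure M {x\<in>space M. ereal t < \<bar>F x\<bar>}) (1 / q) \<le> weak_Lq_norm q M G" .
  qed
  show "weak_Lq_norm q M (\<lambda>x. ereal (c * f x)) \<le> ennreal c * weak_Lq_norm q M (\<lambda>x. ereal (f x))"
    if c: "0 < c" for f :: "'a \<Rightarrow> real" and c
  proof (rule weak_Lq_norm_leI)
    fix t :: real assume t: "0 < t"
    have "{x\<in>space M. ereal t < \<bar>ereal (c * f x)\<bar>} = {x\<in>space M. ereal (t / c) < \<bar>ereal (f x)\<bar>}"
      using c by (auto simp: abs_mult field_simps)
    moreover have "ennreal t = ennreal c * ennreal (t / c)" using t c by (simp flip: ennreal_mult)
    ultimately show "ennreal t * epowr (emeasure M {x\<in>space M. ereal t < \<bar>ereal (c * f x)\<bar>}) (1 / q) \<le> ennreal c * weak_Lq_norm q M (\<lambda>x. ereal (f x))"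
      using t c by (simp only: mult.assoc) (intro mult_left_mono weak_Lq_norm_ge, auto)
  qed
  show "weak_Lq_norm q M (\<lambda>x. ereal (f x + g x)) \<le> 2 * (weak_Lq_norm q M (\<lambda>x. ereal (f x)) + weak_Lq_norm q M (\<lambda>x. ereal (g x)))"
    if [measurable]: "f \<in> borel_measurable M" "g \<in> borel_measurable M" for f g :: "'a \<Rightarrow> real"
  proof (rule weak_Lq_norm_leI)
    fix t :: real assume t: "0 < t"
    let ?m = "\<lambda>h. emeasure M {x\<in>space M. ereal (t / 2) < \<bar>ereal (h x)\<bar>}"
    have "emeasure M {x\<in>space M. ereal t < \<bar>ereal (f x + g x)\<bar>} \<le> emeasure M ({x\<in>space M. ereal (t / 2) < \<bar>ereal (f x)\<bar>} \<union> {x\<in>space M. ereal (t / 2) < \<bar>ereal (g x)\<bar>})"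
      by (rule emeasure_mono) auto
    also have "\<dots> \<le> ?m f + ?m g" by (rule emeasure_subadditive) auto
    finally have "epowr (emeasure M {x\<in>space M. ereal t < \<bar>ereal (f x + g x)\<bar>}) (1 / q) \<le> epowr (?m f + ?m g) (1 / q)"
      using q by (intro epowr_mono) auto
    also have "\<dots> \<le> epowr (?m f) (1 / q) + epowr (?m g) (1 / q)" using q by (intro epowr_subadditive) auto
    finally have "ennreal t * epowr (emeasure M {x\<in>space M. ereal t < \<bar>ereal (f x + g x)\<bar>}) (1 / q)
      \<le> ennreal t * (epowr (?m f) (1 / q) + epowr (?m g) (1 / q))" by (rule mult_left_mono) simp
    also have "ennreal t * (epowr (?m f) (1 / q) + epowr (?m g) (1 / q))
      = 2 * (ennreal (t / 2) * epowr (?m f) (1 / q) + ennreal (t / 2) * epowr (?m g) (1 / q))"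
    proof -
      have "ennreal t = ennreal 2 * ennreal (t / 2)" using t by (subst ennreal_mult[symmetric]) auto
      then have "ennreal t = 2 * ennreal (t / 2)" by simp
      then show ?thesis by (simp only: mult.assoc distrib_left)
    qed
    also have "\<dots> \<le> 2 * (weak_Lq_norm q M (\<lambda>x. ereal (f x)) + weak_Lq_norm q M (\<lambda>x. ereal (g x)))"
      using t by (intro mult_left_mono add_mono weak_Lq_norm_ge) auto
    finally show "ennreal t * epowr (emeasure M {x\<in>space M. ereal t < \<bar>ereal (f x + g x)\<bar>}) (1 / q)
      \<le> 2 * (weak_Lq_norm q M (\<lambda>x. ereal (f x)) + weak_Lq_norm q M (\<lambda>x. ereal (g x)))" .
  qed
  show "ennreal t * epowr (emeasure M {x\<in>space M. t < \<bar>f x\<bar>}) (1 / q) \<le> weak_Lq_norm q M (\<lambda>x. ereal (f x))"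
    if t: "0 < t" for f :: "'a \<Rightarrow> real" and t
    using weak_Lq_norm_ge[OF t, of M "\<lambda>x. ereal (f x)" q] by simp
  show "weak_Lq_norm q M (\<lambda>x. ereal (g x)) \<le> ennreal a"
    if [measurable]: "\<And>k. f k \<in> borel_measurable M" "g \<in> borel_measurable M"
      and lim: "AE x in M. (\<lambda>k. f k x) \<longlonglongrightarrow> g x" and a: "0 \<le> a" and le: "\<And>k. weak_Lq_norm q M (\<lambda>x. ereal (f k x)) \<le> ennreal a"
    for f :: "nat \<Rightarrow> 'a \<Rightarrow> real" and g a
  proof (rule weak_Lq_norm_leI)
    fix t :: real assume t: "0 < t"
    let ?S = "\<lambda>h. {x\<in>space M. ereal t < \<bar>ereal (h x)\<bar>}"
    have le': "emeasure M (?S (f k)) \<le> ennreal ((a / t) powr q)" for k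
    proof -
      have "ennreal t * epowr (emeasure M (?S (f k))) (1 / q) \<le> ennreal a" using weak_Lq_norm_ge[OF t] le[of k] by (rule order_trans)
      then show ?thesis using ennreal_mult_epowr_le_iff[OF q0 t a] by blast
    qed
    have "emeasure M (?S g) = (\<integral>\<^sup>+x. indicator (?S g) x \<partial>M)" by (rule nn_integral_indicator[symmetric]) measurable
    also have "\<dots> \<le> (\<integral>\<^sup>+x. liminf (\<lambda>k. indicator (?S (f k)) x) \<partial>M)"
    proof (rule nn_integral_mono_AE)
      show "AE x in M. (indicator (?S g) x :: ennreal) \<le> liminf (\<lambda>k. indicator (?S (f k)) x)"
        using lim
      proof eventually_elim
        case (elim x)
        show ?case
        proof (cases "x \<in> ?S g")
          case True
          have "(\<lambda>k. \<bar>f k x\<bar>) \<longlonglongrightarrow> \<bar>g x\<bar>" by (intro tendsto_rabs elim)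
          then have "eventually (\<lambda>k. t < \<bar>f k x\<bar>) sequentially" using True by (intro order_tendstoD(1)) auto
          then have "eventually (\<lambda>k. (indicator (?S g) x :: ennreal) \<le> indicator (?S (f k)) x) sequentially"
            by eventually_elim (use True in auto)
          then show ?thesis by (rule Liminf_bounded)
        qed simp
      qed
    qed
    also have "\<dots> \<le> liminf (\<lambda>k. \<integral>\<^sup>+x. indicator (?S (f k)) x \<partial>M)" by (rule nn_integral_liminf) measurable
    also have "\<dots> \<le> limsup (\<lambda>k. \<integral>\<^sup>+x. indicator (?S (f k)) x \<partial>M)" by (rule Liminf_le_Limsup) simp
    also have "\<dots> \<le> ennreal ((a / t) powr q)"
    proof (intro Limsup_bounded always_eventually allI)
      fix k
      have "(\<integral>\<^sup>+x. indicator (?S (f k)) x \<partial>M) = emeasure M (?S (f k))" by (rule nn_integral_indicator) measurable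
      with le'[of k] show "(\<integral>\<^sup>+x. indicator (?S (f k)) x \<partial>M) \<le> ennreal ((a / t) powr q)" by simp
    qed
    finally show "ennreal t * epowr (emeasure M (?S g)) (1 / q) \<le> ennreal a"
      using ennreal_mult_epowr_le_iff[OF q0 t a] by blast
  qed
qed

text \<open>
  What the argument uses of the norms \<open>L\<^sup>q\<close> and \<open>L\<^sup>q\<^sup>,\<^sup>\<infinity>\<close>. The constant \<open>2\<close> in the triangle inequality covers
  the weak norm; sharp constants in the limit are recovered from \<open>fatou\<close>.
\<close>
context function_norm
begin

text \<open>
  The exceptional sets for consecutive differences above \<open>2\<^sup>-\<^sup>k\<close> have measure at most \<open>2\<^sup>-\<^sup>k\<close>, so the
  Borel--Cantelli lemma applies.
\<close>
lemma fast_Cauchy_converges_AE: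
  fixes G :: "nat \<Rightarrow> 'a \<Rightarrow> real"
  assumes [measurable]: "\<And>k. G k \<in> borel_measurable M"
    and fast: "\<And>k. N M (\<lambda>x. ereal (G (Suc k) x - G k x)) \<le> ennreal ((1 / 4) ^ k)"
  shows "AE x in M. convergent (\<lambda>k. G k x)"
proof -
  let ?E = "\<lambda>k. {x\<in>space M. (1 / 2) ^ k < \<bar>G (Suc k) x - G k x\<bar>}"
  have q0: "0 < q" using q by simp
  have E: "emeasure M (?E k) \<le> ennreal ((1 / 2) ^ k)" for k
  proof -
    have "ennreal ((1 / 2) ^ k) * epowr (emeasure M (?E k)) (1 / q) \<le> ennreal ((1 / 4) ^ k)"
      by (rule order_trans[OF chebyshev fast]) auto
    then have "emeasure M (?E k) \<le> ennreal (((1 / 4) ^ k / (1 / 2) ^ k) powr q)"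
      by (subst (asm) ennreal_mult_epowr_le_iff[OF q0]) auto
    also have "(1 / 4) ^ k / (1 / 2) ^ k = ((1 / 2) ^ k :: real)" by (simp add: power_divide[symmetric])
    also have "((1 / 2) ^ k) powr q \<le> ((1 / 2 :: real) ^ k) powr 1"
      using q by (intro powr_mono') (auto simp: power_le_one)
    finally show ?thesis by (simp add: ennreal_leI)
  qed
  have fin: "emeasure M (?E k) < \<infinity>" for k using le_less_trans[OF E ennreal_less_top] by simp
  have "AE x in M. eventually (\<lambda>k. x \<in> space M - ?E k) sequentially"
  proof (rule borel_cantelli_AE1)
    show "summable (\<lambda>k. measure M (?E k))"
    proof (rule summable_comparison_test')
      show "summable (\<lambda>k. (1 / 2 :: real) ^ k)" by (intro summable_geometric) simp
      show "norm (measure M (?E k)) \<le> (1 / 2) ^ k" for k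
        using E[of k] fin[of k] by (simp add: emeasure_eq_ennreal_measure less_top)
    qed
  qed (use fin in auto)
  then show ?thesis
  proof eventually_elim
    case (elim x)
    have "eventually (\<lambda>k. norm (G (Suc k) x - G k x) \<le> (1 / 2) ^ k) sequentially"
      using elim by eventually_elim auto
    then have "summable (\<lambda>k. G (Suc k) x - G k x)"
      by (rule summable_comparison_test_ev) (intro summable_geometric, simp)
    then have "convergent (\<lambda>n. \<Sum>k<n. G (Suc k) x - G k x)" by (simp add: summable_iff_convergent)
    also have "(\<lambda>n. \<Sum>k<n. G (Suc k) x - G k x) = (\<lambda>n. G n x - G 0 x)" by (simp add: sum_lessThan_telescope[of "\<lambda>k. G k x"])
    finally have "convergent (\<lambda>n. (G n x - G 0 x) + G 0 x)" by (intro convergent_add convergent_const)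
    then show ?case by simp
  qed
qed

text \<open>
  The Riesz--Fischer argument. The subsequence that converges almost everywhere is kept in the conclusion, because it
  gives the sharp bound for the norm of the limit.
\<close>
lemma complete:
  fixes G :: "nat \<Rightarrow> 'a \<Rightarrow> real"
  assumes meas[measurable]: "\<And>k. G k \<in> borel_measurable M"
    and cauchy: "\<And>\<epsilon>. 0 < \<epsilon> \<Longrightarrow> \<exists>J. \<forall>i\<ge>J. \<forall>j\<ge>J. N M (\<lambda>x. ereal (G i x - G j x)) \<le> ennreal \<epsilon>"
  obtains h s where "h \<in> borel_measurable M" "strict_mono s" "AE x in M. (\<lambda>k. G (s k) x) \<longlonglongrightarrow> h x"
    "(\<lambda>j. N M (\<lambda>x. ereal (G j x - h x))) \<longlonglongrightarrow> 0"
proof -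
  have "\<exists>J. \<forall>k. \<forall>i\<ge>J k. \<forall>j\<ge>J k. N M (\<lambda>x. ereal (G i x - G j x)) \<le> ennreal ((1 / 4) ^ k)"
    by (intro choice allI cauchy) simp
  then obtain J :: "nat \<Rightarrow> nat" where J: "\<And>k i j. J k \<le> i \<Longrightarrow> J k \<le> j \<Longrightarrow> N M (\<lambda>x. ereal (G i x - G j x)) \<le> ennreal ((1 / 4) ^ k)"
    by blast
  \<comment> \<open>The summand \<open>k\<close> makes the sequence strictly increasing, the sum makes it exceed \<open>J k\<close>.\<close>
  define s where "s k = k + (\<Sum>i\<le>k. J i)" for k
  have mono_s: "strict_mono s" by (rule strict_mono_Suc_iff[THEN iffD2]) (simp add: s_def)
  have sJ: "J k \<le> s k" for k
    unfolding s_def by (rule trans_le_add2) (rule member_le_sum, auto)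
  have "AE x in M. convergent (\<lambda>k. G (s k) x)"
  proof (rule fast_Cauchy_converges_AE)
    fix k
    show "N M (\<lambda>x. ereal (G (s (Suc k)) x - G (s k) x)) \<le> ennreal ((1 / 4) ^ k)"
      using sJ[of k] strict_monoD[OF mono_s, of k "Suc k"] by (intro J) auto
  qed measurable
  then have lim: "AE x in M. (\<lambda>k. G (s k) x) \<longlonglongrightarrow> lim (\<lambda>k. G (s k) x)"
    by eventually_elim (simp add: convergent_LIMSEQ_iff)
  let ?h = "\<lambda>x. lim (\<lambda>k. G (s k) x)"
  have h[measurable]: "?h \<in> borel_measurable M" by measurable
  have "(\<lambda>j. N M (\<lambda>x. ereal (G j x - ?h x))) \<longlonglongrightarrow> 0"
  proof (rule tendsto_zero_ennreal)
    fix r :: real assume r: "0 < r"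
    then obtain J where J: "\<And>i j. J \<le> i \<Longrightarrow> J \<le> j \<Longrightarrow> N M (\<lambda>x. ereal (G i x - G j x)) \<le> ennreal (r / 2)"
      using cauchy[of "r / 2"] by auto
    have "N M (\<lambda>x. ereal (G i x - ?h x)) < ennreal r" if "J \<le> i" for i
    proof -
      have "N M (\<lambda>x. ereal (G i x - ?h x)) \<le> ennreal (r / 2)"
      proof (rule fatou[where f = "\<lambda>k x. G i x - G (s (k + J)) x"])
        show "AE x in M. (\<lambda>k. G i x - G (s (k + J)) x) \<longlonglongrightarrow> G i x - ?h x"
          using lim
        proof eventually_elim
          case (elim x)
          from LIMSEQ_ignore_initial_segment[OF elim, of J] show ?case by (intro tendsto_intros)
        qed
        show "N M (\<lambda>x. ereal (G i x - G (s (k + J)) x)) \<le> ennreal (r / 2)" for k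
          using that seq_suble[OF mono_s, of "k + J"] by (intro J) auto
      qed (use r in auto)
      also have "\<dots> < ennreal r" using r by (simp add: ennreal_less_iff)
      finally show ?thesis .
    qed
    then show "eventually (\<lambda>j. N M (\<lambda>x. ereal (G j x - ?h x)) < ennreal r) sequentially"
      unfolding eventually_sequentially by blast
  qed
  then show ?thesis by (rule that[OF h mono_s lim])
qed

end

section \<open>Gradient norms and Sobolev classes\<close>

lemma sets_weighted[simp]: "sets (weighted w) = sets lebesgue"
  by (simp add: weighted_def)

lemma borel_measurable_weighted:
  "f \<in> borel_measurable borel \<Longrightarrow> f \<in> borel_measurable (weighted w)"
  by (subst measurable_cong_sets[OF sets_weighted refl]) (intro measurable_completion, simp)

lemma weight_measurable:
  assumes "weight w" shows "w \<in> borel_measurable lebesgue"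
proof (rule borel_measurable_LIMSEQ_real)
  fix x
  show "(\<lambda>k. indicator (cball 0 (real k)) x *\<^sub>R w x) \<longlonglongrightarrow> w x"
  proof (rule tendsto_eventually)
    have "eventually (\<lambda>k. norm x \<le> real k) sequentially"
      using filterlim_real_sequentially unfolding filterlim_at_top by blast
    then show "eventually (\<lambda>k. indicator (cball 0 (real k)) x *\<^sub>R w x = w x) sequentially"
      by eventually_elim simp
  qed
  show "(\<lambda>x. indicator (cball 0 (real k)) x *\<^sub>R w x) \<in> borel_measurable lebesgue" for k
    using assms unfolding weight_def set_integrable_def by (auto intro: borel_measurable_integrable)
qed

text \<open>
  The gradient is bounded with compact support, and the weight is integrable on that support.
\<close>
lemma grad_norm_finite:
  assumes v: "weight v" and p: "1 \<le> p" and f: "C1c f"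
  shows "grad_norm p v f < \<infinity>"
proof -
  obtain B where B: "\<And>x. B \<le> norm x \<Longrightarrow> grad f x = 0" using C1c_support[OF f] by blast
  obtain M where M: "0 \<le> M" "\<And>x. norm (grad f x) \<le> M" using C1c_bounded_grad[OF f] by blast
  have [measurable]: "v \<in> borel_measurable lebesgue" by (rule weight_measurable[OF v])
  have v0: "0 \<le> v x" for x using v by (simp add: weight_def)
  have gm: "(\<lambda>x. ennreal (\<bar>norm (grad f x)\<bar> powr p)) \<in> borel_measurable lebesgue"
  proof (rule measurable_completion)
    have [measurable]: "grad f \<in> borel_measurable borel" using f by (intro grad_measurable) (simp add: C1c_def)
    show "(\<lambda>x. ennreal (\<bar>norm (grad f x)\<bar> powr p)) \<in> borel_measurable lborel" by measurable
  qed
  have int: "integrable lebesgue (\<lambda>x. indicator (cball 0 B) x * v x)"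
    using v unfolding weight_def set_integrable_def by simp
  have "(\<integral>\<^sup>+x. ennreal (\<bar>norm (grad f x)\<bar> powr p) \<partial>weighted v) = (\<integral>\<^sup>+x. ennreal (v x) * ennreal (\<bar>norm (grad f x)\<bar> powr p) \<partial>lebesgue)"
    unfolding weighted_def using gm by (intro nn_integral_density) auto
  also have "\<dots> \<le> (\<integral>\<^sup>+x. ennreal (M powr p) * ennreal (norm (indicator (cball 0 B) x * v x)) \<partial>lebesgue)"
  proof (rule nn_integral_mono)
    fix x
    show "ennreal (v x) * ennreal (\<bar>norm (grad f x)\<bar> powr p) \<le> ennreal (M powr p) * ennreal (norm (indicator (cball 0 B) x * v x))"
    proof (cases "norm x \<le> B")
      case True
      have "\<bar>norm (grad f x)\<bar> powr p \<le> M powr p" using M p by (intro powr_mono2) auto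
      then show ?thesis using True v0[of x] by (simp add: mult.commute[of "ennreal (v x)"] mult_right_mono ennreal_leI)
    qed (use B[of x] p in simp)
  qed
  also have "\<dots> = ennreal (M powr p) * (\<integral>\<^sup>+x. ennreal (norm (indicator (cball 0 B) x * v x)) \<partial>lebesgue)"
    using int by (intro nn_integral_cmult) auto
  also have "\<dots> < \<infinity>" using int by (auto simp: integrable_iff_bounded ennreal_mult_less_top)
  finally show ?thesis unfolding grad_norm_def Lq_norm_real by (auto simp: epowr_def)
qed

lemma grad_norm_measurable:
  assumes "C1c f" shows "(\<lambda>x. norm (grad f x)) \<in> borel_measurable (weighted v)"
proof (rule borel_measurable_weighted)
  have [measurable]: "grad f \<in> borel_measurable borel" using assms by (intro grad_measurable) (simp add: C1c_def)
  show "(\<lambda>x. norm (grad f x)) \<in> borel_measurable borel" by measurable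
qed

lemma C1c_grad_diff: "C1c f \<Longrightarrow> C1c g \<Longrightarrow> grad (\<lambda>x. f x - g x) = (\<lambda>x. grad f x - grad g x)"
  by (simp add: C1c_def C1_diff)

lemma grad_norm_triangle:
  fixes a b c :: "real ^ 'n \<Rightarrow> real"
  assumes p: "1 \<le> p" and "C1c a" "C1c b" "C1c c"
    and le: "\<And>x. norm (grad a x) \<le> norm (grad b x) + norm (grad c x)"
  shows "grad_norm p v a \<le> grad_norm p v b + grad_norm p v c"
proof -
  have "grad_norm p v a \<le> Lq_norm p (weighted v) (\<lambda>x. ereal (norm (grad b x) + norm (grad c x)))"
    unfolding grad_norm_def using le by (intro Lq_norm_mono p always_eventually) (auto simp: abs_of_nonneg)
  also have "\<dots> \<le> grad_norm p v b + grad_norm p v c"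
    unfolding grad_norm_def by (intro Lq_norm_triangle p grad_norm_measurable assms)
  finally show ?thesis .
qed

lemma grad_norm_diff_commute:
  "C1c f \<Longrightarrow> C1c g \<Longrightarrow> grad_norm p v (\<lambda>x. f x - g x) = grad_norm p v (\<lambda>x. g x - f x)"
  by (simp add: grad_norm_def C1c_grad_diff norm_minus_commute)

lemma grad_norm_le_diff:
  assumes "1 \<le> p" "C1c f" "C1c g"
  shows "grad_norm p v f \<le> grad_norm p v g + grad_norm p v (\<lambda>x. f x - g x)"
  using assms norm_triangle_sub
  by (intro grad_norm_triangle C1c_diff) (auto simp: C1c_grad_diff)

lemma grad_norm_diff_self:
  assumes "1 \<le> p" "C1c f" shows "grad_norm p v (\<lambda>x. f x - f x) = 0"
  using assms unfolding grad_norm_def C1c_grad_diff[OF assms(2) assms(2)] Lq_norm_real by (simp add: epowr_def)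

lemma sobolev_Cauchy_C1c: "sobolev_Cauchy p v \<phi> \<Longrightarrow> C1c (\<phi> j)"
  by (simp add: sobolev_Cauchy_def test_fun_C1c)

lemma tendsto_ennreal_Cauchy:
  fixes a :: "nat \<Rightarrow> ennreal"
  assumes fin: "\<And>i. a i < \<infinity>"
    and cauchy: "\<And>\<epsilon>. 0 < \<epsilon> \<Longrightarrow> \<exists>J. \<forall>i\<ge>J. \<forall>j\<ge>J. a i \<le> a j + ennreal \<epsilon>"
  shows "\<exists>l<\<infinity>. a \<longlonglongrightarrow> l"
proof -
  have a: "a i = ennreal (enn2real (a i))" for i using fin[of i] by (simp add: less_top)
  have "Cauchy (\<lambda>i. enn2real (a i))"
  proof (rule metric_CauchyI)
    fix e :: real assume e: "0 < e"
    then obtain J where J: "\<And>i j. J \<le> i \<Longrightarrow> J \<le> j \<Longrightarrow> a i \<le> a j + ennreal (e / 2)"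
      using cauchy[of "e / 2"] by auto
    have le: "enn2real (a i) \<le> enn2real (a j) + e / 2" if "J \<le> i" "J \<le> j" for i j
    proof -
      have "ennreal (enn2real (a i)) \<le> ennreal (enn2real (a j) + e / 2)"
        using J[OF that] e a[of i] a[of j] by (simp add: ennreal_plus)
      then show ?thesis using e by (subst (asm) ennreal_le_iff) auto
    qed
    have "dist (enn2real (a i)) (enn2real (a j)) < e" if "J \<le> i" "J \<le> j" for i j
      using le[of i j] le[of j i] that e by (simp add: dist_real_def)
    then show "\<exists>M. \<forall>m\<ge>M. \<forall>n\<ge>M. dist (enn2real (a m)) (enn2real (a n)) < e" by blast
  qed
  then obtain l where "(\<lambda>i. enn2real (a i)) \<longlonglongrightarrow> l" using Cauchy_convergent_iff convergent_def by blast
  then have "(\<lambda>i. ennreal (enn2real (a i))) \<longlonglongrightarrow> ennreal l" by (rule tendsto_ennrealI)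
  then have "a \<longlonglongrightarrow> ennreal l" using a by simp
  then show ?thesis by (intro exI[of _ "ennreal l"]) simp
qed

lemma sobolev_Cauchy_norm_limit:
  assumes v: "weight v" and p: "1 \<le> p" and \<phi>: "sobolev_Cauchy p v \<phi>"
  shows "\<exists>l<\<infinity>. (\<lambda>j. grad_norm p v (\<phi> j)) \<longlonglongrightarrow> l"
proof (rule tendsto_ennreal_Cauchy)
  note C = sobolev_Cauchy_C1c[OF \<phi>]
  show "grad_norm p v (\<phi> i) < \<infinity>" for i by (rule grad_norm_finite[OF v p C])
  fix \<epsilon> :: real assume "0 < \<epsilon>"
  then obtain J where J: "\<And>i j. J \<le> i \<Longrightarrow> J \<le> j \<Longrightarrow> grad_norm p v (\<lambda>x. \<phi> i x - \<phi> j x) < ennreal \<epsilon>"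
    using \<phi> unfolding sobolev_Cauchy_def by blast
  have "grad_norm p v (\<phi> i) \<le> grad_norm p v (\<phi> j) + ennreal \<epsilon>" if "J \<le> i" "J \<le> j" for i j
    by (rule order_trans[OF grad_norm_le_diff[OF p C C] add_left_mono[OF less_imp_le[OF J[OF that]]]])
  then show "\<exists>J. \<forall>i\<ge>J. \<forall>j\<ge>J. grad_norm p v (\<phi> i) \<le> grad_norm p v (\<phi> j) + ennreal \<epsilon>" by blast
qed

lemma sobolev_rel_limit:
  assumes v: "weight v" and p: "1 \<le> p" and rel: "(\<phi>, \<psi>) \<in> sobolev_rel p v" and lim: "(\<lambda>j. grad_norm p v (\<phi> j)) \<longlonglongrightarrow> l"
  shows "(\<lambda>j. grad_norm p v (\<psi> j)) \<longlonglongrightarrow> l"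
proof -
  have C: "C1c (\<phi> j)" "C1c (\<psi> j)" for j using rel by (auto simp: sobolev_rel_def intro: sobolev_Cauchy_C1c)
  let ?d = "\<lambda>j. grad_norm p v (\<lambda>x. \<phi> j x - \<psi> j x)"
  have d: "?d \<longlonglongrightarrow> 0" using rel by (simp add: sobolev_rel_def)
  have 1: "grad_norm p v (\<psi> j) \<le> grad_norm p v (\<phi> j) + ?d j" for j
    using grad_norm_le_diff[OF p C(2) C(1)] by (simp add: grad_norm_diff_commute[OF C(2) C(1)])
  have 2: "grad_norm p v (\<phi> j) - ?d j \<le> grad_norm p v (\<psi> j)" for j
    using grad_norm_le_diff[OF p C(1)[of j] C(2)[of j], of v] grad_norm_finite[OF v p C(1), of j]
    by (auto simp: ennreal_minus_le_iff add.commute)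
  show ?thesis
  proof (rule tendsto_sandwich)
    show "eventually (\<lambda>j. grad_norm p v (\<phi> j) - ?d j \<le> grad_norm p v (\<psi> j)) sequentially"
      by (rule always_eventually) (rule allI, rule 2)
    show "eventually (\<lambda>j. grad_norm p v (\<psi> j) \<le> grad_norm p v (\<phi> j) + ?d j) sequentially"
      by (rule always_eventually) (rule allI, rule 1)
    show "(\<lambda>j. grad_norm p v (\<phi> j) - ?d j) \<longlonglongrightarrow> l"
      using tendsto_diff_ennreal_general[OF lim d] by simp
    show "(\<lambda>j. grad_norm p v (\<phi> j) + ?d j) \<longlonglongrightarrow> l"
      using tendsto_add[OF lim d] by simp
  qed
qed

text \<open>
  Along all representatives of a class the gradient norms have the same limit, which is therefore the norm of the
  class.
\<close>
lemma sobolev_cases: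
  assumes v: "weight v" and p: "1 \<le> p" and F: "F \<in> sobolev p v"
  obtains \<phi> where "sobolev_Cauchy p v \<phi>" "\<forall>\<psi>\<in>F. (\<phi>, \<psi>) \<in> sobolev_rel p v"
    "(\<lambda>j. grad_norm p v (\<phi> j)) \<longlonglongrightarrow> sobolev_norm p v F" "sobolev_norm p v F < \<infinity>"
proof -
  obtain \<phi> where \<phi>: "sobolev_Cauchy p v \<phi>" and F_eq: "F = sobolev_rel p v `` {\<phi>}"
    using F unfolding sobolev_def by (auto elim: quotientE)
  have rel: "(\<phi>, \<psi>) \<in> sobolev_rel p v" if "\<psi> \<in> F" for \<psi> using that F_eq by auto
  have "(\<phi>, \<phi>) \<in> sobolev_rel p v"
    using \<phi> grad_norm_diff_self[OF p sobolev_Cauchy_C1c[OF \<phi>]] by (simp add: sobolev_rel_def)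
  then have \<phi>F: "\<phi> \<in> F" using F_eq by auto
  obtain l where l: "l < \<infinity>" "(\<lambda>j. grad_norm p v (\<phi> j)) \<longlonglongrightarrow> l"
    using sobolev_Cauchy_norm_limit[OF v p \<phi>] by blast
  have eq: "sobolev_norm p v F = l"
    unfolding sobolev_norm_def
  proof (rule the_equality)
    show "\<forall>\<psi>\<in>F. (\<lambda>j. grad_norm p v (\<psi> j)) \<longlonglongrightarrow> l"
      using sobolev_rel_limit[OF v p rel l(2)] by blast
    fix l' assume "\<forall>\<psi>\<in>F. (\<lambda>j. grad_norm p v (\<psi> j)) \<longlonglongrightarrow> l'"
    then show "l' = l" using \<phi>F l(2) LIMSEQ_unique by blast
  qed
  show ?thesis
  proof (rule that[OF \<phi>])
    show "\<forall>\<psi>\<in>F. (\<phi>, \<psi>) \<in> sobolev_rel p v" by (intro ballI rel)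
    show "(\<lambda>j. grad_norm p v (\<phi> j)) \<longlonglongrightarrow> sobolev_norm p v F" unfolding eq by (rule l(2))
    show "sobolev_norm p v F < \<infinity>" unfolding eq by (rule l(1))
  qed
qed

section \<open>Use of the operator norm\<close>

lemma I1_grad_eq:
  fixes f :: "real ^ 'n \<Rightarrow> real"
  assumes f: "C1c f"
  shows "I1 (\<lambda>y. norm (grad f y)) x = grad_potential f x"
proof -
  have [measurable]: "grad f \<in> borel_measurable borel" using f by (intro grad_measurable) (simp add: C1c_def)
  have m: "I1_kernel (\<lambda>y. norm (grad f y)) x \<in> borel_measurable borel" unfolding I1_kernel_def[abs_def] by measurable
  have "I1 (\<lambda>y. norm (grad f y)) x = enn2real (\<integral>\<^sup>+y. ennreal (I1_kernel (\<lambda>y. norm (grad f y)) x y) \<partial>lebesgue)"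
    unfolding I1_def
  proof (rule integral_eq_nn_integral)
    show "I1_kernel (\<lambda>y. norm (grad f y)) x \<in> borel_measurable lebesgue" by (intro measurable_completion) (use m in simp)
  qed (simp add: I1_kernel_def)
  also have "(\<integral>\<^sup>+y. ennreal (I1_kernel (\<lambda>y. norm (grad f y)) x y) \<partial>lebesgue) = riesz (grad_abs f) x"
    unfolding riesz_def nn_integral_completion
  proof (rule nn_integral_cong_AE)
    show "AE y in lborel. ennreal (I1_kernel (\<lambda>y. norm (grad f y)) x y) = grad_abs f y * riesz_kernel (x - y)"
      using AE_lborel_singleton[of x]
    proof eventually_elim
      case (elim y)
      have "ennreal (norm (grad f y) * (1 / norm (x - y) ^ (CARD('n) - 1))) = grad_abs f y * ennreal (1 / norm (x - y) ^ (CARD('n) - 1))"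
        by (rule ennreal_mult) auto
      then show ?case using elim by (subst riesz_kernel_eq) (auto simp: I1_kernel_def)
    qed
  qed
  finally show ?thesis by (simp add: grad_potential_def)
qed

lemma I1_norm_finite: "I1_bounded p v N u \<Longrightarrow> I1_norm p v N u < \<infinity>"
  unfolding I1_bounded_def I1_norm_def by (auto simp: Inf_less_iff)

text \<open>
  The bound for \<open>I\<^sub>1\<close> is tested on \<open>|\<nabla>f|\<close>. Since every admissible constant works, so does their infimum.
\<close>
lemma grad_potential_norm_le:
  assumes v: "weight v" and p: "1 \<le> p" and f: "C1c f" and bdd: "I1_bounded p v N u"
  shows "N (weighted u) (\<lambda>x. ereal (grad_potential f x)) \<le> I1_norm p v N u * grad_norm p v f"
proof -
  let ?X = "N (weighted u) (\<lambda>x. ereal (grad_potential f x))" and ?G = "grad_norm p v f"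
  have fs: "(\<lambda>x. ereal (norm (grad f x))) \<in> fun_space (Lq_norm p) (weighted v)"
    using grad_norm_finite[OF v p f] grad_norm_measurable[OF f, of v]
    unfolding fun_space_def grad_norm_def by simp
  have le: "?X \<le> ennreal A * ?G" if "I1_bound p v N u A" for A
    using that[unfolded I1_bound_def, THEN conjunct2, rule_format, OF fs, THEN conjunct2, THEN conjunct2]
    unfolding I1_grad_eq[OF f] grad_norm_def .
  show ?thesis
  proof (cases "?G = 0")
    case True
    obtain A where "I1_bound p v N u A" using bdd by (auto simp: I1_bounded_def)
    from le[OF this] True show ?thesis by simp
  next
    case False
    have fin: "?G \<noteq> top" using grad_norm_finite[OF v p f] by simp
    have "?X / ?G \<le> I1_norm p v N u"
      unfolding I1_norm_def
    proof (rule Inf_greatest)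
      fix a assume "a \<in> {ennreal A |A. I1_bound p v N u A}"
      then obtain A where A: "a = ennreal A" "I1_bound p v N u A" by blast
      show "?X / ?G \<le> a"
        using False le[OF A(2)] A(1) by (intro divide_le_posI_ennreal) (auto simp: mult.commute zero_less_iff_neq_zero)
    qed
    then have "?G * (?X / ?G) \<le> ?G * I1_norm p v N u" by (rule mult_left_mono) simp
    also have "?G * (?X / ?G) = ?X"
      unfolding ennreal_times_divide mult.commute[of ?G ?X] by (rule mult_divide_eq_ennreal[OF False fin])
    finally show ?thesis by (simp add: mult.commute)
  qed
qed

section \<open>Extension by density\<close>

lemma grad_potential_measurable:
  assumes "C1c f" shows "grad_potential f \<in> borel_measurable borel"
proof -
  have [measurable]: "grad f \<in> borel_measurable borel" using assms by (intro grad_measurable) (simp add: C1c_def)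
  show ?thesis unfolding grad_potential_def[abs_def] by measurable
qed

lemma eventually_le_of_tendsto_ennreal:
  fixes a :: "nat \<Rightarrow> ennreal"
  assumes "a \<longlonglongrightarrow> l" "l < \<infinity>" "0 < e"
  shows "eventually (\<lambda>j. a j \<le> ennreal (enn2real l + e)) sequentially"
proof -
  have "l = ennreal (enn2real l)" using assms(2) by (simp add: less_top)
  also have "\<dots> < ennreal (enn2real l + e)" using assms(3) by (intro ennreal_lessI) (auto intro: add_nonneg_pos)
  finally have "eventually (\<lambda>j. a j < ennreal (enn2real l + e)) sequentially" using assms(1) by (intro order_tendstoD)
  then show ?thesis by eventually_elim simp
qed

text \<open>
  A controlled operator together with a weighted bound for the potentials. Here \<open>k\<close> is the operator norm of \<open>I\<^sub>1\<close>
  as a real number.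
\<close>
locale controlled_operator = function_norm N q
  for N :: "(real ^ 'n::finite) fun_norm" and q +
  fixes T :: "'n operator" and C k p :: real and u v :: "real ^ 'n \<Rightarrow> real"
  assumes C: "0 < C"
    and T_meas: "\<And>f. C1c f \<Longrightarrow> T f \<in> borel_measurable borel"
    and T_bound: "\<And>f x. C1c f \<Longrightarrow> \<bar>T f x\<bar> \<le> ereal (C * grad_potential f x)"
    and T_diff: "\<And>f g x \<epsilon>. C1c f \<Longrightarrow> C1c g \<Longrightarrow> 0 < \<epsilon> \<Longrightarrow> \<epsilon> \<le> 1 / 2 \<Longrightarrow> \<bar>T f x - T g x\<bar> \<le>
        ereal (C * (\<epsilon> * (grad_potential f x + grad_potential g x) + grad_potential (\<lambda>y. f y - g y) x / \<epsilon>))"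
    and v: "weight v" and p: "1 \<le> p" and k: "0 \<le> k"
    and potential: "\<And>f. C1c f \<Longrightarrow> N (weighted u) (\<lambda>x. ereal (grad_potential f x)) \<le> ennreal k * grad_norm p v f"
begin

abbreviation "M \<equiv> weighted u"
abbreviation "gn \<equiv> grad_norm p v"

text \<open>
  The function \<open>T f\<close> is finite everywhere, and is used through its real values.
\<close>
definition G :: "(real ^ 'n \<Rightarrow> real) \<Rightarrow> real ^ 'n \<Rightarrow> real" where
  "G f x = real_of_ereal (T f x)"

lemma T_eq: assumes f: "C1c f" shows "T f x = ereal (G f x)"
  using T_bound[OF f, of x] by (cases "T f x") (auto simp: G_def)

lemma G_meas: assumes "C1c f" shows "G f \<in> borel_measurable M"
  using T_meas[OF assms] unfolding G_def[abs_def] by (intro borel_measurable_weighted) measurable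

lemma potential_meas: "C1c f \<Longrightarrow> grad_potential f \<in> borel_measurable M"
  by (intro borel_measurable_weighted grad_potential_measurable)

lemma gn_finite: "C1c f \<Longrightarrow> gn f < \<infinity>"
  by (rule grad_norm_finite[OF v p])

lemma norm_T: assumes f: "C1c f" shows "N M (T f) \<le> ennreal (C * k) * gn f"
proof -
  note [measurable] = potential_meas[OF f]
  have "N M (T f) \<le> N M (\<lambda>x. ereal (C * grad_potential f x))"
  proof (rule mono)
    show "T f \<in> borel_measurable M" by (intro borel_measurable_weighted T_meas f)
    show "AE x in M. \<bar>T f x\<bar> \<le> \<bar>ereal (C * grad_potential f x)\<bar>"
      using T_bound[OF f] C by (intro always_eventually) (auto simp: grad_potential_nonneg abs_mult)
  qed measurable
  also have "\<dots> \<le> ennreal C * N M (\<lambda>x. ereal (grad_potential f x))" by (rule scale[OF potential_meas[OF f] C])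
  also have "\<dots> \<le> ennreal C * (ennreal k * gn f)" by (intro mult_left_mono potential f) simp
  also have "\<dots> = ennreal (C * k) * gn f" using C k by (simp add: ennreal_mult mult.assoc)
  finally show ?thesis .
qed

lemma norm_T_diff:
  assumes f: "C1c f" and g: "C1c g" and b: "gn f \<le> ennreal b" "gn g \<le> ennreal b" "0 \<le> b"
    and d: "gn (\<lambda>x. f x - g x) \<le> ennreal \<delta>" "0 \<le> \<delta>" and \<epsilon>: "0 < \<epsilon>" "\<epsilon> \<le> 1 / 2"
  shows "N M (\<lambda>x. ereal (G f x - G g x)) \<le> ennreal (C * (8 * \<epsilon> * k * b + 2 * k * \<delta> / \<epsilon>))"
proof -
  note fg = C1c_diff[OF f g]
  note [measurable] = potential_meas[OF f] potential_meas[OF g] potential_meas[OF fg] G_meas[OF f] G_meas[OF g]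
  let ?If = "grad_potential f" and ?Ig = "grad_potential g" and ?Id = "grad_potential (\<lambda>y. f y - g y)"
  have "N M (\<lambda>x. ereal (G f x - G g x)) \<le> N M (\<lambda>x. ereal (C * (\<epsilon> * (?If x + ?Ig x) + 1 / \<epsilon> * ?Id x)))"
  proof (rule mono)
    show "AE x in M. \<bar>ereal (G f x - G g x)\<bar> \<le> \<bar>ereal (C * (\<epsilon> * (?If x + ?Ig x) + 1 / \<epsilon> * ?Id x))\<bar>"
    proof (intro always_eventually allI)
      fix x
      have "\<bar>G f x - G g x\<bar> \<le> C * (\<epsilon> * (?If x + ?Ig x) + 1 / \<epsilon> * ?Id x)"
        using T_diff[OF f g \<epsilon>, of x] by (simp add: T_eq[OF f] T_eq[OF g])
      then show "\<bar>ereal (G f x - G g x)\<bar> \<le> \<bar>ereal (C * (\<epsilon> * (?If x + ?Ig x) + 1 / \<epsilon> * ?Id x))\<bar>" by simp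
    qed
  qed measurable
  also have "\<dots> \<le> ennreal C * N M (\<lambda>x. ereal (\<epsilon> * (?If x + ?Ig x) + 1 / \<epsilon> * ?Id x))"
    by (rule scale[OF _ C]) measurable
  also have "N M (\<lambda>x. ereal (\<epsilon> * (?If x + ?Ig x) + 1 / \<epsilon> * ?Id x))
    \<le> 2 * (N M (\<lambda>x. ereal (\<epsilon> * (?If x + ?Ig x))) + N M (\<lambda>x. ereal (1 / \<epsilon> * ?Id x)))"
    by (rule quasi_triangle) measurable
  also have "N M (\<lambda>x. ereal (\<epsilon> * (?If x + ?Ig x))) \<le> ennreal \<epsilon> * N M (\<lambda>x. ereal (?If x + ?Ig x))"
    by (rule scale[OF _ \<epsilon>(1)]) measurable
  also have "N M (\<lambda>x. ereal (?If x + ?Ig x)) \<le> 2 * (N M (\<lambda>x. ereal (?If x)) + N M (\<lambda>x. ereal (?Ig x)))"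
    by (rule quasi_triangle) measurable
  also have "N M (\<lambda>x. ereal (?If x)) \<le> ennreal k * ennreal b"
    by (rule order_trans[OF potential[OF f] mult_left_mono[OF b(1)]]) simp
  also have "N M (\<lambda>x. ereal (?Ig x)) \<le> ennreal k * ennreal b"
    by (rule order_trans[OF potential[OF g] mult_left_mono[OF b(2)]]) simp
  also have "N M (\<lambda>x. ereal (1 / \<epsilon> * ?Id x)) \<le> ennreal (1 / \<epsilon>) * N M (\<lambda>x. ereal (?Id x))"
    by (rule scale) (use \<epsilon> in auto)
  also have "N M (\<lambda>x. ereal (?Id x)) \<le> ennreal k * ennreal \<delta>"
    by (rule order_trans[OF potential[OF fg] mult_left_mono[OF d(1)]]) simp
  finally have "N M (\<lambda>x. ereal (G f x - G g x))
    \<le> ennreal C * (2 * (ennreal \<epsilon> * (2 * (ennreal k * ennreal b + ennreal k * ennreal b)) + ennreal (1 / \<epsilon>) * (ennreal k * ennreal \<delta>)))"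
    by (simp add: mult_left_mono add_mono)
  also have "\<dots> = ennreal (C * (2 * (\<epsilon> * (2 * (k * b + k * b)) + 1 / \<epsilon> * (k * \<delta>))))"
  proof -
    have 2: "(2 :: ennreal) = ennreal 2" by simp
    show ?thesis
      unfolding 2 using C k b d \<epsilon>
      by (simp only: ennreal_mult[symmetric] ennreal_plus[symmetric] mult_nonneg_nonneg add_nonneg_nonneg
          zero_le_numeral less_imp_le zero_le_divide_iff zero_le_one simp_thms)
  qed
  also have "C * (2 * (\<epsilon> * (2 * (k * b + k * b)) + 1 / \<epsilon> * (k * \<delta>))) = C * (8 * \<epsilon> * k * b + 2 * k * \<delta> / \<epsilon>)"
    by (simp add: algebra_simps)
  finally show ?thesis .
qed

text \<open>
  First \<open>\<epsilon>\<close> is chosen to make the terms with \<open>f\<close> and \<open>g\<close> small, then \<open>\<delta>\<close> depending on \<open>\<epsilon>\<close>.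
\<close>
lemma uniformly_continuous_on_bounded:
  assumes "0 < \<eta>" "0 \<le> b"
  shows "\<exists>\<delta>>0. \<forall>f g. C1c f \<longrightarrow> C1c g \<longrightarrow> gn f \<le> ennreal b \<longrightarrow> gn g \<le> ennreal b \<longrightarrow>
    gn (\<lambda>x. f x - g x) \<le> ennreal \<delta> \<longrightarrow> N M (\<lambda>x. ereal (G f x - G g x)) \<le> ennreal \<eta>"
proof -
  define \<epsilon> where "\<epsilon> = min (1 / 2) (\<eta> / (16 * C * (k * b + 1)))"
  define \<delta> where "\<delta> = \<eta> * \<epsilon> / (4 * C * (k + 1))"
  have kb: "0 < k * b + 1" using k assms by (auto intro: add_nonneg_pos)
  have \<epsilon>: "0 < \<epsilon>" "\<epsilon> \<le> 1 / 2" using assms C kb by (auto simp: \<epsilon>_def)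
  have \<delta>: "0 < \<delta>" using assms C k \<epsilon> by (auto simp: \<delta>_def)
  have "C * (8 * \<epsilon> * k * b) \<le> \<eta> / 2"
  proof -
    have "\<epsilon> \<le> \<eta> / (16 * C * (k * b + 1))" by (simp add: \<epsilon>_def)
    then have "\<epsilon> * (16 * C * (k * b + 1)) \<le> \<eta>" using C kb by (simp add: pos_le_divide_eq)
    moreover have "0 \<le> 16 * C * \<epsilon>" using C \<epsilon> by simp
    ultimately show ?thesis by (simp add: algebra_simps)
  qed
  moreover have "C * (2 * k * \<delta> / \<epsilon>) \<le> \<eta> / 2"
  proof -
    have "C * (2 * k * (\<eta> * \<epsilon> / (4 * C * K)) / \<epsilon>) = \<eta> / 2 * (k / K)" if "0 < K" for K
      using C \<epsilon> that by (simp add: field_simps)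
    from this[of "k + 1"] have "C * (2 * k * \<delta> / \<epsilon>) = \<eta> / 2 * (k / (k + 1))"
      unfolding \<delta>_def using k by linarith
    also have "\<dots> \<le> \<eta> / 2 * 1" using assms k by (intro mult_left_mono) auto
    finally show ?thesis by simp
  qed
  ultimately have le: "C * (8 * \<epsilon> * k * b + 2 * k * \<delta> / \<epsilon>) \<le> \<eta>" by (simp add: distrib_left)
  show ?thesis
  proof (intro exI[of _ \<delta>] conjI \<delta> allI impI)
    fix f g assume "C1c f" "C1c g" "gn f \<le> ennreal b" "gn g \<le> ennreal b" "gn (\<lambda>x. f x - g x) \<le> ennreal \<delta>"
    then have "N M (\<lambda>x. ereal (G f x - G g x)) \<le> ennreal (C * (8 * \<epsilon> * k * b + 2 * k * \<delta> / \<epsilon>))"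
      using assms \<delta> by (intro norm_T_diff \<epsilon>) auto
    also have "\<dots> \<le> ennreal \<eta>" using le by (rule ennreal_leI)
    finally show "N M (\<lambda>x. ereal (G f x - G g x)) \<le> ennreal \<eta>" .
  qed
qed

text \<open>
  The image of a Cauchy sequence is Cauchy, since Cauchy sequences are bounded and \<open>T\<close> is uniformly continuous on
  bounded sets. The same property shows that equivalent sequences have the same limit.
\<close>
lemma extension:
  assumes F: "F \<in> sobolev p v"
  shows "\<exists>h. density_ext T N u F h \<and> N M (\<lambda>x. ereal (h x)) \<le> ennreal (C * k) * sobolev_norm p v F"
proof -
  let ?l = "sobolev_norm p v F"
  let ?b = "enn2real ?l + 1"
  obtain \<phi> where \<phi>: "sobolev_Cauchy p v \<phi>" and rel: "\<forall>\<psi>\<in>F. (\<phi>, \<psi>) \<in> sobolev_rel p v"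
    and lim: "(\<lambda>j. gn (\<phi> j)) \<longlonglongrightarrow> ?l" and fin: "?l < \<infinity>"
    by (rule sobolev_cases[OF v p F])
  note C\<phi> = sobolev_Cauchy_C1c[OF \<phi>]
  have b0: "0 \<le> ?b" by simp
  have bounded: "eventually (\<lambda>j. gn (\<psi> j) \<le> ennreal ?b) sequentially" if "(\<lambda>j. gn (\<psi> j)) \<longlonglongrightarrow> ?l" for \<psi>
    by (rule eventually_le_of_tendsto_ennreal[OF that fin]) simp
  have "\<exists>J. \<forall>i\<ge>J. \<forall>j\<ge>J. N M (\<lambda>x. ereal (G (\<phi> i) x - G (\<phi> j) x)) \<le> ennreal \<eta>" if \<eta>: "0 < \<eta>" for \<eta>
  proof -
    obtain \<delta> where \<delta>: "0 < \<delta>" and uc': "\<forall>f g. C1c f \<longrightarrow> C1c g \<longrightarrow> gn f \<le> ennreal ?b \<longrightarrow> gn g \<le> ennreal ?b \<longrightarrow>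
      gn (\<lambda>x. f x - g x) \<le> ennreal \<delta> \<longrightarrow> N M (\<lambda>x. ereal (G f x - G g x)) \<le> ennreal \<eta>"
      using uniformly_continuous_on_bounded[OF \<eta> b0] by blast
    note uc = uc'[rule_format]
    obtain J0 where J0: "\<And>j. J0 \<le> j \<Longrightarrow> gn (\<phi> j) \<le> ennreal ?b"
      using bounded[OF lim] unfolding eventually_sequentially by blast
    obtain J1 where J1: "\<And>i j. J1 \<le> i \<Longrightarrow> J1 \<le> j \<Longrightarrow> gn (\<lambda>x. \<phi> i x - \<phi> j x) < ennreal \<delta>"
      using \<phi> \<delta> unfolding sobolev_Cauchy_def by blast
    have "N M (\<lambda>x. ereal (G (\<phi> i) x - G (\<phi> j) x)) \<le> ennreal \<eta>" if "max J0 J1 \<le> i" "max J0 J1 \<le> j" for i j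
      using that by (intro uc C\<phi> J0 less_imp_le[OF J1]) auto
    then show ?thesis by blast
  qed
  then obtain h s where h[measurable]: "h \<in> borel_measurable M" and s: "strict_mono s"
    and ae: "AE x in M. (\<lambda>k. G (\<phi> (s k)) x) \<longlonglongrightarrow> h x" and conv: "(\<lambda>j. N M (\<lambda>x. ereal (G (\<phi> j) x - h x))) \<longlonglongrightarrow> 0"
    by (rule complete[of "\<lambda>j. G (\<phi> j)" M, OF G_meas[OF C\<phi>]])
  have bound: "N M (\<lambda>x. ereal (h x)) \<le> ennreal (C * k) * ?l"
  proof (rule ennreal_le_epsilon)
    fix e :: real assume e: "0 < e"
    have "(\<lambda>j. ennreal (C * k) * gn (\<phi> j)) \<longlonglongrightarrow> ennreal (C * k) * ?l"
      by (intro ennreal_tendsto_cmult lim) simp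
    from LIMSEQ_subseq_LIMSEQ[OF this s]
    have "(\<lambda>j. ennreal (C * k) * gn (\<phi> (s j))) \<longlonglongrightarrow> ennreal (C * k) * ?l" by (simp add: comp_def)
    from eventually_le_of_tendsto_ennreal[OF this _ e]
    have "eventually (\<lambda>j. ennreal (C * k) * gn (\<phi> (s j)) \<le> ennreal (enn2real (ennreal (C * k) * ?l) + e)) sequentially"
      using fin by (simp add: ennreal_mult_less_top)
    then obtain J where J: "\<And>j. J \<le> j \<Longrightarrow> ennreal (C * k) * gn (\<phi> (s j)) \<le> ennreal (enn2real (ennreal (C * k) * ?l) + e)"
      unfolding eventually_sequentially by blast
    have "N M (\<lambda>x. ereal (h x)) \<le> ennreal (enn2real (ennreal (C * k) * ?l) + e)"
    proof (rule fatou[where f = "\<lambda>j. G (\<phi> (s (j + J)))"])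
      show "AE x in M. (\<lambda>j. G (\<phi> (s (j + J))) x) \<longlonglongrightarrow> h x"
        using ae by eventually_elim (rule LIMSEQ_ignore_initial_segment)
      fix j
      have "(\<lambda>x. ereal (G (\<phi> (s (j + J))) x)) = T (\<phi> (s (j + J)))" using T_eq[OF C\<phi>] by auto
      then show "N M (\<lambda>x. ereal (G (\<phi> (s (j + J))) x)) \<le> ennreal (enn2real (ennreal (C * k) * ?l) + e)"
        using order_trans[OF norm_T[OF C\<phi>] J[of "j + J"]] by simp
    qed (use G_meas[OF C\<phi>] e h in auto)
    also have "\<dots> = ennreal (C * k) * ?l + ennreal e"
    proof -
      have "ennreal (C * k) * ?l < top" using fin by (simp add: ennreal_mult_less_top)
      then have "ennreal (enn2real (ennreal (C * k) * ?l)) = ennreal (C * k) * ?l" by (rule ennreal_enn2real)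
      then show ?thesis using e by (simp add: ennreal_plus)
    qed
    finally show "N M (\<lambda>x. ereal (h x)) \<le> ennreal (C * k) * ?l + ennreal e" .
  qed
  have "density_ext T N u F h"
    unfolding density_ext_def
  proof (intro conjI ballI)
    have "N M (\<lambda>x. ereal (h x)) < \<infinity>"
      by (rule le_less_trans[OF bound]) (use fin in \<open>simp add: ennreal_mult_less_top\<close>)
    then show "(\<lambda>x. ereal (h x)) \<in> fun_space N M" by (simp add: fun_space_def)
    fix \<psi> assume "\<psi> \<in> F"
    note r = bspec[OF rel this]
    have C\<psi>: "C1c (\<psi> j)" for j using r by (auto simp: sobolev_rel_def intro: sobolev_Cauchy_C1c)
    note lim\<psi> = sobolev_rel_limit[OF v p r lim]
    have d: "(\<lambda>j. gn (\<lambda>x. \<phi> j x - \<psi> j x)) \<longlonglongrightarrow> 0" using r by (simp add: sobolev_rel_def)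
    show "(\<lambda>j. N M (\<lambda>x. T (\<psi> j) x - ereal (h x))) \<longlonglongrightarrow> 0"
    proof (rule tendsto_zero_ennreal)
      fix \<rho> :: real assume \<rho>: "0 < \<rho>"
      then have \<rho>8: "0 < \<rho> / 8" by simp
      obtain \<delta> where \<delta>: "0 < \<delta>" and uc': "\<forall>f g. C1c f \<longrightarrow> C1c g \<longrightarrow> gn f \<le> ennreal ?b \<longrightarrow> gn g \<le> ennreal ?b \<longrightarrow>
        gn (\<lambda>x. f x - g x) \<le> ennreal \<delta> \<longrightarrow> N M (\<lambda>x. ereal (G f x - G g x)) \<le> ennreal (\<rho> / 8)"
        using uniformly_continuous_on_bounded[OF \<rho>8 b0] by blast
      note uc = uc'[rule_format]
      have e1: "eventually (\<lambda>j. gn (\<lambda>x. \<phi> j x - \<psi> j x) < ennreal \<delta>) sequentially"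
        using \<delta> by (intro order_tendstoD(2)[OF d]) simp
      have e2: "eventually (\<lambda>j. N M (\<lambda>x. ereal (G (\<phi> j) x - h x)) < ennreal (\<rho> / 8)) sequentially"
        using \<rho>8 by (intro order_tendstoD(2)[OF conv]) simp
      show "eventually (\<lambda>j. N M (\<lambda>x. T (\<psi> j) x - ereal (h x)) < ennreal \<rho>) sequentially"
        using e1 e2 bounded[OF lim] bounded[OF lim\<psi>]
      proof eventually_elim
        case (elim j)
        note [measurable] = G_meas[OF C\<phi>] G_meas[OF C\<psi>]
        have "N M (\<lambda>x. T (\<psi> j) x - ereal (h x)) = N M (\<lambda>x. ereal ((G (\<psi> j) x - G (\<phi> j) x) + (G (\<phi> j) x - h x)))"
          by (simp add: T_eq[OF C\<psi>])
        also have "\<dots> \<le> 2 * (N M (\<lambda>x. ereal (G (\<psi> j) x - G (\<phi> j) x)) + N M (\<lambda>x. ereal (G (\<phi> j) x - h x)))"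
          by (rule quasi_triangle) measurable
        also have "\<dots> \<le> 2 * (ennreal (\<rho> / 8) + ennreal (\<rho> / 8))"
        proof (intro mult_left_mono add_mono)
          show "N M (\<lambda>x. ereal (G (\<psi> j) x - G (\<phi> j) x)) \<le> ennreal (\<rho> / 8)"
            using elim by (intro uc C\<phi> C\<psi>) (auto simp: grad_norm_diff_commute[OF C\<psi> C\<phi>])
        qed (use elim in auto)
        also have "\<dots> = ennreal (2 * (\<rho> / 8 + \<rho> / 8))"
        proof -
          have "ennreal 2 * ennreal (\<rho> / 8 + \<rho> / 8) = ennreal (2 * (\<rho> / 8 + \<rho> / 8))"
            using \<rho> by (intro ennreal_mult[symmetric]) auto
          moreover have "ennreal (\<rho> / 8 + \<rho> / 8) = ennreal (\<rho> / 8) + ennreal (\<rho> / 8)"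
            using \<rho> by (intro ennreal_plus) auto
          ultimately show ?thesis by simp
        qed
        also have "\<dots> < ennreal \<rho>" using \<rho> by (intro ennreal_lessI) auto
        finally show ?case .
      qed
    qed
  qed
  with bound show ?thesis by blast
qed

lemma sobolev_maps: "sobolev_maps T p v N u (ennreal (C * k))"
  unfolding sobolev_maps_def
proof (intro conjI allI impI ballI)
  fix f :: "real^'n \<Rightarrow> real" assume "test_fun f"
  then have f: "C1c f" by (rule test_fun_C1c)
  show le: "N M (T f) \<le> ennreal (C * k) * gn f" by (rule norm_T[OF f])
  have "N M (T f) < \<infinity>"
    by (rule le_less_trans[OF le]) (use gn_finite[OF f] in \<open>simp add: ennreal_mult_less_top\<close>)
  then show "T f \<in> fun_space N M"
    by (simp add: fun_space_def borel_measurable_weighted T_meas[OF f])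
qed (rule extension)

end

lemma sobolev_maps_of_controlled:
  fixes T :: "'n::finite operator"
  assumes "controlled_by_riesz T"
  obtains C where "0 < C"
    "\<And>N q p u v. function_norm N q \<Longrightarrow> weight v \<Longrightarrow> 1 \<le> p \<Longrightarrow> I1_bounded p v N u \<Longrightarrow>
      sobolev_maps T p v N u (ennreal C * I1_norm p v N u)"
proof -
  obtain C0 where C0: "0 \<le> C0"
    and T: "\<And>f g. C1c f \<Longrightarrow> C1c g \<Longrightarrow> T f \<in> borel_measurable borel \<and>
     (\<forall>x. \<bar>T f x\<bar> \<le> ereal (C0 * grad_potential f x)) \<and>
     (\<forall>x \<epsilon>. 0 < \<epsilon> \<longrightarrow> \<epsilon> \<le> 1 / 2 \<longrightarrow> \<bar>T f x - T g x\<bar> \<le>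
        ereal (C0 * (\<epsilon> * (grad_potential f x + grad_potential g x) + grad_potential (\<lambda>y. f y - g y) x / \<epsilon>)))"
    using assms unfolding controlled_by_riesz_def by blast
  have up: "ereal (C0 * a) \<le> ereal ((C0 + 1) * a)" if "0 \<le> a" for a
    using that by (simp add: distrib_right)
  show ?thesis
  proof (rule that[of "C0 + 1"])
    show "0 < C0 + 1" using C0 by simp
    fix N :: "(real^'n) fun_norm" and q p :: real and u v :: "real^'n \<Rightarrow> real"
    assume N: "function_norm N q" and v: "weight v" and p: "1 \<le> p" and bdd: "I1_bounded p v N u"
    define k where "k = enn2real (I1_norm p v N u)"
    have k_eq: "I1_norm p v N u = ennreal k" "0 \<le> k" using I1_norm_finite[OF bdd] by (auto simp: k_def less_top)
    interpret function_norm N q by (rule N)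
    interpret controlled_operator N q T "C0 + 1" k p u v
    proof
      show "0 < C0 + 1" using C0 by simp
      fix f g :: "real^'n \<Rightarrow> real" and x
      assume f: "C1c f"
      show "T f \<in> borel_measurable borel" using T[OF f f] by blast
      show "\<bar>T f x\<bar> \<le> ereal ((C0 + 1) * grad_potential f x)"
        using T[OF f f] up[OF grad_potential_nonneg] order_trans by blast
      show "N (weighted u) (\<lambda>x. ereal (grad_potential f x)) \<le> ennreal k * grad_norm p v f"
        using grad_potential_norm_le[OF v p f bdd] k_eq by simp
      fix \<epsilon> :: real assume g: "C1c g" and \<epsilon>: "0 < \<epsilon>" "\<epsilon> \<le> 1 / 2"
      have "0 \<le> \<epsilon> * (grad_potential f x + grad_potential g x) + grad_potential (\<lambda>y. f y - g y) x / \<epsilon>"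
        using \<epsilon> by (simp add: grad_potential_nonneg)
      then show "\<bar>T f x - T g x\<bar> \<le>
        ereal ((C0 + 1) * (\<epsilon> * (grad_potential f x + grad_potential g x) + grad_potential (\<lambda>y. f y - g y) x / \<epsilon>))"
        using T[OF f g] \<epsilon> up order_trans by blast
    qed (use v p k_eq in auto)
    show "sobolev_maps T p v N u (ennreal (C0 + 1) * I1_norm p v N u)"
    proof -
      have "ennreal ((C0 + 1) * k) = ennreal (C0 + 1) * ennreal k" by (rule ennreal_mult) (use C0 k_eq in auto)
      with sobolev_maps show ?thesis unfolding k_eq(1) by (simp only:)
    qed
  qed
qed

section \<open>The two-weight inequality\<close>

theorem corollary1p5:
  fixes T :: "'n::finite operator" and p q :: real
  assumes "2 \<le> CARD('n)" and "1 \<le> p" and "1 \<le> q"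
    and "T = max_HL \<or> (\<exists>k\<ge>1. T = max_iter k) \<or> T = max_lorentz \<or> T = max_sphere
      \<or> (\<exists>\<Omega>. rough_kernel \<Omega> \<and> T = max_rough \<Omega>)
      \<or> (\<exists>\<Omega>. rough_kernel \<Omega> \<and> mean_zero \<Omega> \<and> (T = sing_rough \<Omega> \<or> T = max_sing_rough \<Omega>))"
  shows "\<exists>C>0. \<forall>u v. weight u \<longrightarrow> weight v \<longrightarrow>
    (I1_bounded p v (Lq_norm q) u \<longrightarrow>
       sobolev_maps T p v (Lq_norm q) u (ennreal C * I1_norm p v (Lq_norm q) u)) \<and>
    (I1_bounded p v (weak_Lq_norm q) u \<longrightarrow>
       sobolev_maps T p v (weak_Lq_norm q) u (ennreal C * I1_norm p v (weak_Lq_norm q) u))"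
proof -
  have "controlled_by_riesz (max_HL :: 'n operator)" unfolding max_HL_eq by (rule controlled_max_iter) simp
  then have "controlled_by_riesz T"
    using assms(4) controlled_max_iter controlled_max_lorentz[OF assms(1)] controlled_max_sphere
      controlled_max_rough[OF assms(1)] controlled_sing_rough[OF assms(1)] controlled_max_sing_rough[OF assms(1)]
    by (elim disjE exE conjE) auto
  then obtain C where "0 < C" and C: "\<And>N q p u v. function_norm N q \<Longrightarrow> weight v \<Longrightarrow> 1 \<le> p \<Longrightarrow> I1_bounded p v N u \<Longrightarrow>
      sobolev_maps T p v N u (ennreal C * I1_norm p v N u)"
    by (rule sobolev_maps_of_controlled) blast
  show ?thesis
    using C[OF function_norm_Lq[OF assms(3)] _ assms(2)] C[OF function_norm_weak_Lq[OF assms(3)] _ assms(2)] \<open>0 < C\<close>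
    by (intro exI[of _ C]) auto
qed

end
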